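(* Let $0<\epsilon<\frac{44}{2025}$, let $\alpha>1$ be an irrational real number and $\beta\geq 0$ real. Let $M_{\frac54\epsilon}>0$ be a constant such that $d(x)\leq M_{\frac54\epsilon}\,x^{\frac54\epsilon}$ for every positive integer $x$, and let $\ell$ be the least positive integer satisfying $$ \ell \geq 3 + 9\epsilon^{-1}\left(41+\log\left(1+\epsilon^{-1}\right)+\log\left(3711+2\cdot 17^{-3}M_{\frac54\epsilon}\right)\right). $$ Then the least prime $p$ in the Beatty sequence $\mathcal{B}(\alpha,\beta)$ satisfies $$ p \leq \mathcal{L}^{35-16\epsilon}\,\alpha^{2(1-\epsilon)}\, B\, p_{m+\ell}^{1+\epsilon}, $$ where $B=\max\{1,\beta\}$, $\mathcal{L}=\log(2\alpha B)$, $p_n$ denotes the numerator of the $n$-th convergent of the regular continued fraction expansion of $\alpha$, and $m$ is the unique integer such that $p_m \leq \mathcal{L}^{16}\alpha^2 < p_{m+1}$.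
   Context: $d(x)$ denotes the number of positive divisors of the positive integer $x$. For a positive real $\alpha$ and a non-negative real $\beta$, the Beatty sequence is $\mathcal{B}(\alpha,\beta)=\{\lfloor n\alpha+\beta\rfloor : n\in\mathbb{N}\}$, where $\lfloor x\rfloor$ is the largest integer $\leq x$ and $\mathbb{N}=\{1,2,\dots\}$. If $\alpha=[a_0;a_1,a_2,\ldots]$ is the regular continued fraction expansion of $\alpha$, the numerators of its convergents are given by $p_{-1}=1$, $p_0=a_0=\lfloor\alpha\rfloor$, $p_{n+1}=a_{n+1}p_n+p_{n-1}$ for $n\geq 0$; they are strictly increasing integers.
   Formalization: The bound is stated for those α, β for which an integer m ≥ −1 with p_m ≤ L^16 α^2 < p_{m+1} exists; when L^16 α^2 < 1 (αB below about 1.31, e.g. α near 1, β = 0) there is no such m, since all p_n ≥ 1, and the claimed bound is undefined. *)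

theory Defs
  imports Complex_Main "HOL-Computational_Algebra.Primes"
begin

definition num_divisors :: "nat \<Rightarrow> nat" where
  "num_divisors x = card {d. d dvd x}"

definition beatty :: "real \<Rightarrow> real \<Rightarrow> int set" where
  "beatty \<alpha> \<beta> = {\<lfloor>real n * \<alpha> + \<beta>\<rfloor> | n::nat. n \<ge> 1}"

text \<open>
  Regular continued fraction of an irrational \<open>\<alpha> = [a\<^sub>0; a\<^sub>1, a\<^sub>2, \<dots>]\<close>: the \<open>n\<close>-th complete
  quotient is \<open>[a\<^sub>n; a\<^sub>n\<^sub>+\<^sub>1, \<dots>]\<close>, and \<open>a\<^sub>n\<close> is its integer part.
\<close>

primrec complete_quotient :: "real \<Rightarrow> nat \<Rightarrow> real" where
  "complete_quotient \<alpha> 0 = \<alpha>"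
| "complete_quotient \<alpha> (Suc n) = 1 / frac (complete_quotient \<alpha> n)"

definition partial_quotient :: "real \<Rightarrow> nat \<Rightarrow> int" where
  "partial_quotient \<alpha> n = \<lfloor>complete_quotient \<alpha> n\<rfloor>"

text \<open>The numerators \<open>p\<^sub>-\<^sub>1, p\<^sub>0, p\<^sub>1, \<dots>\<close>, listed with the index shifted by one.\<close>

fun conv_num_shift :: "real \<Rightarrow> nat \<Rightarrow> int" where
  "conv_num_shift \<alpha> 0 = 1"
| "conv_num_shift \<alpha> (Suc 0) = partial_quotient \<alpha> 0"
| "conv_num_shift \<alpha> (Suc (Suc n)) =
     partial_quotient \<alpha> (Suc n) * conv_num_shift \<alpha> (Suc n) + conv_num_shift \<alpha> n"

text \<open>The numerator \<open>p\<^sub>k\<close>, meaningful only for \<open>k \<ge> -1\<close>.\<close>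

definition conv_num :: "real \<Rightarrow> int \<Rightarrow> int" where
  "conv_num \<alpha> k = conv_num_shift \<alpha> (nat (k + 1))"

lemma conv_num_initial:
  "conv_num \<alpha> (-1) = 1" "conv_num \<alpha> 0 = \<lfloor>\<alpha>\<rfloor>"
  by (simp_all add: conv_num_def partial_quotient_def)

lemma conv_num_rec:
  "conv_num \<alpha> (int n + 1) =
     partial_quotient \<alpha> (n + 1) * conv_num \<alpha> (int n) + conv_num \<alpha> (int n - 1)"
proof -
  have "nat (int n + 1 + 1) = Suc (Suc n)" "nat (int n + 1) = Suc n" "nat (int n - 1 + 1) = n"
    by linarith+
  then show ?thesis by (simp add: conv_num_def)
qed

definition is_least_prime_in :: "int \<Rightarrow> int set \<Rightarrow> bool" where
  "is_least_prime_in p S \<longleftrightarrow> p \<in> S \<and> prime p \<and> (\<forall>q\<in>S. prime q \<longrightarrow> p \<le> q)"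

end

theory Submission
  imports Defs "HOL-Analysis.Harmonic_Numbers" "HOL-Analysis.Complex_Transcendental"
    "HOL-Number_Theory.Prime_Powers" "HOL-Computational_Algebra.Squarefree"
begin

text \<open>
  A prime \<open>p > \<beta>\<close> lies in the Beatty sequence as soon as \<open>(p + 1/2 - \<beta>) / \<alpha>\<close> is within \<open>1 / (2\<alpha>)\<close> of an
  integer. A trigonometric polynomial of degree \<open>H = \<lceil>2\<alpha>\<rceil>\<close> that is nonpositive away from the integers
  reduces the search for such a prime to a saving of a factor of order \<open>H\<close> over the trivial bound for
  \<open>\<Sum>h\<le>H. |\<Sum>n\<le>N. \<Lambda>(n) e(hn/\<alpha>)|\<close>. Vaughan's identity splits the inner sum into bilinear sums; in the
  sums of type II the frequency \<open>h\<close> is merged with the inner variable before the Cauchy--Schwarz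
  inequality is applied, and the resulting multiples of \<open>1/\<alpha>\<close> are well spaced modulo one up to half
  of \<open>q\<close>, the numerator of a convergent of \<open>\<alpha>\<close>. Only a mean value of divisor functions enters, so the
  losses are powers of \<open>log N\<close>. With \<open>q = p\<^sub>n\<close> for an \<open>n\<close> about halfway between \<open>m\<close> and \<open>m + \<ell>\<close>, both
  \<open>p\<^sub>n / p\<^sub>m\<^sub>+\<^sub>1\<close> and \<open>p\<^sub>m\<^sub>+\<^sub>\<ell> / p\<^sub>n\<close> are at least \<open>2\<close> to the power of about \<open>\<ell> / 4\<close>, and as \<open>\<ell>\<close> is a large multiple
  of \<open>1 / \<epsilon>\<close>, this absorbs all constants and logarithms.
\<close>

subsection \<open>Vaughan's identity\<close>

text \<open>The size of q is decided by the saving of order H. If each frequency were treated alone,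
  every single sum would have to be smaller by a factor H; after merging, the bound is that of one
  bilinear sum of length H N, and q has to exceed H^2 only by powers of logarithms, which is the
  range that the threshold defining m provides. The sums of type I can be estimated for each h,
  since their loss fits into the same condition.

  The logarithms are not bounded by multiples of ln (2 \<alpha> B): with large partial quotients, q
  may be huge compared with \<alpha> and B. With W = ln (2 \<alpha> B)^16 \<alpha>^2, the threshold
  in question, and d = ln (q / W), all logarithms are at most a constant times d ln (2 \<alpha> B).
  The powers of ln (2 \<alpha> B) appear in the result, and the powers of d are paid by (q /
  W)^\<epsilon>. Hence the form of the result: the negative \<epsilon> parts of its exponents divide
  the \<epsilon>-th power of a numerator by W^\<epsilon>.\<close>

lemma sum_divisors_swap:
  fixes G :: "nat \<Rightarrow> nat \<Rightarrow> 'a::comm_monoid_add"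
  shows "(\<Sum>n=1..N. \<Sum>d | d dvd n. G d (n div d)) = (\<Sum>d=1..N. \<Sum>k=1..N div d. G d k)"
proof -
  have "(\<Sum>n=1..N. \<Sum>d | d dvd n. G d (n div d)) =
        (\<Sum>(n, d)\<in>(SIGMA n:{1..N}. {d. d dvd n}). G d (n div d))"
    by (rule sum.Sigma) auto
  also have "\<dots> = (\<Sum>(d, k)\<in>(SIGMA d:{1..N}. {1..N div d}). G d k)"
  proof (rule sum.reindex_bij_witness[of _ "\<lambda>(d, k). (d * k, d)" "\<lambda>(n, d). (d, n div d)"])
    fix x assume "x \<in> (SIGMA n:{1..N}. {d. d dvd n})"
    then obtain n d where x: "x = (n, d)" and n: "n \<in> {1..N}" and d: "d dvd n" by auto
    have "d > 0" "d \<le> n" using n d by (auto intro: dvd_pos_nat dvd_imp_le)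
    then show "(case case x of (n, d) \<Rightarrow> (d, n div d) of (d, k) \<Rightarrow> (d * k, d)) = x"
      "(case x of (n, d) \<Rightarrow> (d, n div d)) \<in> (SIGMA d:{1..N}. {1..N div d})"
      "(case case x of (n, d) \<Rightarrow> (d, n div d) of (d, k) \<Rightarrow> G d k) = (case x of (n, d) \<Rightarrow> G d (n div d))"
      unfolding x using n d by (auto simp: Suc_le_eq div_greater_zero_iff intro: div_le_mono)
  next
    fix x assume "x \<in> (SIGMA d:{1..N}. {1..N div d})"
    then obtain d k where x: "x = (d, k)" and d: "d \<in> {1..N}" "k \<in> {1..N div d}" by auto
    then show "(case case x of (d, k) \<Rightarrow> (d * k, d) of (n, d) \<Rightarrow> (d, n div d)) = x"
      "(case x of (d, k) \<Rightarrow> (d * k, d)) \<in> (SIGMA n:{1..N}. {d. d dvd n})"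
      unfolding x by (auto simp: less_eq_div_iff_mult_less_eq mult.commute)
  qed
  also have "\<dots> = (\<Sum>d=1..N. \<Sum>k=1..N div d. G d k)"
    by (rule sum.Sigma[symmetric]) auto
  finally show ?thesis .
qed

text \<open>Both sides run over the pairs with m d dividing n; the right one groups them by r = m d.
  This is associativity of Dirichlet convolution.\<close>

lemma sum_divisor_pairs:
  fixes F :: "nat \<Rightarrow> nat \<Rightarrow> 'a::comm_monoid_add"
  assumes "n > 0"
  shows "(\<Sum>m | m dvd n. \<Sum>d | d dvd n div m. F m d) = (\<Sum>r | r dvd n. \<Sum>m | m dvd r. F m (r div m))"
proof -
  have "(\<Sum>m | m dvd n. \<Sum>d | d dvd n div m. F m d) =
        (\<Sum>(m, d)\<in>(SIGMA m:{m. m dvd n}. {d. d dvd n div m}). F m d)"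
    using assms by (intro sum.Sigma) (auto simp: div_greater_zero_iff dest: dvd_imp_le)
  also have "\<dots> = (\<Sum>(r, m)\<in>(SIGMA r:{r. r dvd n}. {m. m dvd r}). F m (r div m))"
  proof (rule sum.reindex_bij_witness[of _ "\<lambda>(r, m). (m, r div m)" "\<lambda>(m, d). (m * d, m)"])
    fix x assume "x \<in> (SIGMA m:{m. m dvd n}. {d. d dvd n div m})"
    then obtain m d where x: "x = (m, d)" and m: "m dvd n" and d: "d dvd n div m" by auto
    have "m > 0" using m assms by (rule dvd_pos_nat[rotated])
    moreover have "m * d dvd n" using m d \<open>m > 0\<close> by (simp add: dvd_div_iff_mult mult.commute)
    ultimately show "(case case x of (m, d) \<Rightarrow> (m * d, m) of (r, m) \<Rightarrow> (m, r div m)) = x"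
      "(case x of (m, d) \<Rightarrow> (m * d, m)) \<in> (SIGMA r:{r. r dvd n}. {m. m dvd r})"
      "(case case x of (m, d) \<Rightarrow> (m * d, m) of (r, m) \<Rightarrow> F m (r div m)) = (case x of (m, d) \<Rightarrow> F m d)"
      unfolding x by simp_all
  next
    fix x assume "x \<in> (SIGMA r:{r. r dvd n}. {m. m dvd r})"
    then obtain r m where x: "x = (r, m)" and r: "r dvd n" and m: "m dvd r" by auto
    have "m dvd n" "r div m dvd n div m" using r m by (auto intro: dvd_trans div_dvd_div[THEN iffD2])
    then show "(case case x of (r, m) \<Rightarrow> (m, r div m) of (m, d) \<Rightarrow> (m * d, m)) = x"
      "(case x of (r, m) \<Rightarrow> (m, r div m)) \<in> (SIGMA m:{m. m dvd n}. {d. d dvd n div m})"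
      unfolding x using m by simp_all
  qed
  also have "\<dots> = (\<Sum>r | r dvd n. \<Sum>m | m dvd r. F m (r div m))"
    using assms by (intro sum.Sigma[symmetric]) (auto intro: finite_divisors_nat dvd_pos_nat)
  finally show ?thesis .
qed

lemma sum_divisor_pairs_swap:
  fixes F :: "nat \<Rightarrow> nat \<Rightarrow> 'a::comm_monoid_add"
  assumes "n > 0"
  shows "(\<Sum>m | m dvd n. \<Sum>d | d dvd n div m. F m d) = (\<Sum>d | d dvd n. \<Sum>m | m dvd n div d. F m d)"
proof -
  have "(\<Sum>m | m dvd r. F m (r div m)) = (\<Sum>m | m dvd r. F (r div m) m)" if "r dvd n" for r
    using dvd_pos_nat[OF assms that]
    by (intro sum.reindex_bij_witness[of _ "\<lambda>m. r div m" "\<lambda>m. r div m"]) auto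
  then show ?thesis
    using sum_divisor_pairs[OF assms, of F] sum_divisor_pairs[OF assms, of "\<lambda>m d. F d m"] by simp
qed

section \<open>The Moebius function, its truncations and the resulting identity\<close>

definition moebius_mu :: "nat \<Rightarrow> real" where
  "moebius_mu n = (if squarefree n then (-1) ^ card (prime_factors n) else 0)"

lemma moebius_mu_1: "moebius_mu (Suc 0) = 1"
  by (simp add: moebius_mu_def)

lemma abs_moebius_le: "\<bar>moebius_mu n\<bar> \<le> 1"
  by (simp add: moebius_mu_def)

lemma moebius_prime_times:
  assumes "prime p" "\<not> p dvd d" "squarefree d"
  shows "moebius_mu (p * d) = - moebius_mu d"
proof -
  have "coprime p d" using assms prime_imp_coprime by blast
  moreover have "squarefree p" using assms squarefree_prime by blast
  ultimately have sq: "squarefree (p * d)"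
    using assms squarefree_mult_coprime by blast
  have "d \<noteq> 0" using assms by (metis dvd_0_right)
  then have "prime_factors (p * d) = insert p (prime_factors d)"
    using assms by (auto simp: prime_factors_product prime_prime_factors)
  moreover have "p \<notin> prime_factors d" using assms by auto
  ultimately show ?thesis using sq assms by (simp add: moebius_mu_def)
qed

text \<open>For a prime p dividing n, the squarefree divisors come in pairs d and p d with p not
  dividing d, and their values cancel.\<close>

lemma sum_moebius:
  assumes "n > 1"
  shows "(\<Sum>d | d dvd n. moebius_mu d) = 0"
proof -
  obtain p where p: "prime p" "p dvd n" using assms prime_factor_nat[of n] by auto
  let ?D = "{d. d dvd n \<and> squarefree d \<and> \<not> p dvd d}" and ?E = "{d. d dvd n \<and> squarefree d \<and> p dvd d}"
  have fin: "finite {d. d dvd n}" using assms by auto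
  have sp: "squarefree (p * d)" if "squarefree d" "\<not> p dvd d" for d
    using that p by (intro squarefree_mult_coprime) (auto intro: prime_imp_coprime squarefree_prime)
  have np: "\<not> p dvd d div p" if "squarefree d" "p dvd d" for d
  proof
    assume "p dvd d div p"
    then have "p ^ 2 dvd d" using that p by (simp add: dvd_div_iff_mult power2_eq_square prime_gt_0_nat)
    then show False using that p not_prime_unit unfolding squarefree_def by blast
  qed
  have "(\<Sum>d | d dvd n. moebius_mu d) = sum moebius_mu (?D \<union> ?E)"
    using fin by (intro sum.mono_neutral_right) (auto simp: moebius_mu_def)
  also have "\<dots> = sum moebius_mu ?D + sum moebius_mu ?E"
    using fin by (intro sum.union_disjoint) auto
  also have "sum moebius_mu ?E = (\<Sum>d\<in>?D. - moebius_mu d)"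
  proof (rule sum.reindex_bij_witness[of _ "\<lambda>d. p * d" "\<lambda>d. d div p"])
    fix d assume d: "d \<in> ?E"
    then show "p * (d div p) = d" by simp
    have "d div p dvd d" using d by (metis CollectD dvd_div_mult_self dvd_triv_left)
    then show "d div p \<in> ?D" using d np[of d] 
      by (auto intro: squarefree_mono[of "d div p" d] dvd_trans[of "d div p" d])
  next
    fix d assume d: "d \<in> ?D"
    then show "p * d div p = d" using p by (simp add: prime_gt_0_nat)
    show "p * d \<in> ?E" using d p sp[of d] by (auto intro: divides_mult prime_imp_coprime)
  next
    fix d assume d: "d \<in> ?E"
    have "d div p dvd d" using d by (metis CollectD dvd_div_mult_self dvd_triv_left)
    then have "squarefree (d div p)" using d by (auto intro: squarefree_mono[of "d div p" d])
    then show "- moebius_mu (d div p) = moebius_mu d"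
      using d np[of d] p moebius_prime_times[of p "d div p"] by simp
  qed
  finally show ?thesis by (simp add: sum_negf)
qed

text \<open>The convolution of 1 with \<mu> cut off at V. For k from 1 to V it agrees with the unit
  of Dirichlet convolution; its values beyond V are coefficients in a sum of type II.\<close>

definition moebius_trunc :: "nat \<Rightarrow> nat \<Rightarrow> real" where
  "moebius_trunc V k = (\<Sum>d | d dvd k. if d \<le> V then moebius_mu d else 0)"

lemma moebius_trunc_1: "V \<ge> 1 \<Longrightarrow> moebius_trunc V (Suc 0) = 1"
  by (simp add: moebius_trunc_def moebius_mu_1)

lemma moebius_trunc_eq_0:
  assumes "1 < k" "k \<le> V"
  shows "moebius_trunc V k = 0"
proof -
  have "moebius_trunc V k = (\<Sum>d | d dvd k. moebius_mu d)"
    unfolding moebius_trunc_def using assms by (intro sum.cong) (auto dest: dvd_imp_le)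
  then show ?thesis using sum_moebius assms by simp
qed

lemma abs_moebius_trunc_le: "\<bar>moebius_trunc V k\<bar> \<le> real (num_divisors k)"
proof -
  have "\<bar>moebius_trunc V k\<bar> \<le> (\<Sum>d | d dvd k. \<bar>if d \<le> V then moebius_mu d else 0\<bar>)"
    unfolding moebius_trunc_def by (rule sum_abs)
  also have "\<dots> \<le> (\<Sum>d | d dvd k. 1)" by (rule sum_mono) (simp add: abs_moebius_le)
  finally show ?thesis by (simp add: num_divisors_def)
qed

text \<open>The coefficients of the middle term of Vaughan's identity: \<Lambda> cut off at U,
  convolved with \<mu> cut off at V.\<close>

definition vaughan_coeff :: "nat \<Rightarrow> nat \<Rightarrow> nat \<Rightarrow> real" where
  "vaughan_coeff U V r =
     (\<Sum>m | m dvd r. (if m \<le> U then mangoldt m else 0) * (if r div m \<le> V then moebius_mu (r div m) else 0))"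

text \<open>No divisor function is lost: the factors next to \<Lambda> have absolute value at most
  1, and \<Lambda> summed over the divisors of r is exactly \<open>ln r\<close>.\<close>

lemma abs_vaughan_coeff_le:
  assumes "r > 0"
  shows "\<bar>vaughan_coeff U V r\<bar> \<le> ln r"
proof -
  have "\<bar>vaughan_coeff U V r\<bar> \<le> 
     (\<Sum>m | m dvd r. \<bar>(if m \<le> U then mangoldt m else 0) * (if r div m \<le> V then moebius_mu (r div m) else 0)\<bar>)"
    unfolding vaughan_coeff_def by (rule sum_abs)
  also have "\<dots> \<le> (\<Sum>m | m dvd r. mangoldt m)"
    by (rule sum_mono) (auto simp: abs_mult mangoldt_nonneg abs_moebius_le intro!: mult_right_le_one_le)
  also have "\<dots> = ln r" using mangoldt_sum[of r, where 'a = real] assms by simp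
  finally show ?thesis .
qed

lemma vaughan_coeff_eq_0:
  assumes "r > U * V"
  shows "vaughan_coeff U V r = 0"
  unfolding vaughan_coeff_def
proof (rule sum.neutral, rule)
  fix m assume "m \<in> {m. m dvd r}"
  then have r: "r = m * (r div m)" by simp
  have "\<not> (m \<le> U \<and> r div m \<le> V)"
  proof
    assume "m \<le> U \<and> r div m \<le> V"
    then have "m * (r div m) \<le> U * V" by (intro mult_le_mono) auto
    then show False using r assms by linarith
  qed
  then show "(if m \<le> U then mangoldt m else 0) * (if r div m \<le> V then moebius_mu (r div m) else 0) = 0"
    by auto
qed

text \<open>As the logarithm is 1 convolved with \<Lambda>, convolving it with the truncated \<mu>
  gives \<Lambda> convolved with \<open>moebius_trunc V\<close>. When \<Lambda> is split at U, the
  small part becomes the divisor sum of \<open>vaughan_coeff\<close>; in the large part the cofactor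
  1 contributes \<Lambda>(n) itself, cofactors from 2 to V nothing, and those above V
  remain.\<close>

lemma vaughan_pointwise:
  assumes "n > 0" "V \<ge> 1"
  shows "(if U < n then mangoldt n else 0) =
      (\<Sum>d | d dvd n. (if d \<le> V then moebius_mu d else 0) * ln (real (n div d)))
    - (\<Sum>r | r dvd n. vaughan_coeff U V r)
    - (\<Sum>m | m dvd n. (if U < m then mangoldt m else 0) * (if V < n div m then moebius_trunc V (n div m) else 0))"
proof -
  let ?L = "mangoldt :: nat \<Rightarrow> real" and ?mu = "\<lambda>d. if d \<le> V then moebius_mu d else 0"
  have fin: "finite {d. d dvd n}" using assms by auto
  have pos: "n div d > 0" if "d dvd n" for d using that assms by (auto elim!: dvdE)
  have "(\<Sum>d | d dvd n. ?mu d * ln (real (n div d))) = (\<Sum>d | d dvd n. ?mu d * (\<Sum>m | m dvd n div d. ?L m))"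
    using pos by (intro sum.cong) (auto simp: mangoldt_sum)
  also have "\<dots> = (\<Sum>d | d dvd n. \<Sum>m | m dvd n div d. ?L m * ?mu d)"
    by (simp add: sum_distrib_left mult.commute)
  also have "\<dots> = (\<Sum>m | m dvd n. \<Sum>d | d dvd n div m. ?L m * ?mu d)"
    using sum_divisor_pairs_swap[OF assms(1), of "\<lambda>m d. ?L m * ?mu d"] by simp
  also have "\<dots> = (\<Sum>m | m dvd n. ?L m * moebius_trunc V (n div m))"
    by (simp add: moebius_trunc_def sum_distrib_left)
  also have "\<dots> = (\<Sum>m | m dvd n. (if m \<le> U then ?L m else 0) * moebius_trunc V (n div m) +
     (if U < m then ?L m else 0) * moebius_trunc V (n div m))"
    by (intro sum.cong) auto
  also have "\<dots> = (\<Sum>m | m dvd n. (if m \<le> U then ?L m else 0) * moebius_trunc V (n div m)) +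
     (\<Sum>m | m dvd n. (if U < m then ?L m else 0) * moebius_trunc V (n div m))"
    by (rule sum.distrib)
  also have "(\<Sum>m | m dvd n. (if m \<le> U then ?L m else 0) * moebius_trunc V (n div m)) = 
      (\<Sum>m | m dvd n. \<Sum>d | d dvd n div m. (if m \<le> U then ?L m else 0) * ?mu d)"
    by (simp only: moebius_trunc_def sum_distrib_left)
  also have "\<dots> = (\<Sum>r | r dvd n. vaughan_coeff U V r)"
    unfolding vaughan_coeff_def using assms by (intro sum_divisor_pairs)
  also have "(\<Sum>m | m dvd n. (if U < m then ?L m else 0) * moebius_trunc V (n div m)) =
      (\<Sum>m | m dvd n. (if m = n then (if U < n then ?L n else 0) else 0) + 
        (if U < m then ?L m else 0) * (if V < n div m then moebius_trunc V (n div m) else 0))"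
  proof (rule sum.cong[OF refl])
    fix m assume "m \<in> {m. m dvd n}"
    then have m: "m dvd n" by simp
    consider "m = n" | "m \<noteq> n" "n div m \<le> V" | "m \<noteq> n" "V < n div m" by linarith
    then show "(if U < m then ?L m else 0) * moebius_trunc V (n div m) = 
       (if m = n then (if U < n then ?L n else 0) else 0) + 
        (if U < m then ?L m else 0) * (if V < n div m then moebius_trunc V (n div m) else 0)"
    proof cases
      case 1
      then show ?thesis using assms by (auto simp: moebius_trunc_1)
    next
      case 2
      then have "n div m \<noteq> 1" using m by (auto elim!: dvdE)
      then have "1 < n div m" using pos[OF m] by linarith
      then show ?thesis using 2 by (simp add: moebius_trunc_eq_0)
    next
      case 3
      then show ?thesis by auto
    qed
  qed
  also have "\<dots> = (\<Sum>m | m dvd n. if m = n then (if U < n then ?L n else 0) else 0) + 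
        (\<Sum>m | m dvd n. (if U < m then ?L m else 0) * (if V < n div m then moebius_trunc V (n div m) else 0))"
    by (rule sum.distrib)
  also have "(\<Sum>m | m dvd n. if m = n then (if U < n then ?L n else 0) else 0) = (if U < n then ?L n else 0)"
    using fin by (simp add: sum.delta)
  finally show ?thesis by linarith
qed

lemma vaughan_identity:
  fixes f :: "nat \<Rightarrow> complex"
  assumes "V \<ge> 1"
  shows "(\<Sum>n=1..N. of_real (if U < n then mangoldt n else 0) * f n) =
      (\<Sum>d=1..N. of_real (if d \<le> V then moebius_mu d else 0) * (\<Sum>k=1..N div d. of_real (ln k) * f (d * k)))
    - (\<Sum>r=1..N. of_real (vaughan_coeff U V r) * (\<Sum>k=1..N div r. f (r * k)))
    - (\<Sum>m=1..N. of_real (if U < m then mangoldt m else 0) *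
         (\<Sum>k=1..N div m. of_real (if V < k then moebius_trunc V k else 0) * f (m * k)))"
proof -
  define a where "a d = (if d \<le> V then moebius_mu d else 0)" for d
  define b where "b d = (if U < d then mangoldt d else 0 :: real)" for d
  define c where "c d = (if V < d then moebius_trunc V d else 0)" for d
  define G where "G d k = of_real (a d) * (of_real (ln k) * f (d * k))
    - of_real (vaughan_coeff U V d) * f (d * k) - of_real (b d) * (of_real (c k) * f (d * k))"
    for d k :: nat
  have eq: "of_real (b n) * f n = (\<Sum>d | d dvd n. G d (n div d))" if "n \<in> {1..N}" for n
  proof -
    have n: "n > 0" using that by simp
    have "of_real (b n) * f n = (\<Sum>d | d dvd n. of_real (a d) * of_real (ln (real (n div d))) * f n)
      - (\<Sum>d | d dvd n. of_real (vaughan_coeff U V d) * f n)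
      - (\<Sum>d | d dvd n. of_real (b d) * of_real (c (n div d)) * f n)"
      unfolding vaughan_pointwise[OF n assms, of U, folded a_def b_def c_def]
      by (simp only: of_real_diff of_real_sum of_real_mult left_diff_distrib sum_distrib_right)
    also have "\<dots> = (\<Sum>d | d dvd n. G d (n div d))"
      unfolding sum_subtractf[symmetric] G_def
      by (intro sum.cong) (auto simp: mult.assoc)
    finally show ?thesis .
  qed
  have "(\<Sum>n=1..N. of_real (b n) * f n) = (\<Sum>n=1..N. \<Sum>d | d dvd n. G d (n div d))"
    using eq by (rule sum.cong[OF refl])
  also have "\<dots> = (\<Sum>d=1..N. \<Sum>k=1..N div d. G d k)" by (rule sum_divisors_swap)
  finally show ?thesis
    unfolding a_def[symmetric] b_def[symmetric] c_def[symmetric]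
    by (simp only: G_def sum_subtractf sum_distrib_left)
qed

subsection \<open>Mean values of divisor functions\<close>

text \<open>Multiplicativity up to an inequality, without a coprimality condition. It suffices for
  upper bounds and passes to divisor sums, so Euler products are avoided.\<close>

definition submultiplicative :: "(nat \<Rightarrow> real) \<Rightarrow> bool" where
  "submultiplicative f \<longleftrightarrow> (\<forall>n. f n \<ge> 0) \<and> (\<forall>a>0. \<forall>b>0. f (a * b) \<le> f a * f b)"

text \<open>Every divisor of a b is a divisor of a times a divisor of b, possibly in several ways;
  counting all of them only enlarges the right-hand side.\<close>

lemma submultiplicative_divisor_sum:
  assumes "submultiplicative f"
  shows "submultiplicative (\<lambda>n. \<Sum>d | d dvd n. f d)"
proof -
  have f: "f n \<ge> 0" "a > 0 \<Longrightarrow> b > 0 \<Longrightarrow> f (a * b) \<le> f a * f b" for n a b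
    using assms by (auto simp: submultiplicative_def)
  have "(\<Sum>d | d dvd a * b. f d) \<le> (\<Sum>d | d dvd a. f d) * (\<Sum>d | d dvd b. f d)" if ab: "a > 0" "b > 0" for a b
  proof -
    let ?S = "{d. d dvd a} \<times> {d. d dvd b}"
    have fin: "finite ?S" using ab by auto
    have "{d. d dvd a * b} \<subseteq> (\<lambda>(x, y). x * y) ` ?S"
      using division_decomp[of _ a b] by (auto simp: image_iff)
    then have "(\<Sum>d | d dvd a * b. f d) \<le> (\<Sum>d\<in>(\<lambda>(x, y). x * y) ` ?S. f d)"
      using f fin by (intro sum_mono2) auto
    also have "\<dots> \<le> sum (f \<circ> (\<lambda>(x, y). x * y)) ?S"
      using f fin by (intro sum_image_le) auto
    also have "\<dots> \<le> (\<Sum>(x, y)\<in>?S. f x * f y)"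
      by (intro sum_mono) (auto intro!: f(2) intro: dvd_pos_nat[OF ab(1)] dvd_pos_nat[OF ab(2)])
    also have "\<dots> = (\<Sum>d | d dvd a. f d) * (\<Sum>d | d dvd b. f d)"
      by (simp add: sum_product sum.cartesian_product)
    finally show ?thesis .
  qed
  then show ?thesis using f by (auto simp: submultiplicative_def intro: sum_nonneg)
qed

text \<open>With t = d k the weight 1 / t splits exactly and F up to an inequality; relaxing d k
  \<le> T to d, k \<le> T lets the sum factor.\<close>

lemma sum_div_convolution_le:
  assumes F: "submultiplicative F" and g: "\<And>n. g n \<ge> 0" and h: "\<And>n. h n \<ge> 0"
  shows "(\<Sum>t=1..T. F t * (\<Sum>d | d dvd t. g d * h (t div d)) / real t) \<le>
     (\<Sum>t=1..T. F t * g t / real t) * (\<Sum>t=1..T. F t * h t / real t)"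
proof -
  have F0: "F n \<ge> 0" "a > 0 \<Longrightarrow> b > 0 \<Longrightarrow> F (a * b) \<le> F a * F b" for n a b
    using F by (auto simp: submultiplicative_def)
  have "(\<Sum>t=1..T. F t * (\<Sum>d | d dvd t. g d * h (t div d)) / real t) =
    (\<Sum>t=1..T. \<Sum>d | d dvd t. F (d * (t div d)) * g d * h (t div d) / real (d * (t div d)))"
    by (simp add: sum_distrib_left sum_divide_distrib mult.assoc)
  also have "\<dots> = (\<Sum>d=1..T. \<Sum>k=1..T div d. F (d * k) * g d * h k / real (d * k))"
    by (rule sum_divisors_swap)
  also have "\<dots> \<le> (\<Sum>d=1..T. \<Sum>k=1..T. (F d * g d / real d) * (F k * h k / real k))"
  proof (rule sum_mono)
    fix d assume d: "d \<in> {1..T}"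
    have "(\<Sum>k=1..T div d. F (d * k) * g d * h k / real (d * k)) \<le> 
       (\<Sum>k=1..T div d. (F d * g d / real d) * (F k * h k / real k))"
    proof (rule sum_mono)
      fix k assume k: "k \<in> {1..T div d}"
      have "F (d * k) * (g d * h k) \<le> (F d * F k) * (g d * h k)"
        using F0 d k g h by (intro mult_right_mono) auto
      then have "F (d * k) * (g d * h k) / real (d * k) \<le> (F d * F k) * (g d * h k) / real (d * k)"
        by (rule divide_right_mono) simp
      then show "F (d * k) * g d * h k / real (d * k) \<le> (F d * g d / real d) * (F k * h k / real k)"
        by (simp add: mult_ac)
    qed
    also have "\<dots> \<le> (\<Sum>k=1..T. (F d * g d / real d) * (F k * h k / real k))"
    proof (rule sum_mono2)
      show "{1..T div d} \<subseteq> {1..T}" using div_le_dividend[of T d] by auto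
    qed (use F0 g h in auto)
    finally show "(\<Sum>k=1..T div d. F (d * k) * g d * h k / real (d * k)) \<le>
        (\<Sum>k=1..T. (F d * g d / real d) * (F k * h k / real k))" .
  qed
  also have "\<dots> = (\<Sum>t=1..T. F t * g t / real t) * (\<Sum>t=1..T. F t * h t / real t)"
    by (simp add: sum_product)
  finally show ?thesis .
qed

text \<open>The number of ordered factorizations of t into three factors. It arises because a pair
  (h, k) with h k = t will carry the weight \<open>num_divisors k\<close>.\<close>

definition divisor3 :: "nat \<Rightarrow> real" where
  "divisor3 t = (\<Sum>d | d dvd t. real (num_divisors d))"

lemma submultiplicative_num_divisors: "submultiplicative (\<lambda>n. real (num_divisors n))"
  using submultiplicative_divisor_sum[of "\<lambda>_. 1"] 
  by (simp add: submultiplicative_def num_divisors_def)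

lemma submultiplicative_divisor3: "submultiplicative divisor3"
  unfolding divisor3_def[abs_def]
  by (rule submultiplicative_divisor_sum[OF submultiplicative_num_divisors])

lemma divisor3_nonneg: "divisor3 t \<ge> 0"
  using submultiplicative_divisor3 by (simp add: submultiplicative_def)

text \<open>\<open>divisor3\<close> is a convolution of three constant functions 1; each is peeled
  off at the cost of one sum of F(t) / t.\<close>

lemma sum_divisor3_le:
  assumes F: "submultiplicative F"
  shows "(\<Sum>t=1..T. F t * divisor3 t / real t) \<le> (\<Sum>t=1..T. F t / real t) ^ 3"
proof -
  let ?S = "\<Sum>t=1..T. F t / real t"
  have F0: "F n \<ge> 0" for n using F by (auto simp: submultiplicative_def)
  have S0: "?S \<ge> 0" using F0 by (intro sum_nonneg) auto
  have 1: "(\<Sum>t=1..T. F t * real (num_divisors t) / real t) \<le> ?S * ?S"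
    using sum_div_convolution_le[OF F, of "\<lambda>_. 1" "\<lambda>_. 1" T] by (simp add: num_divisors_def)
  have "(\<Sum>t=1..T. F t * divisor3 t / real t) \<le> (\<Sum>t=1..T. F t * real (num_divisors t) / real t) * ?S"
    using sum_div_convolution_le[OF F, of "\<lambda>n. real (num_divisors n)" "\<lambda>_. 1" T] by (simp add: divisor3_def)
  also have "\<dots> \<le> (?S * ?S) * ?S" using 1 S0 by (rule mult_right_mono)
  finally show ?thesis by (simp add: power3_eq_cube)
qed

lemma harm_le_ln: 
  assumes "T \<ge> 1" shows "harm T \<le> 1 + ln (real T)"
  using assms
proof (induction T rule: dec_induct)
  case base
  then show ?case by (simp add: harm_def)
next
  case (step T)
  have "ln (real T / (real T + 1)) \<le> real T / (real T + 1) - 1"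
    using step by (intro ln_le_minus_one) auto
  also have "\<dots> = - inverse (real (Suc T))" using step by (simp add: field_simps)
  finally have "inverse (real (Suc T)) \<le> ln (real (Suc T)) - ln (real T)"
    using step by (simp add: ln_div add.commute)
  then show ?case using step by (simp add: harm_Suc)
qed

text \<open>\<open>sum_divisor3_le\<close> is used with F = 1 and then with F =
  \<open>divisor3\<close>, so the exponent is 9 = 3 * 3. Removing the weight 1 / t by t \<le> T
  costs one logarithm compared with the true order.\<close>

lemma sum_divisor3_squared_le:
  assumes "T \<ge> 1"
  shows "(\<Sum>t=1..T. (divisor3 t)\<^sup>2) \<le> real T * (1 + ln (real T)) ^ 9"
proof -
  have h: "(\<Sum>t=1..T. 1 / real t) = harm T" by (simp add: harm_def inverse_eq_divide)
  have "(\<Sum>t=1..T. divisor3 t / real t) \<le> harm T ^ 3"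
    using sum_divisor3_le[of "\<lambda>_. 1" T] h by (simp add: submultiplicative_def)
  moreover have "(\<Sum>t=1..T. divisor3 t / real t) \<ge> 0" by (intro sum_nonneg) (auto simp: divisor3_nonneg)
  ultimately have "(\<Sum>t=1..T. divisor3 t / real t) ^ 3 \<le> (harm T ^ 3) ^ 3" by (intro power_mono)
  with sum_divisor3_le[OF submultiplicative_divisor3, of T]
  have "(\<Sum>t=1..T. divisor3 t * divisor3 t / real t) \<le> harm T ^ 9" by (simp flip: power_mult)
  also have "\<dots> \<le> (1 + ln (real T)) ^ 9"
    using assms harm_le_ln by (intro power_mono harm_nonneg)
  finally have 2: "(\<Sum>t=1..T. divisor3 t * divisor3 t / real t) \<le> (1 + ln (real T)) ^ 9" .
  have "(\<Sum>t=1..T. (divisor3 t)\<^sup>2) \<le> (\<Sum>t=1..T. real T * (divisor3 t * divisor3 t / real t))"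
  proof (rule sum_mono)
    fix t assume t: "t \<in> {1..T}"
    have "(divisor3 t)\<^sup>2 * real t \<le> (divisor3 t)\<^sup>2 * real T" using t by (intro mult_left_mono) auto
    then show "(divisor3 t)\<^sup>2 \<le> real T * (divisor3 t * divisor3 t / real t)"
      using t by (simp add: field_simps power2_eq_square)
  qed
  also have "\<dots> = real T * (\<Sum>t=1..T. divisor3 t * divisor3 t / real t)" by (simp add: sum_distrib_left)
  also have "\<dots> \<le> real T * (1 + ln (real T)) ^ 9" using 2 by (rule mult_left_mono) simp
  finally show ?thesis .
qed

subsection \<open>Chebyshev's lower bound\<close>

lemma ln_fact_eq_sum_mangoldt: "ln (fact N :: real) = (\<Sum>d=1..N. mangoldt d * real (N div d))"
proof -
  have "ln (fact N :: real) = (\<Sum>n=1..N. ln (real n))"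
  proof -
    have "(fact N :: real) = (\<Prod>n=1..N. real n)" by (simp add: fact_prod)
    then show ?thesis by (simp only:) (rule ln_prod; simp)
  qed
  also have "\<dots> = (\<Sum>n=1..N. \<Sum>d | d dvd n. mangoldt d)"
    by (intro sum.cong) (auto simp: mangoldt_sum)
  also have "\<dots> = (\<Sum>d=1..N. \<Sum>k=1..N div d. mangoldt d)" by (rule sum_divisors_swap)
  finally show ?thesis by (simp add: mult.commute)
qed

text \<open>Chebyshev's argument: in the logarithm of the central binomial coefficient, \<Lambda>(d)
  has the coefficient \<open>(2 * n) div d - 2 * (n div d)\<close>, which is at most 1.\<close>

lemma sum_mangoldt_even_ge:
  assumes "n \<ge> 1"
  shows "(\<Sum>d=1..2*n. mangoldt d) \<ge> real n / 3"
proof -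
  have "4 ^ n / (2 * real n) \<le> real ((2 * n) choose n)"
    using assms by (intro central_binomial_lower_bound) auto
  then have "ln (4 ^ n / (2 * real n)) \<le> ln (real ((2 * n) choose n))"
    using assms by (intro ln_mono) auto
  also have "real ((2 * n) choose n) = fact (2 * n) / (fact n * fact n)"
    by (subst binomial_fact) (auto simp: mult_2)
  also have "ln \<dots> = ln (fact (2 * n)) - 2 * ln (fact n)"
    by (simp add: ln_div ln_mult)
  also have "ln (fact n :: real) = (\<Sum>d=1..2*n. mangoldt d * real (n div d))"
    unfolding ln_fact_eq_sum_mangoldt by (rule sum.mono_neutral_left) auto
  also have "ln (fact (2 * n) :: real) - 2 * \<dots> = 
      (\<Sum>d=1..2*n. mangoldt d * (real ((2 * n) div d) - 2 * real (n div d)))"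
    unfolding ln_fact_eq_sum_mangoldt by (simp add: sum_distrib_left sum_subtractf algebra_simps)
  also have "\<dots> \<le> (\<Sum>d=1..2*n. mangoldt d)"
  proof (rule sum_mono)
    fix d assume d: "d \<in> {1..2*n}"
    have "2 * n < (2 * (n div d) + 2) * d"
      using d dividend_less_div_times[of d n] by (simp add: algebra_simps)
    then have "(2 * n) div d < 2 * (n div d) + 2" using d by (simp add: div_less_iff_less_mult)
    then have "real ((2 * n) div d) - 2 * real (n div d) \<le> 1" by linarith
    then show "mangoldt d * (real ((2 * n) div d) - 2 * real (n div d)) \<le> mangoldt d"
      using mangoldt_nonneg[of d] by (simp add: mult_left_le)
  qed
  finally have *: "ln (4 ^ n / (2 * real n)) \<le> (\<Sum>d=1..2*n. mangoldt d)" .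
  \<comment> \<open>This is at least 4 n / 3 - 1 - (n - 1) = n / 3.\<close>
  have "ln (4 ^ n / (2 * real n)) = real n * ln 4 - ln 2 - ln (real n)"
    using assms by (simp add: ln_div ln_realpow ln_mult)
  moreover have "real n * ln (2::real) \<ge> real n * (2/3)"
    using ln2_ge_two_thirds by (intro mult_left_mono) auto
  moreover have "real n * ln 4 = 2 * (real n * ln 2)" using ln_realpow[of 2 2] by simp
  moreover have "ln (real n) \<le> real n - 1" using assms by (intro ln_le_minus_one) auto
  ultimately show ?thesis using * ln_2_less_1 by linarith
qed

lemma sum_mangoldt_ge:
  assumes "N \<ge> 2"
  shows "(\<Sum>d=1..N. mangoldt d) \<ge> real N / 9"
proof -
  have "real N / 9 \<le> real (N div 2) / 3"
  proof -
    have "N \<le> 3 * (N div 2)" using assms by presburger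
    then have "real N \<le> real (3 * (N div 2))" by (rule of_nat_mono)
    then show ?thesis by simp
  qed
  also have "\<dots> \<le> (\<Sum>d=1..2*(N div 2). mangoldt d)"
    using assms by (intro sum_mangoldt_even_ge) auto
  also have "\<dots> \<le> (\<Sum>d=1..N. mangoldt d)"
    by (intro sum_mono2) (auto simp: mangoldt_nonneg)
  finally show ?thesis .
qed

text \<open>A proper prime power p^k \<le> N has p \<le> sqrt N and k \<le> log 2 N \<le> 2 ln N,
  and its \<Lambda> is at most ln N.\<close>

lemma sum_mangoldt_nonprime_le:
  fixes N :: nat
  assumes "N \<ge> 1"
  shows "(\<Sum>n | n \<in> {1..N} \<and> \<not> prime n. mangoldt n) \<le> 2 * sqrt N * (ln N)\<^sup>2"
proof -
  let ?P = "{n::nat. n \<in> {1..N} \<and> \<not> prime n \<and> primepow n}"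
  define s where "s = nat \<lfloor>sqrt N\<rfloor>"
  define b where "b = nat \<lfloor>log 2 N\<rfloor>"
  have sub: "?P \<subseteq> (\<lambda>(p, k). p ^ k) ` ({1..s} \<times> {1..b})"
  proof
    fix n assume n: "n \<in> ?P"
    then obtain p k where pk: "prime p" "k > 0" "n = p ^ k" unfolding primepow_def by auto
    have k2: "k \<ge> 2"
    proof (rule ccontr)
      assume "\<not> k \<ge> 2"
      then have "k = 1" using pk by linarith
      then show False using pk n by simp
    qed
    have p2: "p \<ge> 2" using prime_ge_2_nat[of p] pk by simp
    have "p ^ 2 \<le> p ^ k" using p2 k2 by (intro power_increasing) auto
    then have "real (p ^ 2) \<le> real N" using n pk by (intro of_nat_mono) auto
    then have "real p \<le> sqrt N" by (intro real_le_rsqrt) simp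
    then have ps: "p \<le> s" unfolding s_def by (simp add: le_nat_floor)
    have "2 ^ k \<le> p ^ k" using p2 by (intro power_mono) auto
    also have "p ^ k \<le> N" using n pk by auto
    finally have "real (2 ^ k) \<le> real N" by (rule of_nat_mono)
    then have "real k \<le> log 2 N" using assms by (intro le_log_of_power) auto
    then have "k \<le> b" unfolding b_def by (simp add: le_nat_floor)
    with ps p2 k2 have "(p, k) \<in> {1..s} \<times> {1..b}" by auto
    then show "n \<in> (\<lambda>(p, k). p ^ k) ` ({1..s} \<times> {1..b})"
      using pk by (intro image_eqI[of _ _ "(p, k)"]) simp_all
  qed
  have "card ?P \<le> card ({1..s} \<times> {1..b})"
    using card_mono[OF _ sub] card_image_le[of "{1..s} \<times> {1..b}" "\<lambda>(p, k). p ^ k"]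
    by (meson finite_SigmaI finite_atLeastAtMost finite_imageI le_trans)
  then have card: "card ?P \<le> s * b" by simp
  have "ln N \<ge> 0" using assms by simp
  have "(\<Sum>n | n \<in> {1..N} \<and> \<not> prime n. mangoldt n) = (\<Sum>n\<in>?P. mangoldt n :: real)"
    by (intro sum.mono_neutral_right) (auto simp: mangoldt_def)
  also have "\<dots> \<le> (\<Sum>n\<in>?P. ln N)"
  proof (rule sum_mono)
    fix n assume n: "n \<in> ?P"
    have "mangoldt n \<le> ln n" using mangoldt_le[of n] n by simp
    also have "\<dots> \<le> ln N" using n by simp
    finally show "mangoldt n \<le> ln N" .
  qed
  also have "\<dots> = real (card ?P) * ln N" by simp
  also have "\<dots> \<le> real (s * b) * ln N"
    using card \<open>ln N \<ge> 0\<close> by (intro mult_right_mono of_nat_mono) auto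
  also have "\<dots> \<le> (sqrt N * (2 * ln N)) * ln N"
  proof -
    have "real s \<le> sqrt N" unfolding s_def by simp
    moreover have "real b \<le> log 2 N" unfolding b_def using assms by simp
    moreover have "log 2 N \<le> 2 * ln N"
    proof -
      have "ln N * 1 \<le> ln N * (2 * ln 2)"
        using ln2_ge_two_thirds \<open>ln N \<ge> 0\<close> by (intro mult_left_mono) auto
      then show ?thesis by (simp add: log_def field_simps)
    qed
    ultimately show ?thesis using \<open>ln N \<ge> 0\<close> 
      unfolding of_nat_mult by (intro mult_right_mono mult_mono) auto
  qed
  finally show ?thesis by (simp add: power2_eq_square mult_ac)
qed

subsection \<open>Exponential sums over intervals\<close>

definition dist_int :: "real \<Rightarrow> real" where
  "dist_int x = \<bar>x - of_int (round x)\<bar>"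

lemma dist_int_nonneg: "dist_int x \<ge> 0"
  by (simp add: dist_int_def)

lemma dist_int_le: "dist_int x \<le> \<bar>x - of_int k\<bar>"
  unfolding dist_int_def by (rule round_diff_minimal)

lemma dist_int_le_half: "dist_int x \<le> 1 / 2"
  unfolding dist_int_def using of_int_round_abs_le[of x] by (simp add: abs_minus_commute)

lemma dist_int_minus: "dist_int (- x) = dist_int x"
proof (rule antisym)
  show "dist_int (- x) \<le> dist_int x" for x
    using dist_int_le[of "- x" "- round x"] by (simp add: dist_int_def)
  from this[of "- x"] show "dist_int x \<le> dist_int (- x)" by simp
qed

lemma dist_int_minus_commute: "dist_int (x - y) = dist_int (y - x)"
  using dist_int_minus[of "x - y"] by simp

definition expi :: "real \<Rightarrow> complex" where
  "expi x = cis (2 * pi * x)"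

lemma norm_expi [simp]: "norm (expi x) = 1"
  by (simp add: expi_def)

lemma expi_add: "expi (x + y) = expi x * expi y"
  by (simp add: expi_def cis_mult algebra_simps)

lemma expi_minus: "expi (- x) = cnj (expi x)"
  by (simp add: expi_def cis_cnj)

lemma expi_diff: "expi (x - y) = expi x * cnj (expi y)"
  using expi_add[of x "- y"] by (simp add: expi_minus)

lemma expi_of_nat_mult: "expi (real n * x) = expi x ^ n"
  unfolding expi_def Complex.DeMoivre by (simp add: mult_ac)

lemma sin_ge_half: 
  assumes "0 \<le> t" "t \<le> pi / 2" shows "t / 2 \<le> sin (t::real)"
proof (cases "t \<le> pi / 3")
  case True
  have "\<exists>s. 0 \<le> s \<and> s \<le> t \<and> sin t = t * cos s"
  proof (cases "t = 0")
    case False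
    then have "0 < t" using assms by simp
    then obtain z where "0 < z" "z < t" "sin t - sin 0 = (t - 0) * cos z"
      using MVT2[of 0 t sin cos] by (auto intro!: derivative_eq_intros)
    then show ?thesis by (intro exI[of _ z]) auto
  qed auto
  then obtain s where s: "0 \<le> s" "s \<le> t" "sin t = t * cos s" by blast
  have "cos (pi / 3) \<le> cos s" using s True by (intro cos_monotone_0_pi_le) auto
  then have "t * (1 / 2) \<le> t * cos s" using assms by (intro mult_left_mono) (auto simp: cos_60)
  then show ?thesis using s by simp
next
  case False
  have "sin (pi / 3) \<le> sin t" using False assms by (intro sin_monotone_2pi_le) auto
  moreover have "sqrt 3 \<ge> 17/10" by (rule real_le_rsqrt) (simp add: power2_eq_square)
  moreover have "pi < 3.2" using pi_approx by simp
  ultimately show ?thesis using assms by (simp add: sin_60)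
qed

text \<open>|1 - e(y)| = 2 |sin (pi y)|. The constant 2 cancels the 2 bounding a difference of two
  unimodular numbers, so geometric sums are at most 1 / \<open>dist_int x\<close>.\<close>

lemma norm_one_minus_expi_ge: "norm (1 - expi x) \<ge> 2 * dist_int x"
proof -
  define y where "y = x - of_int (round x)"
  have y: "\<bar>y\<bar> \<le> 1 / 2" using dist_int_le_half[of x] by (simp add: dist_int_def y_def)
  have e: "expi x = expi y"
  proof -
    have "expi x = expi (y + of_int (round x))" by (simp add: y_def)
    also have "\<dots> = expi y * cis (2 * pi * of_int (round x))" by (simp only: expi_add) (simp add: expi_def)
    also have "cis (2 * pi * of_int (round x)) = 1" by (simp add: cis_multiple_2pi)
    finally show ?thesis by simp
  qed
  have "(norm (1 - expi y))\<^sup>2 = (2 * sin (pi * y))\<^sup>2"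
  proof -
    have "(norm (1 - expi y))\<^sup>2 = (1 - cos (2 * pi * y))\<^sup>2 + (sin (2 * pi * y))\<^sup>2"
      by (simp add: expi_def cmod_power2)
    also have "\<dots> = 2 - 2 * cos (2 * (pi * y))"
      using sin_cos_squared_add[of "2 * pi * y"] by (simp add: power2_eq_square algebra_simps)
    also have "cos (2 * (pi * y)) = 1 - 2 * (sin (pi * y))\<^sup>2" by (rule cos_double_sin)
    finally show ?thesis by (simp add: power2_eq_square)
  qed
  then have "norm (1 - expi y) = \<bar>2 * sin (pi * y)\<bar>" by (metis abs_norm_cancel power2_abs power2_eq_iff_nonneg abs_ge_zero norm_ge_zero)
  also have "\<bar>2 * sin (pi * y)\<bar> = 2 * sin (pi * \<bar>y\<bar>)"
  proof -
    have "sin (pi * \<bar>y\<bar>) \<ge> 0" using y by (intro sin_ge_zero) auto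
    then show ?thesis by (auto simp: abs_if)
  qed
  also have "2 * sin (pi * \<bar>y\<bar>) \<ge> 2 * (pi * \<bar>y\<bar> / 2)"
    using y sin_ge_half[of "pi * \<bar>y\<bar>"] by simp
  finally have "norm (1 - expi y) \<ge> pi * \<bar>y\<bar>" by simp
  moreover have "pi * \<bar>y\<bar> \<ge> 2 * \<bar>y\<bar>" using pi_ge_two by (intro mult_right_mono) auto
  ultimately show ?thesis by (simp add: e dist_int_def y_def)
qed

text \<open>This is \<open>min M (1 / dist_int x)\<close>, with value \<open>M\<close> when \<open>x\<close> is an integer.\<close>

definition geo_bound :: "real \<Rightarrow> real \<Rightarrow> real" where
  "geo_bound M x = (if M * dist_int x \<le> 1 then M else 1 / dist_int x)"

lemma geo_bound_nonneg: "M \<ge> 0 \<Longrightarrow> geo_bound M x \<ge> 0"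
  by (simp add: geo_bound_def dist_int_nonneg)

lemma geo_bound_le_left: "geo_bound M x \<le> M"
proof (cases "M * dist_int x \<le> 1")
  case False
  then have "dist_int x \<noteq> 0" by auto
  then have "dist_int x > 0" using dist_int_nonneg[of x] by linarith
  then show ?thesis using False by (simp add: geo_bound_def divide_le_eq)
qed (simp add: geo_bound_def)

lemma geo_bound_le_right: "dist_int x > 0 \<Longrightarrow> geo_bound M x \<le> 1 / dist_int x"
  by (simp add: geo_bound_def le_divide_eq)

lemma le_geo_boundI:
  assumes "a \<le> M" "dist_int x > 0 \<Longrightarrow> a \<le> 1 / dist_int x"
  shows "a \<le> geo_bound M x"
proof (cases "M * dist_int x \<le> 1")
  case False
  then have "dist_int x \<noteq> 0" by auto
  then show ?thesis using False assms dist_int_nonneg[of x] by (simp add: geo_bound_def)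
qed (use assms in \<open>simp add: geo_bound_def\<close>)

lemma geo_bound_mono: "M \<le> M' \<Longrightarrow> geo_bound M x \<le> geo_bound M' x"
  by (rule le_geo_boundI) (use geo_bound_le_left[of M x] geo_bound_le_right[of x M] in auto)

lemma geo_bound_cong: "dist_int x = dist_int y \<Longrightarrow> geo_bound M x = geo_bound M y"
  by (simp add: geo_bound_def)

text \<open>Away from the integers the cap M may be replaced by D. This removes the large caps X / t
  of small t in \<open>sum_geo_bound_hyperbola\<close>.\<close>

lemma geo_bound_le_inverse:
  assumes "dist_int x \<ge> 1 / D" "D > 0" shows "geo_bound M x \<le> geo_bound D x"
proof -
  have pos: "dist_int x > 0" using assms by (smt (verit) divide_pos_pos)
  have "1 / dist_int x \<le> D" using assms pos by (simp add: field_simps)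
  then show ?thesis using geo_bound_le_right[OF pos, of M] by (intro le_geo_boundI) auto
qed

lemma norm_geometric_sum_le:
  "norm (\<Sum>m\<in>{a..<b}. expi (real m * x)) \<le> geo_bound (real (b - a)) x"
proof (rule le_geo_boundI)
  show "norm (\<Sum>m\<in>{a..<b}. expi (real m * x)) \<le> real (b - a)"
    using norm_sum[of "\<lambda>m. expi (real m * x)" "{a..<b}"] by simp
next
  assume pos: "dist_int x > 0"
  have "norm ((1 - expi x) * (\<Sum>m\<in>{a..<b}. expi x ^ m)) \<le> 2"
  proof (cases "a \<le> b")
    case True
    have "(1 - expi x) * (\<Sum>m\<in>{a..<b}. expi x ^ m) = expi x ^ a - expi x ^ b"
      using True
    proof (induction b rule: dec_induct)
      case (step b)
      then show ?case by (simp only: sum.atLeastLessThan_Suc distrib_left step.IH) (simp add: algebra_simps)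
    qed simp
    then show ?thesis 
      using norm_triangle_ineq4[of "expi x ^ a" "expi x ^ b"] by (simp add: norm_power)
  qed simp
  then have "norm (1 - expi x) * norm (\<Sum>m\<in>{a..<b}. expi x ^ m) \<le> 2" by (simp add: norm_mult)
  moreover have "2 * dist_int x * norm (\<Sum>m\<in>{a..<b}. expi x ^ m) \<le> norm (1 - expi x) * norm (\<Sum>m\<in>{a..<b}. expi x ^ m)"
    by (intro mult_right_mono norm_one_minus_expi_ge) simp
  ultimately show "norm (\<Sum>m\<in>{a..<b}. expi (real m * x)) \<le> 1 / dist_int x"
    unfolding expi_of_nat_mult using pos by (simp add: field_simps)
qed

text \<open>Points on one side of their nearest integer have distances which, multiplied by D and
  rounded down, are distinct natural numbers k; such a point contributes at most D / k, or M if k =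
  0. The factor 2 counts the two sides.\<close>

lemma sum_geo_bound_spaced:
  fixes y :: "'a \<Rightarrow> real"
  assumes fin: "finite S" and D: "D > 0" and M: "M \<ge> 0"
    and sp: "\<And>s t. s \<in> S \<Longrightarrow> t \<in> S \<Longrightarrow> s \<noteq> t \<Longrightarrow> dist_int (y s - y t) \<ge> 1 / D"
  shows "(\<Sum>s\<in>S. geo_bound M (y s)) \<le> 2 * (M + D * harm (nat \<lfloor>D\<rfloor>))"
proof -
  define r where "r s = y s - of_int (round (y s))" for s
  have half: "(\<Sum>s\<in>A. geo_bound M (y s)) \<le> M + D * harm (nat \<lfloor>D\<rfloor>)"
    if A: "A \<subseteq> S" and \<sigma>: "\<sigma> \<in> {1, -1}" and nn: "\<And>s. s \<in> A \<Longrightarrow> \<sigma> * r s \<ge> 0" for A and \<sigma> :: real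
  proof -
    define i where "i s = nat \<lfloor>\<sigma> * r s * D\<rfloor>" for s
    define g where "g k = (if k = 0 then M else D / real k)" for k :: nat
    have fi: "real (i s) \<le> \<sigma> * r s * D" "\<sigma> * r s * D < real (i s) + 1" if "s \<in> A" for s
      using nn[OF that] D unfolding i_def by (auto simp: mult_nonneg_nonneg)
    have inj: "inj_on i A"
    proof (rule inj_onI, rule ccontr)
      fix s t assume st: "s \<in> A" "t \<in> A" "i s = i t" "s \<noteq> t"
      have "\<bar>\<sigma> * r s * D - \<sigma> * r t * D\<bar> < 1" using fi[OF st(1)] fi[OF st(2)] st(3) by linarith
      also have "\<sigma> * r s * D - \<sigma> * r t * D = \<sigma> * ((r s - r t) * D)" by (simp add: algebra_simps)
      also have "\<bar>\<dots>\<bar> = \<bar>r s - r t\<bar> * D" using \<sigma> D by (auto simp: abs_mult)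
      finally have 1: "\<bar>r s - r t\<bar> < 1 / D" using D by (simp add: field_simps)
      have "dist_int (y s - y t) \<le> \<bar>y s - y t - of_int (round (y s) - round (y t))\<bar>"
        by (rule dist_int_le)
      also have "\<dots> = \<bar>r s - r t\<bar>" by (simp add: r_def algebra_simps)
      finally show False using 1 sp[of s t] st A by fastforce
    qed
    have le: "geo_bound M (y s) \<le> g (i s)" if s: "s \<in> A" for s
    proof (cases "i s = 0")
      case True
      then show ?thesis by (simp add: g_def geo_bound_le_left)
    next
      case False
      have d: "dist_int (y s) = \<sigma> * r s"
        using nn[OF s] \<sigma> by (auto simp: dist_int_def r_def)
      have ge: "dist_int (y s) * D \<ge> real (i s)" using fi(1)[OF s] d by simp
      have "real (i s) > 0" using False by simp
      then have "dist_int (y s) * D > 0" using ge by linarith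
      then have pos: "dist_int (y s) > 0" using D by (simp add: zero_less_mult_iff)
      have "geo_bound M (y s) \<le> 1 / dist_int (y s)" by (rule geo_bound_le_right[OF pos])
      also have "\<dots> \<le> D / real (i s)" using ge pos False by (simp add: field_simps)
      finally show ?thesis using False by (simp add: g_def)
    qed
    have sub: "i ` A \<subseteq> {0..nat \<lfloor>D\<rfloor>}"
    proof (clarsimp)
      fix s assume s: "s \<in> A"
      have "\<bar>r s\<bar> \<le> 1 / 2" using dist_int_le_half[of "y s"] by (simp add: dist_int_def r_def)
      moreover have "\<sigma> = 1 \<or> \<sigma> = -1" using \<sigma> by simp
      ultimately have "\<sigma> * r s \<le> 1" by (elim disjE) (simp_all add: abs_le_iff)
      then have "\<sigma> * r s * D \<le> 1 * D" using D by (intro mult_right_mono) auto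
      then show "i s \<le> nat \<lfloor>D\<rfloor>" unfolding i_def by (intro nat_mono floor_mono) simp
    qed
    have g0: "g k \<ge> 0" for k using D M by (simp add: g_def)
    have "(\<Sum>s\<in>A. geo_bound M (y s)) \<le> (\<Sum>s\<in>A. g (i s))" by (intro sum_mono le)
    also have "\<dots> = sum g (i ` A)" using inj by (simp add: sum.reindex)
    also have "\<dots> \<le> sum g {0..nat \<lfloor>D\<rfloor>}" using sub g0 by (intro sum_mono2) auto
    also have "\<dots> = M + (\<Sum>k=1..nat \<lfloor>D\<rfloor>. D / real k)"
      by (subst sum.atLeast_Suc_atMost) (auto simp: g_def intro!: sum.cong)
    also have "\<dots> = M + D * harm (nat \<lfloor>D\<rfloor>)" by (simp add: harm_def sum_distrib_left divide_inverse)
    finally show ?thesis .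
  qed
  have "(\<Sum>s\<in>S. geo_bound M (y s)) = (\<Sum>s\<in>{s\<in>S. r s \<ge> 0} \<union> {s\<in>S. r s < 0}. geo_bound M (y s))"
    by (intro sum.cong) auto
  also have "\<dots> = (\<Sum>s\<in>{s\<in>S. r s \<ge> 0}. geo_bound M (y s)) + (\<Sum>s\<in>{s\<in>S. r s < 0}. geo_bound M (y s))"
    using fin by (intro sum.union_disjoint) auto
  also have "\<dots> \<le> (M + D * harm (nat \<lfloor>D\<rfloor>)) + (M + D * harm (nat \<lfloor>D\<rfloor>))"
    using half[of "{s\<in>S. r s \<ge> 0}" 1] half[of "{s\<in>S. r s < 0}" "-1"] by (intro add_mono) auto
  finally show ?thesis by simp
qed

text \<open>The consequence of a rational approximation with denominator q on which the estimates
  rest: any \<open>q div 2 + 1\<close> consecutive multiples of \<theta>, also after a common shift,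
  are pairwise at least 1 / (2 q) apart modulo one.\<close>

definition well_spaced :: "real \<Rightarrow> nat \<Rightarrow> bool" where
  "well_spaced \<theta> q \<longleftrightarrow> q > 0 \<and> (\<forall>t::nat. 0 < t \<and> 2 * t \<le> q \<longrightarrow> dist_int (real t * \<theta>) \<ge> 1 / (2 * real q))"

text \<open>For 0 < t \<le> q / 2 the fraction t a / q is not an integer, hence at least 1 / q away
  from the integers; passing from a / q to \<theta> moves it by at most t / q^2 \<le> 1 / (2 q),
  which is why t stops at q / 2.\<close>

lemma well_spaced_rational_approx:
  fixes a :: int and q :: nat
  assumes q: "q > 0" and cop: "coprime a (int q)" and approx: "\<bar>\<theta> - of_int a / real q\<bar> \<le> 1 / (real q)\<^sup>2"
  shows "well_spaced \<theta> q"
  unfolding well_spaced_def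
proof (intro conjI q allI impI)
  fix t :: nat assume t: "0 < t \<and> 2 * t \<le> q"
  define k where "k = round (real t * \<theta>)"
  have "int t * a - k * int q \<noteq> 0"
  proof
    assume "int t * a - k * int q = 0"
    then have "int q dvd int t * a" by simp
    then have "int q dvd int t" using cop by (simp add: coprime_dvd_mult_left_iff coprime_commute)
    then have "q dvd t" by simp
    then show False using t by (auto dest: dvd_imp_le)
  qed
  then have "\<bar>of_int (int t * a - k * int q)\<bar> \<ge> (1::real)" by linarith
  then have "\<bar>of_int (int t * a - k * int q) / real q\<bar> \<ge> 1 / real q"
    using q by (simp add: divide_right_mono)
  also have "of_int (int t * a - k * int q) / real q = real t * (of_int a / real q) - of_int k"
    using q by (simp add: field_simps)
  finally have 1: "\<bar>real t * (of_int a / real q) - of_int k\<bar> \<ge> 1 / real q" .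
  have "\<bar>real t * \<theta> - real t * (of_int a / real q)\<bar> = real t * \<bar>\<theta> - of_int a / real q\<bar>"
    by (simp only: abs_mult abs_of_nat flip: right_diff_distrib)
  also have "\<dots> \<le> (real q / 2) * (1 / (real q)\<^sup>2)"
    using t approx by (intro mult_mono) auto
  also have "\<dots> = 1 / (2 * real q)" using q by (simp add: power2_eq_square)
  finally have 2: "\<bar>real t * \<theta> - real t * (of_int a / real q)\<bar> \<le> 1 / (2 * real q)" .
  define e where "e = 1 / (2 * real q)"
  have "1 / real q = 2 * e" by (simp add: e_def)
  moreover have "\<bar>x - z\<bar> \<ge> e" if "\<bar>y - z\<bar> \<ge> 2 * e" "\<bar>x - y\<bar> \<le> e" for x y z
    using that by linarith
  ultimately have "\<bar>real t * \<theta> - of_int k\<bar> \<ge> e" using 1 2 unfolding e_def[symmetric] by auto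
  then show "dist_int (real t * \<theta>) \<ge> 1 / (2 * real q)"
    by (simp only: dist_int_def k_def e_def)
qed

lemma sum_geo_bound_block:
  assumes ws: "well_spaced \<theta> q" and M: "M \<ge> 0" and S: "S \<subseteq> {a..<a + (q div 2 + 1)}"
  shows "(\<Sum>t\<in>S. geo_bound M (real t * \<theta> + \<gamma>)) \<le> 2 * (M + 2 * real q * harm (2 * q))"
proof -
  have q: "q > 0" using ws by (simp add: well_spaced_def)
  have "(\<Sum>t\<in>S. geo_bound M (real t * \<theta> + \<gamma>)) \<le> 2 * (M + (2 * real q) * harm (nat \<lfloor>2 * real q\<rfloor>))"
  proof (rule sum_geo_bound_spaced)
    fix s t assume st: "s \<in> S" "t \<in> S" "s \<noteq> t"
    have *: "dist_int ((real s * \<theta> + \<gamma>) - (real t * \<theta> + \<gamma>)) \<ge> 1 / (2 * real q)" if "s \<in> S" "t \<in> S" "t < s" for s t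
    proof -
      have "s \<in> {a..<a + (q div 2 + 1)}" "t \<in> {a..<a + (q div 2 + 1)}" using that S by auto
      then have "0 < s - t \<and> 2 * (s - t) \<le> q" using that by auto
      then have "dist_int (real (s - t) * \<theta>) \<ge> 1 / (2 * real q)"
        using ws unfolding well_spaced_def by blast
      moreover have "real (s - t) * \<theta> = (real s * \<theta> + \<gamma>) - (real t * \<theta> + \<gamma>)"
        using that by (simp add: of_nat_diff left_diff_distrib)
      ultimately show ?thesis by simp
    qed
    show "dist_int ((real s * \<theta> + \<gamma>) - (real t * \<theta> + \<gamma>)) \<ge> 1 / (2 * real q)"
    proof (cases "t < s")
      case False
      then have "t > s" using st by simp
      then show ?thesis using st by (subst dist_int_minus_commute) (rule *)
    qed (use st * in blast)
  qed (use q M S finite_subset in auto)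
  moreover have "nat \<lfloor>2 * real q\<rfloor> = 2 * q" by linarith
  ultimately show ?thesis by simp
qed

text \<open>The interval is covered by blocks of at least q / 2 terms, so there are at most 2 T / q
  + 1 of them.\<close>

lemma sum_geo_bound_interval:
  assumes ws: "well_spaced \<theta> q" and M: "M \<ge> 0"
  shows "(\<Sum>t\<in>{a..<a + T}. geo_bound M (real t * \<theta> + \<gamma>)) \<le> 
    (2 * real T / real q + 1) * (2 * (M + 2 * real q * harm (2 * q)))"
proof (induction T arbitrary: a rule: less_induct)
  case (less T)
  let ?K = "q div 2 + 1" and ?C = "2 * (M + 2 * real q * harm (2 * q))"
  have q: "q > 0" using ws by (simp add: well_spaced_def)
  have C0: "?C \<ge> 0" using M by (auto intro!: mult_nonneg_nonneg add_nonneg_nonneg harm_nonneg)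
  show ?case
  proof (cases "T \<le> ?K")
    case True
    have "(\<Sum>t\<in>{a..<a + T}. geo_bound M (real t * \<theta> + \<gamma>)) \<le> 1 * ?C"
      using sum_geo_bound_block[OF ws M, of "{a..<a + T}" a \<gamma>] True by simp
    also have "\<dots> \<le> (2 * real T / real q + 1) * ?C" using C0 by (intro mult_right_mono) auto
    finally show ?thesis .
  next
    case False
    have split: "{a..<a + T} = {a..<a + ?K} \<union> {a + ?K..<(a + ?K) + (T - ?K)}" using False by auto
    have "(\<Sum>t\<in>{a..<a + T}. geo_bound M (real t * \<theta> + \<gamma>)) = 
       (\<Sum>t\<in>{a..<a + ?K}. geo_bound M (real t * \<theta> + \<gamma>)) + 
       (\<Sum>t\<in>{a + ?K..<(a + ?K) + (T - ?K)}. geo_bound M (real t * \<theta> + \<gamma>))"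
      unfolding split by (intro sum.union_disjoint) auto
    also have "\<dots> \<le> ?C + (2 * real (T - ?K) / real q + 1) * ?C"
    proof (rule add_mono)
      show "(\<Sum>t\<in>{a..<a + ?K}. geo_bound M (real t * \<theta> + \<gamma>)) \<le> ?C"
        by (rule sum_geo_bound_block[OF ws M subset_refl])
      have "T - ?K < T" using False by simp
      then show "(\<Sum>t\<in>{a + ?K..<(a + ?K) + (T - ?K)}. geo_bound M (real t * \<theta> + \<gamma>))
        \<le> (2 * real (T - ?K) / real q + 1) * ?C" by (rule less.IH)
    qed
    also have "\<dots> = (2 * real (T - ?K) / real q + 2) * ?C" by (simp add: algebra_simps)
    also have "\<dots> \<le> (2 * real T / real q + 1) * ?C"
    proof (intro mult_right_mono C0)
      have "q \<le> 2 * ?K" by simp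
      then have "real q \<le> real (2 * ?K)" by (rule of_nat_mono)
      then have "real q \<le> 2 * real ?K" by (simp only: of_nat_mult of_nat_numeral)
      then have "1 \<le> 2 * real ?K / real q" using q by simp
      moreover have "2 * real (T - ?K) / real q = 2 * real T / real q - 2 * real ?K / real q"
        using False by (simp add: of_nat_diff diff_divide_distrib)
      ultimately show "2 * real (T - ?K) / real q + 2 \<le> 2 * real T / real q + 1" by linarith
    qed
    finally show ?thesis .
  qed
qed

text \<open>In the first block, where the cap X / t is too large, the distance from the integers
  themselves replaces it by 2 q. On the b-th later block of length K the cap is at most X / (b K),
  and these caps add up to a harmonic sum.\<close>

lemma sum_geo_bound_hyperbola:
  assumes ws: "well_spaced \<theta> q" and X: "X \<ge> 0" and L: "harm (2 * q) \<le> L" "harm Z \<le> L" "1 \<le> L"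
  shows "(\<Sum>t=1..Z. geo_bound (X / real t) (real t * \<theta>)) \<le> L * (4 * X / real q + 8 * real Z + 8 * real q)"
proof -
  let ?K = "q div 2 + 1"
  define f where "f t = geo_bound (X / real t) (real t * \<theta>)" for t :: nat
  define l :: real where "l = harm (2 * q)"
  have q: "q > 0" using ws by (simp add: well_spaced_def)
  have l: "0 \<le> l" "l \<le> L" using L by (auto simp: l_def harm_nonneg)
  have "q \<le> 2 * ?K" by simp
  then have "real q \<le> real (2 * ?K)" by (rule of_nat_mono)
  then have K: "real q \<le> 2 * real ?K" by (simp only: of_nat_mult of_nat_numeral)
  have f0: "f t \<ge> 0" for t using X by (simp add: f_def geo_bound_nonneg)
  have blocks: "sum f {1..<?K * (B + 1)} \<le> 2 * (2 * real q + 2 * real q * l) + 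
     (\<Sum>b=1..B. 2 * (X / (real b * real ?K) + 2 * real q * l))" for B
  proof (induction B)
    case 0
    have "sum f {1..<?K} \<le> (\<Sum>t\<in>{1..<?K}. geo_bound (2 * real q) (real t * \<theta> + 0))"
    proof (rule sum_mono)
      fix t assume "t \<in> {1..<?K}"
      then have "0 < t \<and> 2 * t \<le> q" by auto
      then have "dist_int (real t * \<theta>) \<ge> 1 / (2 * real q)" using ws by (simp add: well_spaced_def)
      then show "f t \<le> geo_bound (2 * real q) (real t * \<theta> + 0)"
        unfolding f_def using q by (simp add: geo_bound_le_inverse)
    qed
    also have "\<dots> \<le> 2 * (2 * real q + 2 * real q * harm (2 * q))"
      by (rule sum_geo_bound_block[OF ws, where a = 1]) auto
    finally show ?case by (simp add: l_def)
  next
    case (Suc B)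
    have split: "{1..<?K * (Suc B + 1)} = {1..<?K * (B + 1)} \<union> {?K * (B + 1)..<?K * (B + 1) + ?K}" by auto
    have "sum f {1..<?K * (Suc B + 1)} = sum f {1..<?K * (B + 1)} + sum f {?K * (B + 1)..<?K * (B + 1) + ?K}"
      unfolding split by (intro sum.union_disjoint) auto
    also have "sum f {?K * (B + 1)..<?K * (B + 1) + ?K} \<le> 
      (\<Sum>t\<in>{?K * (B + 1)..<?K * (B + 1) + ?K}. geo_bound (X / (real (Suc B) * real ?K)) (real t * \<theta> + 0))"
    proof (rule sum_mono)
      fix t assume "t \<in> {?K * (B + 1)..<?K * (B + 1) + ?K}"
      then have "?K * (B + 1) \<le> t" by simp
      then have "real (?K * (B + 1)) \<le> real t" by (rule of_nat_mono)
      then have t: "real (Suc B) * real ?K \<le> real t" by (simp only: of_nat_mult) (simp add: algebra_simps)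
      have "0 < ?K * (B + 1)" by simp
      then have "0 < t" using \<open>?K * (B + 1) \<le> t\<close> by (rule less_le_trans)
      then have "X / real t \<le> X / (real (Suc B) * real ?K)"
        using X t by (intro divide_left_mono mult_pos_pos) auto
      then show "f t \<le> geo_bound (X / (real (Suc B) * real ?K)) (real t * \<theta> + 0)"
        unfolding f_def by (simp add: geo_bound_mono)
    qed
    also have "\<dots> \<le> 2 * (X / (real (Suc B) * real ?K) + 2 * real q * harm (2 * q))"
      using X by (intro sum_geo_bound_block[OF ws, where a = "?K * (B + 1)"]) auto
    finally show ?case using Suc by (simp add: l_def)
  qed
  define B where "B = Z div ?K"
  have "Z < ?K * (B + 1)" unfolding B_def using dividend_less_times_div[of ?K Z] by simp
  then have "sum f {1..Z} \<le> sum f {1..<?K * (B + 1)}" using f0 by (intro sum_mono2) auto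
  also note blocks[of B]
  also have "(\<Sum>b=1..B. 2 * (X / (real b * k) + 2 * real q * l)) = 2 * X / k * harm B + real B * (4 * real q * l)" for k
    by (simp add: sum.distrib sum_distrib_left harm_def divide_inverse mult_ac)
  also have "2 * X / real ?K * harm B \<le> 4 * X / real q * L"
  proof (rule mult_mono)
    have "2 * X * real q \<le> 2 * X * (2 * real ?K)" using X K by (intro mult_left_mono) auto
    then show "2 * X / real ?K \<le> 4 * X / real q" using q by (simp add: field_simps)
    have "harm B \<le> (harm Z :: real)" by (intro harm_mono) (simp add: B_def)
    then show "harm B \<le> L" using L by simp
  qed (use X in \<open>auto simp: harm_nonneg\<close>)
  also have "real B * (4 * real q * l) \<le> 8 * real Z * L"
  proof -
    have "B * ?K \<le> Z" unfolding B_def by (rule div_times_less_eq_dividend)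
    then have "real B * real ?K \<le> real Z" by (metis of_nat_mult of_nat_mono)
    moreover have "real B * real q \<le> real B * (2 * real ?K)" using K by (intro mult_left_mono) auto
    ultimately have "4 * (real B * real q) \<le> 8 * real Z" by linarith
    then have "4 * (real B * real q) * l \<le> 8 * real Z * L" by (rule mult_mono) (use l in auto)
    then show ?thesis by (simp add: mult_ac)
  qed
  also have "2 * (2 * real q + 2 * real q * l) + (4 * X / real q * L + 8 * real Z * L) \<le> 
     L * (4 * X / real q + 8 * real Z + 8 * real q)"
  proof -
    have "real q * 1 \<le> real q * L" using L by (intro mult_left_mono) auto
    moreover have "real q * l \<le> real q * L" using l by (intro mult_left_mono) auto
    ultimately show ?thesis by (simp add: algebra_simps)
  qed
  finally show ?thesis by (simp add: f_def)
qed

subsection \<open>Sums of type I and type II\<close>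

text \<open>A Schur test on the fibres of \<phi>: the product g(s) g(t) of fibre weights is replaced
  by the mean of their squares, and symmetry of \<kappa> reduces both halves to row sums.\<close>

lemma sum_bilinear_le:
  fixes \<kappa> :: "nat \<Rightarrow> nat \<Rightarrow> real" and \<phi> :: "'a \<Rightarrow> nat"
  assumes P: "finite P" and \<phi>: "\<phi> ` P \<subseteq> {1..T}"
    and sym: "\<And>s t. \<kappa> s t = \<kappa> t s" and nn: "\<And>s t. \<kappa> s t \<ge> 0"
    and row: "\<And>s. (\<Sum>t=1..T. \<kappa> s t) \<le> C"
  shows "(\<Sum>x\<in>P. \<Sum>y\<in>P. w x * w y * \<kappa> (\<phi> x) (\<phi> y)) \<le> C * (\<Sum>t=1..T. (\<Sum>x | x \<in> P \<and> \<phi> x = t. w x)\<^sup>2)"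
proof -
  define g where "g t = (\<Sum>x | x \<in> P \<and> \<phi> x = t. w x)" for t
  have grp: "(\<Sum>x\<in>P. w x * F (\<phi> x)) = (\<Sum>t=1..T. g t * F t)" for F
  proof -
    have "(\<Sum>x\<in>P. w x * F (\<phi> x)) = (\<Sum>t=1..T. \<Sum>x | x \<in> P \<and> \<phi> x = t. w x * F (\<phi> x))"
      using P \<phi> by (intro sum.group[symmetric]) auto
    also have "\<dots> = (\<Sum>t=1..T. g t * F t)"
      unfolding g_def sum_distrib_right by (intro sum.cong refl) auto
    finally show ?thesis .
  qed
  have "(\<Sum>x\<in>P. \<Sum>y\<in>P. w x * w y * \<kappa> (\<phi> x) (\<phi> y)) = (\<Sum>x\<in>P. w x * (\<Sum>y\<in>P. w y * \<kappa> (\<phi> x) (\<phi> y)))"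
    by (simp add: sum_distrib_left mult.assoc)
  also have "\<dots> = (\<Sum>s=1..T. g s * (\<Sum>t=1..T. g t * \<kappa> s t))"
    by (simp only: grp[of "\<kappa> _"] grp[of "\<lambda>s. \<Sum>t=1..T. g t * \<kappa> s t"])
  also have "\<dots> = (\<Sum>s=1..T. \<Sum>t=1..T. g s * g t * \<kappa> s t)"
    by (simp add: sum_distrib_left mult.assoc)
  also have "\<dots> \<le> (\<Sum>s=1..T. \<Sum>t=1..T. (g s)\<^sup>2 / 2 * \<kappa> s t + (g t)\<^sup>2 / 2 * \<kappa> s t)"
  proof (intro sum_mono)
    fix s t
    have "g s * g t \<le> (g s)\<^sup>2 / 2 + (g t)\<^sup>2 / 2"
      using sum_squares_bound[of "g s" "g t"] by simp
    then have "g s * g t * \<kappa> s t \<le> ((g s)\<^sup>2 / 2 + (g t)\<^sup>2 / 2) * \<kappa> s t" using nn by (rule mult_right_mono)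
    then show "g s * g t * \<kappa> s t \<le> (g s)\<^sup>2 / 2 * \<kappa> s t + (g t)\<^sup>2 / 2 * \<kappa> s t" by (simp add: distrib_right)
  qed
  also have "\<dots> = (\<Sum>s=1..T. \<Sum>t=1..T. (g s)\<^sup>2 / 2 * \<kappa> s t) + (\<Sum>s=1..T. \<Sum>t=1..T. (g t)\<^sup>2 / 2 * \<kappa> s t)"
    by (simp only: sum.distrib)
  also have "(\<Sum>s=1..T. \<Sum>t=1..T. (g t)\<^sup>2 / 2 * \<kappa> s t) = (\<Sum>t=1..T. \<Sum>s=1..T. (g t)\<^sup>2 / 2 * \<kappa> t s)"
    by (subst sum.swap) (simp only: sym)
  also have "(\<Sum>s=1..T. \<Sum>t=1..T. (g s)\<^sup>2 / 2 * \<kappa> s t) + (\<Sum>t=1..T. \<Sum>s=1..T. (g t)\<^sup>2 / 2 * \<kappa> t s) =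
     (\<Sum>s=1..T. (g s)\<^sup>2 * (\<Sum>t=1..T. \<kappa> s t))"
    by (simp only: sum_distrib_left flip: sum.distrib) (simp add: field_simps)
  also have "\<dots> \<le> (\<Sum>s=1..T. (g s)\<^sup>2 * C)" by (intro sum_mono mult_left_mono row) auto
  finally show ?thesis by (simp add: g_def sum_distrib_left mult.commute)
qed

text \<open>On the fibre, a pair is determined by its second component, a divisor of t.\<close>

lemma sum_divisor_fibre_le_divisor3:
  assumes "t > 0"
  shows "(\<Sum>x | x \<in> {1..H} \<times> {1..K} \<and> fst x * snd x = t. real (num_divisors (snd x))) \<le> divisor3 t"
proof -
  let ?S = "{x. x \<in> {1..H} \<times> {1..K} \<and> fst x * snd x = t}"
  have "inj_on snd ?S" by (intro inj_onI) (auto simp: prod_eq_iff)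
  then have "(\<Sum>x\<in>?S. real (num_divisors (snd x))) = (\<Sum>d\<in>snd ` ?S. real (num_divisors d))"
    by (simp add: sum.reindex)
  also have "\<dots> \<le> (\<Sum>d | d dvd t. real (num_divisors d))"
    using assms by (intro sum_mono2) auto
  finally show ?thesis by (simp add: divisor3_def)
qed

text \<open>A pair x = (h, k) enters the phase only through h k. Opening the square and summing over
  m first leaves geometric sums in (h k - h' k') \<theta> with products up to T; the Schur test then
  needs only the spacing of the multiples of \<theta> and the mean square of
  \<open>divisor3\<close>.\<close>

lemma sum_norm_square_type_II:
  fixes z :: "nat \<times> nat \<Rightarrow> complex"
  assumes ws: "well_spaced \<theta> q" and M: "M \<ge> 1" and T: "T = H * (N div M)" "T \<ge> 1"
    and z: "\<And>x. norm (z x) \<le> real (num_divisors (snd x))"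
  shows "(\<Sum>m\<in>{M<..2 * M}. (norm (\<Sum>x\<in>{1..H} \<times> {1..N div m}. z x * expi (real (m * (fst x * snd x)) * \<theta>)))\<^sup>2)
    \<le> (2 * real T / real q + 1) * (2 * (real M + 2 * real q * harm (2 * q))) * (real T * (1 + ln (real T)) ^ 9)"
    (is "?lhs \<le> ?C * _")
proof -
  define P where "P = {1..H} \<times> {1..N div M}"
  define \<phi> where "\<phi> x = fst x * snd x" for x :: "nat \<times> nat"
  define w where "w x = real (num_divisors (snd x))" for x :: "nat \<times> nat"
  define \<kappa> where "\<kappa> s t = geo_bound (real M) ((real s - real t) * \<theta>)" for s t :: nat
  \<comment> \<open>The condition k \<le> N div m, detached from the range of x: the set P is the
    same for all m, and for fixed x and y the condition confines m to an interval.\<close>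
  define b where "b m x = (if snd x \<le> N div m then 1 else 0 :: complex)" for m :: nat and x :: "nat \<times> nat"
  have finP: "finite P" by (simp add: P_def)
  have \<phi>P: "\<phi> ` P \<subseteq> {1..T}"
    unfolding P_def \<phi>_def T by (auto intro!: mult_le_mono)
  have w: "norm (z x) \<le> w x" for x using z by (simp add: w_def)
  have restrict: "(\<Sum>x\<in>{1..H} \<times> {1..N div m}. z x * expi (real (m * (fst x * snd x)) * \<theta>)) = 
      (\<Sum>x\<in>P. z x * b m x * expi (real m * (real (\<phi> x) * \<theta>)))" if m: "m \<in> {M<..2 * M}" for m
  proof -
    have "N div m \<le> N div M" using m M by (intro div_le_mono2) auto
    then have "(\<Sum>x\<in>P. z x * b m x * expi (real m * (real (\<phi> x) * \<theta>))) = 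
       (\<Sum>x\<in>{1..H} \<times> {1..N div m}. z x * b m x * expi (real m * (real (\<phi> x) * \<theta>)))"
      unfolding P_def by (intro sum.mono_neutral_right) (auto simp: b_def)
    also have "\<dots> = (\<Sum>x\<in>{1..H} \<times> {1..N div m}. z x * expi (real (m * (fst x * snd x)) * \<theta>))"
      by (intro sum.cong) (auto simp: b_def \<phi>_def mult.assoc)
    finally show ?thesis by simp
  qed
  have square: "of_real ((norm (\<Sum>x\<in>P. z x * b m x * expi (real m * (real (\<phi> x) * \<theta>))))\<^sup>2) = 
     (\<Sum>x\<in>P. \<Sum>y\<in>P. z x * cnj (z y) * (b m x * b m y * expi (real m * ((real (\<phi> x) - real (\<phi> y)) * \<theta>))))" for m
  proof -
    have "cnj (b m y) = b m y" for y by (simp add: b_def)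
    moreover have "expi (real m * ((real (\<phi> x) - real (\<phi> y)) * \<theta>)) = 
       expi (real m * (real (\<phi> x) * \<theta>)) * cnj (expi (real m * (real (\<phi> y) * \<theta>)))" for x y
      by (simp add: left_diff_distrib right_diff_distrib expi_diff)
    ultimately show ?thesis unfolding complex_norm_square by (simp add: sum_product mult_ac)
  qed
  have inner: "norm (\<Sum>m\<in>{M<..2 * M}. b m x * b m y * expi (real m * ((real (\<phi> x) - real (\<phi> y)) * \<theta>))) \<le> \<kappa> (\<phi> x) (\<phi> y)"
    if xy: "x \<in> P" "y \<in> P" for x y
  proof -
    define E where "E = min (2 * M) (min (N div snd x) (N div snd y)) + 1"
    have pos: "snd x > 0" "snd y > 0" using xy by (auto simp: P_def)
    have b: "b m x * b m y = (if m < E then 1 else 0)" if "m \<in> {M<..2 * M}" for m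
    proof -
      have "snd x \<le> N div m \<longleftrightarrow> m \<le> N div snd x" "snd y \<le> N div m \<longleftrightarrow> m \<le> N div snd y"
        using that pos by (auto simp: less_eq_div_iff_mult_less_eq mult.commute)
      then show ?thesis using that by (auto simp: b_def E_def)
    qed
    have "(\<Sum>m\<in>{M<..2 * M}. b m x * b m y * expi (real m * ((real (\<phi> x) - real (\<phi> y)) * \<theta>))) = 
       (\<Sum>m\<in>{M<..2 * M}. if m < E then expi (real m * ((real (\<phi> x) - real (\<phi> y)) * \<theta>)) else 0)"
      by (intro sum.cong refl) (simp add: b)
    also have "\<dots> = (\<Sum>m\<in>{M + 1..<E}. expi (real m * ((real (\<phi> x) - real (\<phi> y)) * \<theta>)))"
      by (intro sum.mono_neutral_cong_right) (auto simp: E_def)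
    also have "norm \<dots> \<le> geo_bound (real (E - (M + 1))) ((real (\<phi> x) - real (\<phi> y)) * \<theta>)"
      by (rule norm_geometric_sum_le)
    also have "\<dots> \<le> \<kappa> (\<phi> x) (\<phi> y)" unfolding \<kappa>_def by (intro geo_bound_mono) (auto simp: E_def)
    finally show ?thesis .
  qed
  have "of_real ?lhs = (\<Sum>m\<in>{M<..2 * M}. of_real ((norm (\<Sum>x\<in>P. z x * b m x * expi (real m * (real (\<phi> x) * \<theta>))))\<^sup>2) :: complex)"
    unfolding of_real_sum by (intro sum.cong refl) (simp only: restrict)
  also have "\<dots> = (\<Sum>m\<in>{M<..2 * M}. \<Sum>x\<in>P. \<Sum>y\<in>P. z x * cnj (z y) * (b m x * b m y * expi (real m * ((real (\<phi> x) - real (\<phi> y)) * \<theta>))))"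
    by (simp only: square)
  also have "\<dots> = (\<Sum>x\<in>P. \<Sum>m\<in>{M<..2 * M}. \<Sum>y\<in>P. z x * cnj (z y) * (b m x * b m y * expi (real m * ((real (\<phi> x) - real (\<phi> y)) * \<theta>))))"
    by (rule sum.swap)
  also have "\<dots> = (\<Sum>x\<in>P. \<Sum>y\<in>P. \<Sum>m\<in>{M<..2 * M}. z x * cnj (z y) * (b m x * b m y * expi (real m * ((real (\<phi> x) - real (\<phi> y)) * \<theta>))))"
    by (intro sum.cong refl sum.swap)
  also have "\<dots> = (\<Sum>x\<in>P. \<Sum>y\<in>P. z x * cnj (z y) * (\<Sum>m\<in>{M<..2 * M}. b m x * b m y * expi (real m * ((real (\<phi> x) - real (\<phi> y)) * \<theta>))))"
    by (simp only: sum_distrib_left)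
  finally have lhs: "of_real ?lhs = \<dots>" .
  have "?lhs \<le> norm (of_real ?lhs :: complex)" unfolding norm_of_real by (rule abs_ge_self)
  also have "\<dots> \<le> (\<Sum>x\<in>P. \<Sum>y\<in>P. w x * w y * \<kappa> (\<phi> x) (\<phi> y))"
    unfolding lhs
  proof (intro sum_norm_le)
    fix x y assume xy: "x \<in> P" "y \<in> P"
    show "norm (z x * cnj (z y) * (\<Sum>m\<in>{M<..2 * M}. b m x * b m y * expi (real m * ((real (\<phi> x) - real (\<phi> y)) * \<theta>))))
       \<le> w x * w y * \<kappa> (\<phi> x) (\<phi> y)"
      unfolding norm_mult complex_mod_cnj
      by (intro mult_mono w inner xy mult_nonneg_nonneg norm_ge_zero) (simp add: w_def)+
  qed
  also have "\<dots> \<le> ?C * (\<Sum>t=1..T. (\<Sum>x | x \<in> P \<and> \<phi> x = t. w x)\<^sup>2)"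
  proof (rule sum_bilinear_le[OF finP \<phi>P])
    show "\<kappa> s t = \<kappa> t s" for s t
      unfolding \<kappa>_def by (intro geo_bound_cong) (simp add: left_diff_distrib dist_int_minus_commute)
    show "\<kappa> s t \<ge> 0" for s t by (simp add: \<kappa>_def geo_bound_nonneg)
    show "(\<Sum>t=1..T. \<kappa> s t) \<le> ?C" for s
    proof -
      have "(\<Sum>t=1..T. \<kappa> s t) = (\<Sum>t\<in>{1..<1 + T}. geo_bound (real M) (real t * \<theta> + (- real s * \<theta>)))"
        unfolding \<kappa>_def 
        by (intro sum.cong geo_bound_cong) (auto simp: left_diff_distrib dist_int_minus_commute[of "real s * \<theta>"])
      also have "\<dots> \<le> ?C" by (rule sum_geo_bound_interval[OF ws]) simp
      finally show ?thesis .
    qed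
  qed
  also have "\<dots> \<le> ?C * (real T * (1 + ln (real T)) ^ 9)"
  proof (rule mult_left_mono)
    have "(\<Sum>t=1..T. (\<Sum>x | x \<in> P \<and> \<phi> x = t. w x)\<^sup>2) \<le> (\<Sum>t=1..T. (divisor3 t)\<^sup>2)"
      unfolding P_def \<phi>_def w_def
      by (intro sum_mono power_mono sum_divisor_fibre_le_divisor3 sum_nonneg) auto
    also have "\<dots> \<le> real T * (1 + ln (real T)) ^ 9" by (rule sum_divisor3_squared_le[OF T(2)])
    finally show "(\<Sum>t=1..T. (\<Sum>x | x \<in> P \<and> \<phi> x = t. w x)\<^sup>2) \<le> real T * (1 + ln (real T)) ^ 9" .
    show "?C \<ge> 0" by (intro mult_nonneg_nonneg add_nonneg_nonneg) (auto simp: harm_nonneg)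
  qed
  finally show ?thesis .
qed

text \<open>L^12 consists of L^2 from the coefficients a, L from \<open>harm (2 * q)\<close> and L^9
  from the mean square of \<open>divisor3\<close>. The bound for all h together has the shape of a
  bound for one sum of length H N.\<close>

lemma type_II_dyadic:
  fixes a :: "nat \<Rightarrow> real" and b :: "nat \<Rightarrow> real"
  assumes ws: "well_spaced \<theta> q" and M: "M \<ge> 1" and N: "N \<ge> 1" and H: "H \<ge> 1"
    and a: "\<And>m. \<bar>a m\<bar> \<le> L" and b: "\<And>k. \<bar>b k\<bar> \<le> real (num_divisors k)"
    and L: "1 + ln (real (H * N)) \<le> L" "harm (2 * q) \<le> L"
  shows "(\<Sum>h=1..H. norm (\<Sum>m\<in>{M<..2 * M}. of_real (a m) * (\<Sum>k=1..N div m. of_real (b k) * expi (real (h * (m * k)) * \<theta>))))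
    \<le> sqrt (8 * L ^ 12 * (real H * real N) * (real H * real N / real q + real H * real N / real M + real M + real q))"
proof -
  define S where "S h = (\<Sum>m\<in>{M<..2 * M}. of_real (a m) * (\<Sum>k=1..N div m. of_real (b k) * expi (real (h * (m * k)) * \<theta>)))" for h
  define T where "T = H * (N div M)"
  \<comment> \<open>The conjugate sign of S(h) linearizes the absolute value. Having modulus at most
    1, it joins the coefficient of k, so that h and k form one variable.\<close>
  define z where "z x = cnj (sgn (S (fst x))) * of_real (b (snd x))" for x :: "nat \<times> nat"
  define Y where "Y m = (\<Sum>x\<in>{1..H} \<times> {1..N div m}. z x * expi (real (m * (fst x * snd x)) * \<theta>))" for m
  have q: "q > 0" using ws by (simp add: well_spaced_def)
  have HN: "real (H * N) \<ge> 1" using H N by (metis mult_le_mono nat_mult_1 of_nat_1 of_nat_mono)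
  have L1: "1 \<le> L" using L(1) ln_ge_zero[OF HN] by linarith
  show ?thesis
  proof (cases "T = 0")
    case True
    then have "N div M = 0" using H by (simp add: T_def)
    then have "N div m = 0" if "m \<in> {M<..2 * M}" for m
      using that M div_le_mono2[of M m N] by simp
    then have "(\<Sum>h=1..H. norm (\<Sum>m\<in>{M<..2 * M}. of_real (a m) * (\<Sum>k=1..N div m. of_real (b k) * expi (real (h * (m * k)) * \<theta>)))) = 0"
      by (intro sum.neutral ballI) (simp add: sum.neutral)
    then show ?thesis using L1 by simp
  next
    case False
    then have T1: "T \<ge> 1" by simp
    have sgn: "of_real (norm u) = cnj (sgn u) * u" for u :: complex
    proof (cases "u = 0")
      case False
      then have "cnj (sgn u) * u = u * cnj u / of_real (norm u)" by (simp add: sgn_eq)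
      then show ?thesis using False by (simp add: complex_norm_square[symmetric] power2_eq_square)
    qed simp
    have "of_real (\<Sum>h=1..H. norm (S h)) = (\<Sum>h=1..H. cnj (sgn (S h)) * S h)"
      by (simp add: sgn)
    also have "\<dots> = (\<Sum>h=1..H. \<Sum>m\<in>{M<..2 * M}. of_real (a m) * (\<Sum>k=1..N div m. z (h, k) * expi (real (m * (h * k)) * \<theta>)))"
      by (subst S_def) (simp add: sum_distrib_left z_def mult_ac)
    also have "\<dots> = (\<Sum>m\<in>{M<..2 * M}. \<Sum>h=1..H. of_real (a m) * (\<Sum>k=1..N div m. z (h, k) * expi (real (m * (h * k)) * \<theta>)))"
      by (rule sum.swap)
    also have "\<dots> = (\<Sum>m\<in>{M<..2 * M}. of_real (a m) * Y m)"
      by (simp add: Y_def sum_distrib_left sum.cartesian_product case_prod_unfold)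
    finally have eq: "of_real (\<Sum>h=1..H. norm (S h)) = (\<Sum>m\<in>{M<..2 * M}. of_real (a m) * Y m)" .
    have "(\<Sum>h=1..H. norm (S h)) = norm (of_real (\<Sum>h=1..H. norm (S h)) :: complex)"
      unfolding norm_of_real by (simp add: sum_nonneg)
    also have "\<dots> \<le> (\<Sum>m\<in>{M<..2 * M}. norm (of_real (a m) * Y m))" unfolding eq by (rule norm_sum)
    also have "\<dots> \<le> (\<Sum>m\<in>{M<..2 * M}. L * norm (Y m))"
      using a by (intro sum_mono) (simp add: norm_mult mult_right_mono)
    finally have le: "(\<Sum>h=1..H. norm (S h)) \<le> (\<Sum>m\<in>{M<..2 * M}. L * norm (Y m))" .
    have "(\<Sum>h=1..H. norm (S h))\<^sup>2 \<le> (\<Sum>m\<in>{M<..2 * M}. L * norm (Y m))\<^sup>2"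
      using le by (intro power_mono sum_nonneg) auto
    also have "\<dots> \<le> (\<Sum>m\<in>{M<..2 * M}. L\<^sup>2) * (\<Sum>m\<in>{M<..2 * M}. (norm (Y m))\<^sup>2)"
      by (rule Cauchy_Schwarz_ineq_sum)
    also have "(\<Sum>m\<in>{M<..2 * M}. L\<^sup>2) = real M * L\<^sup>2" by simp
    also have "(\<Sum>m\<in>{M<..2 * M}. (norm (Y m))\<^sup>2) \<le> 
       (2 * real T / real q + 1) * (2 * (real M + 2 * real q * harm (2 * q))) * (real T * (1 + ln (real T)) ^ 9)"
      unfolding Y_def
    proof (rule sum_norm_square_type_II[OF ws M T_def T1])
      show "norm (z x) \<le> real (num_divisors (snd x))" for x
        using b[of "snd x"] by (simp add: z_def norm_mult norm_sgn)
    qed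
    also have "\<dots> \<le> (2 * (real T / real q + 1)) * (2 * (2 * (real M + real q) * L)) * (real T * L ^ 9)"
    proof (intro mult_mono)
      show "2 * real T / real q + 1 \<le> 2 * (real T / real q + 1)" by simp
      have "real M \<le> real M * L" using mult_left_mono[OF L1, of "real M"] by simp
      moreover have "real q * harm (2 * q) \<le> real q * L" using L by (intro mult_left_mono) auto
      moreover have "real M * L \<ge> 0" using L1 by simp
      ultimately show "real M + 2 * real q * harm (2 * q) \<le> 2 * (real M + real q) * L" 
        by (simp add: algebra_simps)
      have "real T \<le> real (H * N)" unfolding T_def by (intro of_nat_mono mult_le_mono) auto
      then have "1 + ln (real T) \<le> L" using T1 L by (smt (verit) ln_mono of_nat_0_less_iff less_le_trans zero_less_one)
      then show "(1 + ln (real T)) ^ 9 \<le> L ^ 9" using T1 by (intro power_mono) auto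
    qed (use T1 L1 in \<open>auto simp: harm_nonneg intro!: mult_nonneg_nonneg add_nonneg_nonneg\<close>)
    finally have "(\<Sum>h=1..H. norm (S h))\<^sup>2 \<le> real M * L\<^sup>2 * 
       ((2 * (real T / real q + 1)) * (2 * (2 * (real M + real q) * L)) * (real T * L ^ 9))"
      by (simp add: mult_left_mono)
    also have "\<dots> = 8 * L ^ 12 * ((real M * real T) * (real M * real T / real q + real T + real M + real q))"
      using q by (simp add: field_simps eval_nat_numeral)
    also have "\<dots> \<le> 8 * L ^ 12 * ((real H * real N) * (real H * real N / real q + real H * real N / real M + real M + real q))"
    proof -
      have "M * (N div M) \<le> N" by simp
      then have "M * T \<le> H * N" unfolding T_def by (metis mult.left_commute mult_le_mono2)
      then have MT: "real M * real T \<le> real H * real N" by (metis of_nat_mono of_nat_mult)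
      then have "real T \<le> real H * real N / real M" using M by (simp add: field_simps)
      moreover have "real M * real T / real q \<le> real H * real N / real q" using MT by (intro divide_right_mono) auto
      ultimately have "real M * real T / real q + real T + real M + real q \<le>
          real H * real N / real q + real H * real N / real M + real M + real q"
        by (intro add_mono) auto
      from mult_mono[OF MT this] show ?thesis using L1 by (intro mult_left_mono) auto
    qed
    finally have "(\<Sum>h=1..H. norm (S h)) \<le> 
       sqrt (8 * L ^ 12 * ((real H * real N) * (real H * real N / real q + real H * real N / real M + real M + real q)))"
      by (rule real_le_rsqrt)
    then show ?thesis by (simp add: S_def mult.assoc)
  qed
qed

lemma sum_dyadic_split:
  fixes F :: "nat \<Rightarrow> 'a::comm_monoid_add"
  shows "(\<Sum>m\<in>{U<..U * 2 ^ r}. F m) = (\<Sum>i<r. \<Sum>m\<in>{U * 2 ^ i<..2 * (U * 2 ^ i)}. F m)"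
proof (induction r)
  case (Suc r)
  have "{U<..2 * W} = {U<..W} \<union> {W<..2 * W}" if "U \<le> W" for W :: nat using that by auto
  from this[of "U * 2 ^ r"] have "{U<..U * 2 ^ Suc r} = {U<..U * 2 ^ r} \<union> {U * 2 ^ r<..2 * (U * 2 ^ r)}"
    by (simp add: mult.left_commute)
  then show ?case using Suc by (simp add: sum.union_disjoint)
qed simp

text \<open>Dyadic pieces with M \<ge> W vanish and M is never below U, so one bound serves all
  pieces; at most 2 L of them reach up to N.\<close>

lemma type_II_sum:
  fixes a :: "nat \<Rightarrow> real" and b :: "nat \<Rightarrow> real"
  assumes ws: "well_spaced \<theta> q" and U: "U \<ge> 1" and N: "N \<ge> 1" and H: "H \<ge> 1"
    and a: "\<And>m. \<bar>a m\<bar> \<le> L" "\<And>m. m \<le> U \<Longrightarrow> a m = 0" "\<And>m. m > W \<Longrightarrow> a m = 0"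
    and b: "\<And>k. \<bar>b k\<bar> \<le> real (num_divisors k)"
    and L: "1 + ln (real (H * N)) \<le> L" "harm (2 * q) \<le> L"
  shows "(\<Sum>h=1..H. norm (\<Sum>m=1..N. of_real (a m) * (\<Sum>k=1..N div m. of_real (b k) * expi (real (h * (m * k)) * \<theta>))))
    \<le> 2 * L * sqrt (8 * L ^ 12 * (real H * real N) * (real H * real N / real q + real H * real N / real U + real W + real q))"
    (is "_ \<le> 2 * L * ?R")
proof -
  define F where "F h m = of_real (a m) * (\<Sum>k=1..N div m. of_real (b k) * expi (real (h * (m * k)) * \<theta>))" for h m
  define r where "r = nat \<lceil>log 2 (real N)\<rceil>"
  have q: "q > 0" using ws by (simp add: well_spaced_def)
  have "N \<le> H * N" using H by simp
  then have HN: "real N \<le> real (H * N)" by (rule of_nat_mono)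
  have L1: "1 + ln (real N) \<le> L" using L(1) HN N by (smt (verit) ln_mono of_nat_0_less_iff less_le_trans zero_less_one)
  have lnN: "ln (real N) \<ge> 0" using N by simp
  have r: "N \<le> 2 ^ r"
  proof -
    have "log 2 (real N) \<le> real r" unfolding r_def by linarith
    then have "real N \<le> 2 powr real r" using N by (simp add: log_le_iff)
    then show ?thesis by (simp add: powr_realpow)
  qed
  have rL: "real r \<le> 2 * L"
  proof -
    have "0 \<le> log 2 (real N)" using N by simp
    then have "real r \<le> log 2 (real N) + 1" unfolding r_def by linarith
    also have "log 2 (real N) \<le> 2 * ln (real N)"
    proof -
      have "ln (real N) * 1 \<le> ln (real N) * (2 * ln 2)"
        using ln2_ge_two_thirds lnN by (intro mult_left_mono) auto
      then show ?thesis by (simp add: log_def field_simps)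
    qed
    finally show ?thesis using L1 by linarith
  qed
  have eq: "(\<Sum>m=1..N. F h m) = (\<Sum>i<r. \<Sum>m\<in>{U * 2 ^ i<..2 * (U * 2 ^ i)}. F h m)" for h
  proof -
    have "(\<Sum>m=1..N. F h m) = (\<Sum>m\<in>{U<..U * 2 ^ r}. F h m)"
    proof (rule sum.mono_neutral_cong)
      fix m assume "m \<in> {U<..U * 2 ^ r} - {1..N}"
      then show "F h m = 0" using U by (auto simp: F_def)
    next
      fix m assume m: "m \<in> {1..N} - {U<..U * 2 ^ r}"
      have "m \<le> N" using m by simp
      also note r
      also have "2 ^ r \<le> U * 2 ^ r" using U by simp
      finally have "m \<le> U" using m by auto
      then show "F h m = 0" by (simp add: F_def a)
    qed auto
    then show ?thesis by (simp add: sum_dyadic_split)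
  qed
  have "(\<Sum>h=1..H. norm (\<Sum>m=1..N. F h m)) \<le> (\<Sum>h=1..H. \<Sum>i<r. norm (\<Sum>m\<in>{U * 2 ^ i<..2 * (U * 2 ^ i)}. F h m))"
    unfolding eq by (intro sum_mono norm_sum)
  also have "\<dots> = (\<Sum>i<r. \<Sum>h=1..H. norm (\<Sum>m\<in>{U * 2 ^ i<..2 * (U * 2 ^ i)}. F h m))" by (rule sum.swap)
  also have "\<dots> \<le> (\<Sum>i<r. ?R)"
  proof (rule sum_mono)
    fix i
    define M where "M = U * 2 ^ i"
    have M: "M \<ge> 1" "U \<le> M" using U by (auto simp: M_def)
    have "(\<Sum>h=1..H. norm (\<Sum>m\<in>{M<..2 * M}. F h m)) \<le> ?R"
    proof (cases "M \<ge> W")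
      case True
      then have "F h m = 0" if "m \<in> {M<..2 * M}" for h m using that by (simp add: F_def a)
      then show ?thesis using L1 lnN by simp
    next
      case False
      have "(\<Sum>h=1..H. norm (\<Sum>m\<in>{M<..2 * M}. F h m)) \<le> 
        sqrt (8 * L ^ 12 * (real H * real N) * (real H * real N / real q + real H * real N / real M + real M + real q))"
        unfolding F_def by (rule type_II_dyadic[OF ws M(1) N H a(1) b L])
      also have "\<dots> \<le> ?R"
      proof (intro real_sqrt_le_mono mult_left_mono add_mono order_refl)
        show "real H * real N / real M \<le> real H * real N / real U" using M U by (intro divide_left_mono) auto
      qed (use False L1 lnN in auto)
      finally show ?thesis .
    qed
    then show "(\<Sum>h=1..H. norm (\<Sum>m\<in>{U * 2 ^ i<..2 * (U * 2 ^ i)}. F h m)) \<le> ?R" by (simp only: M_def)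
  qed
  also have "\<dots> = real r * ?R" by simp
  also have "\<dots> \<le> 2 * L * ?R" 
    using rL L1 lnN by (intro mult_right_mono real_sqrt_ge_zero mult_nonneg_nonneg add_nonneg_nonneg) auto
  finally show ?thesis by (simp only: F_def)
qed

section \<open>Partial summation and sums of type I\<close>

lemma norm_sum_ln_le:
  fixes z :: "nat \<Rightarrow> complex"
  assumes "\<And>n. n \<le> K \<Longrightarrow> norm (\<Sum>k=1..n. z k) \<le> B"
  shows "norm (\<Sum>k=1..K. of_real (ln (real k)) * z k) \<le> 2 * ln (real K) * B"
proof (cases "K = 0")
  case False
  define Z where "Z n = (\<Sum>k=1..n. z k)" for n
  \<comment> \<open>The induction follows the distance of the weighted sum from its boundary term
    \<open>ln n * Z n\<close>; each step adds an increment of the logarithm times B, and the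
    increments telescope.\<close>
  have "norm ((\<Sum>k=1..n. of_real (ln (real k)) * z k) - of_real (ln (real n)) * Z n) \<le> ln (real n) * B"
    if "1 \<le> n" "n \<le> K" for n
    using that
  proof (induction n rule: dec_induct)
    case (step n)
    have "(\<Sum>k=1..Suc n. of_real (ln (real k)) * z k) - of_real (ln (real (Suc n))) * Z (Suc n) = 
       ((\<Sum>k=1..n. of_real (ln (real k)) * z k) - of_real (ln (real n)) * Z n) - of_real (ln (real (Suc n)) - ln (real n)) * Z n"
      by (simp add: Z_def algebra_simps)
    also have "norm \<dots> \<le> ln (real n) * B + (ln (real (Suc n)) - ln (real n)) * B"
    proof (rule order_trans[OF norm_triangle_ineq4 add_mono])
      show "norm ((\<Sum>k=1..n. of_real (ln (real k)) * z k) - of_real (ln (real n)) * Z n) \<le> ln (real n) * B"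
        using step by simp
      have "ln (real n) \<le> ln (real (Suc n))" using step by simp
      then show "norm (of_real (ln (real (Suc n)) - ln (real n)) * Z n) \<le> (ln (real (Suc n)) - ln (real n)) * B"
        using assms[of n] step unfolding norm_mult norm_of_real Z_def by (intro mult_mono) auto
    qed
    finally show ?case by (simp add: algebra_simps)
  qed (simp add: Z_def)
  from this[of K] have "norm ((\<Sum>k=1..K. of_real (ln (real k)) * z k) - of_real (ln (real K)) * Z K) \<le> ln (real K) * B"
    using False by simp
  moreover have "norm (of_real (ln (real K)) * Z K) \<le> ln (real K) * B"
    using assms[of K] False unfolding norm_mult norm_of_real Z_def by (intro mult_mono) auto
  ultimately show ?thesis
    using norm_triangle_ineq2[of "\<Sum>k=1..K. of_real (ln (real k)) * z k" "of_real (ln (real K)) * Z K"] by linarith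
qed simp

text \<open>The multiples of h \<theta> need not be well spaced, but d goes injectively to h d, a
  multiplier of \<theta> up to H Y, and N / d = N h / (h d) \<le> N H / (h d). The loss of a factor
  H is later covered by q \<ge> \<Theta> H^2.\<close>

lemma sum_geo_bound_type_I:
  assumes ws: "well_spaced \<theta> q" and h: "h \<in> {1..H}" and L: "harm (2 * q) \<le> L" "harm (H * Y) \<le> L" "1 \<le> L"
  shows "(\<Sum>d=1..Y. geo_bound (real N / real d) (real (h * d) * \<theta>))
     \<le> L * (4 * (real N * real H) / real q + 8 * (real H * real Y) + 8 * real q)"
proof -
  have "(\<Sum>d=1..Y. geo_bound (real N / real d) (real (h * d) * \<theta>)) \<le>
      (\<Sum>d=1..Y. geo_bound ((real N * real H) / real (h * d)) (real (h * d) * \<theta>))"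
  proof (intro sum_mono geo_bound_mono)
    fix d assume d: "d \<in> {1..Y}"
    have "real N / real d = (real N * real h) / real (h * d)" using d h by simp
    also have "\<dots> \<le> (real N * real H) / real (h * d)"
      using h by (intro divide_right_mono mult_left_mono) auto
    finally show "real N / real d \<le> (real N * real H) / real (h * d)" .
  qed
  also have "\<dots> = (\<Sum>t\<in>(\<lambda>d. h * d) ` {1..Y}. geo_bound ((real N * real H) / real t) (real t * \<theta>))"
    using h by (subst sum.reindex) (auto simp: inj_on_def)
  also have "\<dots> \<le> (\<Sum>t=1..H * Y. geo_bound ((real N * real H) / real t) (real t * \<theta>))"
    using h by (intro sum_mono2) (auto intro!: mult_le_mono geo_bound_nonneg)
  also have "\<dots> \<le> L * (4 * (real N * real H) / real q + 8 * real (H * Y) + 8 * real q)"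
    by (rule sum_geo_bound_hyperbola[OF ws _ L]) simp
  finally show ?thesis by simp
qed

lemma norm_expi_sum_le_geo_bound:
  assumes "d \<ge> 1" "n \<le> N div d"
  shows "norm (\<Sum>k=1..n. expi (real (h * (d * k)) * \<theta>)) \<le> geo_bound (real N / real d) (real (h * d) * \<theta>)"
proof -
  have "(\<Sum>k=1..n. expi (real (h * (d * k)) * \<theta>)) = (\<Sum>k\<in>{1..<n + 1}. expi (real k * (real (h * d) * \<theta>)))"
    by (intro sum.cong) (auto simp: mult_ac)
  also have "norm \<dots> \<le> geo_bound (real (n + 1 - 1)) (real (h * d) * \<theta>)" by (rule norm_geometric_sum_le)
  also have "\<dots> \<le> geo_bound (real N / real d) (real (h * d) * \<theta>)"
  proof (rule geo_bound_mono)
    have "real n \<le> real (N div d)" using assms by simp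
    also have "\<dots> \<le> real N / real d" by (rule of_nat_div_le_of_nat)
    finally show "real (n + 1 - 1) \<le> real N / real d" by simp
  qed
  finally show ?thesis .
qed

text \<open>D measures by how much the inner sum may exceed \<open>geo_bound\<close>: 2 L for
  logarithmic weights, 1 for constant ones.\<close>

lemma type_I_sum:
  fixes c :: "nat \<Rightarrow> real" and w :: "nat \<Rightarrow> real"
  assumes ws: "well_spaced \<theta> q" and h: "h \<in> {1..H}" and L: "harm (2 * q) \<le> L" "harm (H * Y) \<le> L" "1 \<le> L"
    and A: "A \<ge> 0" and c: "\<And>d. d \<in> {1..N} \<Longrightarrow> \<bar>c d\<bar> * D \<le> A" "\<And>d. d > Y \<Longrightarrow> c d = 0" 
    and w: "\<And>d. d \<in> {1..N} \<Longrightarrow> norm (\<Sum>k=1..N div d. of_real (w k) * expi (real (h * (d * k)) * \<theta>)) \<le> 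
         D * geo_bound (real N / real d) (real (h * d) * \<theta>)"
  shows "norm (\<Sum>d=1..N. of_real (c d) * (\<Sum>k=1..N div d. of_real (w k) * expi (real (h * (d * k)) * \<theta>)))
     \<le> A * (L * (4 * (real N * real H) / real q + 8 * (real H * real Y) + 8 * real q))"
proof -
  let ?g = "\<lambda>d. geo_bound (real N / real d) (real (h * d) * \<theta>)"
  have "norm (\<Sum>d=1..N. of_real (c d) * (\<Sum>k=1..N div d. of_real (w k) * expi (real (h * (d * k)) * \<theta>)))
     \<le> (\<Sum>d=1..N. if d \<le> Y then A * ?g d else 0)"
  proof (rule sum_norm_le)
    fix d assume d: "d \<in> {1..N}"
    show "norm (of_real (c d) * (\<Sum>k=1..N div d. of_real (w k) * expi (real (h * (d * k)) * \<theta>))) \<le> (if d \<le> Y then A * ?g d else 0)"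
    proof (cases "d \<le> Y")
      case True
      have "norm (of_real (c d) * (\<Sum>k=1..N div d. of_real (w k) * expi (real (h * (d * k)) * \<theta>))) \<le> \<bar>c d\<bar> * (D * ?g d)"
        unfolding norm_mult norm_of_real using w[OF d] by (intro mult_left_mono) auto
      also have "\<dots> = (\<bar>c d\<bar> * D) * ?g d" by simp
      also have "\<dots> \<le> A * ?g d" using c(1)[OF d] by (intro mult_right_mono geo_bound_nonneg) auto
      finally show ?thesis using True by simp
    qed (simp add: c)
  qed
  also have "\<dots> = (\<Sum>d\<in>{1..N} \<inter> {..Y}. A * ?g d)" by (subst sum.inter_restrict) auto
  also have "\<dots> \<le> (\<Sum>d=1..Y. A * ?g d)" using A by (intro sum_mono2) (auto intro!: mult_nonneg_nonneg geo_bound_nonneg)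
  also have "\<dots> = A * (\<Sum>d=1..Y. ?g d)" by (simp add: sum_distrib_left)
  also have "\<dots> \<le> A * (L * (4 * (real N * real H) / real q + 8 * (real H * real Y) + 8 * real q))"
    by (intro mult_left_mono A sum_geo_bound_type_I[OF ws h L])
  finally show ?thesis .
qed

subsection \<open>A trigonometric minorant\<close>

text \<open>The quadratic has the roots e^(iy) and e^(-iy) and belongs to the recurrence of sin (j
  y), so the product telescopes to boundary terms.\<close>

lemma sin_power_sum:
  fixes z :: complex and y :: real
  shows "(z\<^sup>2 - 2 * of_real (cos y) * z + 1) * (\<Sum>j\<le>n. of_real (sin (real j * y)) * z ^ j) =
    of_real (sin y) * z - of_real (sin (real (Suc n) * y)) * z ^ Suc n + of_real (sin (real n * y)) * z ^ (n + 2)"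
proof (induction n)
  case (Suc n)
  have rec: "sin (real (Suc (Suc n)) * y) = 2 * cos y * sin (real (Suc n) * y) - sin (real n * y)"
  proof -
    have "real (Suc (Suc n)) * y = real (Suc n) * y + y" "real n * y = real (Suc n) * y - y"
      by (simp_all add: algebra_simps)
    then show ?thesis by (simp only: sin_add sin_diff) (simp add: algebra_simps)
  qed
  show ?case
    unfolding sum.atMost_Suc distrib_left Suc.IH rec
    by (simp add: algebra_simps power2_eq_square)
qed simp

lemma sum_cos_multiples:
  assumes "J \<ge> 2"
  shows "(\<Sum>j=1..J. cos (2 * pi * real j / real J)) = 0"
proof -
  define z where "z = expi (1 / real J)"
  have zj: "z ^ j = cis (2 * pi * real j / real J)" for j
    unfolding z_def expi_of_nat_mult[symmetric] by (simp add: expi_def)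
  have "z ^ J = 1" using assms by (simp add: zj)
  have "z \<noteq> 1"
  proof
    assume "z = 1"
    then have "cos (2 * pi / real J) = 1" using zj[of 1] by (simp add: complex_eq_iff)
    moreover have "cos (2 * pi / real J) < cos 0"
      using assms by (intro cos_monotone_0_pi) (auto simp: field_simps)
    ultimately show False by simp
  qed
  have "(1 - z) * (\<Sum>j=1..J. z ^ j) = z - z ^ Suc J"
  proof (induction J)
    case (Suc J)
    have "(1 - z) * (\<Sum>j=1..Suc J. z ^ j) = (1 - z) * (\<Sum>j=1..J. z ^ j) + (1 - z) * z ^ Suc J"
      by (simp add: distrib_left)
    also have "\<dots> = z - z ^ Suc (Suc J)" unfolding Suc.IH by (simp add: algebra_simps)
    finally show ?case .
  qed simp
  then have "(\<Sum>j=1..J. z ^ j) = 0" using \<open>z ^ J = 1\<close> \<open>z \<noteq> 1\<close> by simp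
  then have "Re (\<Sum>j=1..J. z ^ j) = 0" by simp
  then show ?thesis by (simp add: zj)
qed

lemma sum_sin_squared:
  assumes "J \<ge> 2"
  shows "(\<Sum>j=1..J. (sin (real j * (pi / real J)))\<^sup>2) = real J / 2"
proof -
  have "(sin (real j * (pi / real J)))\<^sup>2 = 1 / 2 - cos (2 * pi * real j / real J) / 2" for j
  proof -
    have "cos (2 * pi * real j / real J) = 1 - 2 * (sin (real j * (pi / real J)))\<^sup>2"
      using cos_double_sin[of "real j * (pi / real J)"] by (simp add: mult_ac)
    then show ?thesis by (simp add: diff_divide_distrib)
  qed
  then have "(\<Sum>j=1..J. (sin (real j * (pi / real J)))\<^sup>2) = 
     real J / 2 - (\<Sum>j=1..J. cos (2 * pi * real j / real J)) / 2"
    by (simp add: sum_subtractf sum_divide_distrib)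
  then show ?thesis using sum_cos_multiples[OF assms] by simp
qed

lemma cos_two_pi_dist_int: "cos (2 * pi * x) = cos (2 * pi * dist_int x)"
proof -
  have "cos (2 * pi * x) = cos (2 * pi * (x - of_int (round x)) + 2 * pi * of_int (round x))"
    by (simp add: algebra_simps)
  also have "\<dots> = cos (2 * pi * (x - of_int (round x)))"
    by (simp only: cos_add cos_int_2pin sin_int_2pin mult_zero_right diff_zero mult_1_right)
  also have "\<dots> = cos (2 * pi * dist_int x)"
  proof -
    have "cos (2 * pi * w) = cos (2 * pi * \<bar>w\<bar>)" for w :: real by (cases "w \<ge> 0") auto
    then show ?thesis unfolding dist_int_def .
  qed
  finally show ?thesis .
qed

text \<open>
  The sine weights are extremal: among all weights on \<open>J\<close> consecutive frequencies they make
  \<open>|\<Sum> u\<^sub>j e(jx)|\<^sup>2\<close> concentrate best near \<open>0\<close>, so that the mean value of \<open>T\<close> stays positive although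
  \<open>T\<close> is nonpositive outside an interval of length \<open>2 / J\<close>.
\<close>

lemma fejer_type_minorant:
  fixes lam :: "nat \<Rightarrow> real"
  assumes J: "J \<ge> 2" and lam: "\<And>n. lam n \<ge> 0"
    and E: "(\<Sum>h=1..J. norm (\<Sum>n=1..N. of_real (lam n) * expi (real (h * n) * \<theta>))) \<le> E"
  shows "\<exists>c T. c > 0 \<and> (\<forall>x. dist_int x \<ge> 1 / real J \<longrightarrow> T x \<le> 0) \<and> (\<forall>x. T x \<le> 6 * real J * c) \<and>
    (\<Sum>n=1..N. lam n * T (real n * \<theta> + \<gamma>)) \<ge> c * ((\<Sum>n=1..N. lam n) - 8 * E)"
proof -
  \<comment> \<open>For this angle sin (j y) vanishes at j = 0 and j = J. T changes sign at distance
    1 / J, where cos (2 pi x) = cos (2 y), and c is the mean value of T over a period, the squares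
    of the u(j) adding up to J / 2.\<close>
  define y where "y = pi / real J"
  define u where "u j = sin (real j * y)" for j :: nat
  define kap where "kap = cos y - cos (2 * y)"
  define P where "P x = (\<Sum>j=1..J. of_real (u j) * expi (real j * x))" for x
  define T where "T x = (cos (2 * pi * x) - cos (2 * y)) * (norm (P x))\<^sup>2" for x
  define c where "c = kap * real J / 2"
  define s where "s h = norm (\<Sum>n=1..N. of_real (lam n) * expi (real (h * n) * \<theta>))" for h
  define \<Psi> where "\<Psi> = (\<Sum>n=1..N. lam n)"
  have y: "0 < y" "y \<le> pi / 2" using J by (auto simp: y_def field_simps)
  have u01: "\<bar>u j\<bar> \<le> 1" for j by (simp add: u_def)
  have uJ: "u J = 0" using J by (simp add: u_def y_def)
  have siny: "sin y > 0" using y pi_gt_zero by (intro sin_gt_zero) linarith+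
  have kap: "kap \<ge> 1 - cos y"
  proof -
    have "kap = (1 - cos y) * (1 + 2 * cos y)"
      unfolding kap_def cos_double_cos by (simp add: power2_eq_square algebra_simps)
    moreover have "(1 - cos y) * (1 + 2 * cos y) \<ge> (1 - cos y) * 1"
      using y cos_ge_zero[of y] by (intro mult_left_mono) auto
    ultimately show ?thesis by simp
  qed
  \<comment> \<open>The boundary part of T has the factor sin y, of order 1 / J, while kap is of
    order 1 / J^2. The claim amounts to sin y \<le> 4 c.\<close>
  have siny_le: "sin y \<le> 2 * kap * real J"
  proof -
    have s: "sin (y / 2) \<ge> y / 4" using sin_ge_half[of "y / 2"] y by simp
    have "1 \<le> 2 * (real J * (y / 4))" using J pi_gt3 by (simp add: y_def)
    also have "\<dots> \<le> 2 * (real J * sin (y / 2))" using s by (intro mult_left_mono) auto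
    finally have 1: "1 \<le> 2 * (real J * sin (y / 2))" .
    have s0: "sin (y / 2) \<ge> 0" using s y by linarith
    have "sin y = 2 * sin (y / 2) * cos (y / 2)" using sin_double[of "y / 2"] by simp
    also have "\<dots> \<le> 2 * sin (y / 2) * 1" using s0 by (intro mult_left_mono) auto
    also have "\<dots> \<le> 2 * sin (y / 2) * (2 * (real J * sin (y / 2)))"
      using s0 1 by (intro mult_left_mono) auto
    also have "\<dots> = 2 * (1 - cos y) * real J"
      using cos_double_sin[of "y / 2"] by (simp add: power2_eq_square)
    also have "\<dots> \<le> 2 * kap * real J" using kap by (intro mult_right_mono) auto
    finally show ?thesis .
  qed
  have "0 < 2 * kap * real J" using siny siny_le by linarith
  then have kap_pos: "kap > 0" using J by (simp add: zero_less_mult_iff)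
  \<comment> \<open>The weights u form an eigenvector: multiplication by cos (2 pi x) acts on P as
    the factor cos y, up to terms at the frequencies 0 and J.\<close>
  have identity: "(of_real (cos (2 * pi * x)) - of_real (cos y)) * P x = of_real (sin y / 2) * (1 + expi (real J * x))" for x
  proof -
    define z where "z = expi x"
    have z0: "z \<noteq> 0" using norm_expi[of x] unfolding z_def by (metis norm_zero zero_neq_one)
    have Pz: "P x = (\<Sum>j\<le>J. of_real (sin (real j * y)) * z ^ j)"
    proof -
      have "(\<Sum>j\<le>J. of_real (sin (real j * y)) * z ^ j) = (\<Sum>j\<in>{0} \<union> {1..J}. of_real (sin (real j * y)) * z ^ j)"
        by (intro sum.cong) auto
      also have "\<dots> = (\<Sum>j=1..J. of_real (sin (real j * y)) * z ^ j)"
        by (subst sum.union_disjoint) auto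
      finally show ?thesis by (simp add: P_def u_def z_def expi_of_nat_mult)
    qed
    have uJ1: "sin (real (Suc J) * y) = - sin y"
    proof -
      have "real (Suc J) * y = y + pi" using J by (simp add: y_def field_simps)
      then show ?thesis by (simp only: sin_periodic_pi)
    qed
    have "(z\<^sup>2 - 2 * of_real (cos y) * z + 1) * P x = of_real (sin y) * z * (1 + z ^ J)"
      unfolding Pz sin_power_sum uJ1 using uJ by (simp add: u_def algebra_simps)
    moreover have "z\<^sup>2 - 2 * of_real (cos y) * z + 1 = 2 * z * (of_real (cos (2 * pi * x)) - of_real (cos y))"
    proof -
      have "z * cnj z = 1" using complex_norm_square[of z] by (simp add: z_def)
      moreover have C: "2 * of_real (cos (2 * pi * x)) = z + cnj z"
        using complex_add_cnj[of z] by (simp add: z_def expi_def)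
      moreover have "2 * z * of_real (cos (2 * pi * x)) = z * (z + cnj z)" unfolding C[symmetric] by simp
      ultimately have "2 * z * of_real (cos (2 * pi * x)) = z\<^sup>2 + 1"
        by (simp add: power2_eq_square distrib_left)
      then show ?thesis by (simp add: right_diff_distrib mult_ac)
    qed
    ultimately have "2 * z * (of_real (cos (2 * pi * x)) - of_real (cos y)) * P x = of_real (sin y) * z * (1 + z ^ J)"
      by (simp only:)
    also have "\<dots> = 2 * z * (of_real (sin y / 2) * (1 + z ^ J))" by simp
    finally have "(2 * z) * ((of_real (cos (2 * pi * x)) - of_real (cos y)) * P x) = 
        (2 * z) * (of_real (sin y / 2) * (1 + z ^ J))" by (simp only: mult.assoc)
    then have "(of_real (cos (2 * pi * x)) - of_real (cos y)) * P x = of_real (sin y / 2) * (1 + z ^ J)"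
      unfolding mult_cancel_left using z0 by simp
    then show ?thesis by (simp only: z_def expi_of_nat_mult)
  qed
  have Re_expi: "Re (expi x) = cos (2 * pi * x)" for x by (simp add: expi_def)
  have normP: "(norm (P x))\<^sup>2 = (\<Sum>i=1..J. \<Sum>j=1..J. u i * u j * cos (2 * pi * ((real i - real j) * x)))" for x
  proof -
    have "of_real ((norm (P x))\<^sup>2) = P x * cnj (P x)" by (rule complex_norm_square)
    also have "\<dots> = (\<Sum>i=1..J. \<Sum>j=1..J. of_real (u i * u j) * expi ((real i - real j) * x))"
    proof -
      have "expi ((real i - real j) * x) = expi (real i * x) * cnj (expi (real j * x))" for i j
        by (simp add: left_diff_distrib expi_diff)
      then show ?thesis unfolding P_def by (simp add: sum_product mult_ac)
    qed
    finally have "Re (of_real ((norm (P x))\<^sup>2)) = Re \<dots>" by (rule arg_cong)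
    then show ?thesis by (simp add: Re_expi del: of_real_mult)
  qed
  \<comment> \<open>The first part carries the mean value. In the second, the frequency 0 would
    occur only for j = J, where u vanishes.\<close>
  have T_eq: "T x = kap * (norm (P x))\<^sup>2 + 
      sin y / 2 * (\<Sum>j=1..J. u j * (cos (2 * pi * (real j * x)) + cos (2 * pi * (real (J - j) * x))))" for x
  proof -
    have "of_real (T x) = of_real kap * (P x * cnj (P x)) + 
      (of_real (cos (2 * pi * x)) - of_real (cos y)) * P x * cnj (P x)"
      unfolding T_def kap_def of_real_mult complex_norm_square by (simp add: algebra_simps)
    also have "\<dots> = of_real (kap * (norm (P x))\<^sup>2) + 
       of_real (sin y / 2) * ((1 + expi (real J * x)) * cnj (P x))"
      unfolding identity by (simp add: complex_norm_square mult.assoc del: of_real_power)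
    also have "(1 + expi (real J * x)) * cnj (P x) = 
       (\<Sum>j=1..J. of_real (u j) * (cnj (expi (real j * x)) + expi (real (J - j) * x)))"
      unfolding P_def cnj_sum sum_distrib_left
    proof (rule sum.cong[OF refl])
      fix j assume "j \<in> {1..J}"
      then have "expi (real (J - j) * x) = expi (real J * x) * cnj (expi (real j * x))"
        by (simp add: of_nat_diff left_diff_distrib expi_diff)
      then show "(1 + expi (real J * x)) * cnj (of_real (u j) * expi (real j * x)) = 
          of_real (u j) * (cnj (expi (real j * x)) + expi (real (J - j) * x))"
        by (simp add: algebra_simps)
    qed
    finally have "Re (of_real (T x)) = Re (of_real (kap * (norm (P x))\<^sup>2) + of_real (sin y / 2) *
       (\<Sum>j=1..J. of_real (u j) * (cnj (expi (real j * x)) + expi (real (J - j) * x))))"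
      by (rule arg_cong)
    then show ?thesis by (simp add: Re_expi)
  qed
  have c0: "c > 0" using kap_pos J by (simp add: c_def)
  show ?thesis
  proof (intro exI[of _ c] exI[of _ T] conjI allI impI)
    show "c > 0" by (rule c0)
    show "T x \<le> 0" if "dist_int x \<ge> 1 / real J" for x
    proof -
      have "cos (2 * pi * x) \<le> cos (2 * y)"
        unfolding cos_two_pi_dist_int[of x]
      proof (rule cos_monotone_0_pi_le)
        show "2 * y \<le> 2 * pi * dist_int x"
          using that mult_left_mono[of "1 / real J" "dist_int x" "2 * pi"] by (simp add: y_def)
        show "2 * pi * dist_int x \<le> pi" using dist_int_le_half[of x] by simp
      qed (use y in simp)
      then show ?thesis unfolding T_def by (intro mult_nonpos_nonneg) auto
    qed
    \<comment> \<open>The bound |P| \<le> J gives kap J^2 = 2 J c, and the boundary part adds 4 J c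
      because sin y \<le> 4 c.\<close>
    show "T x \<le> 6 * real J * c" for x
    proof -
      have nP: "norm (P x) \<le> real J"
      proof -
        have "norm (P x) \<le> (\<Sum>j=1..J. norm (of_real (u j) * expi (real j * x)))"
          unfolding P_def by (rule norm_sum)
        also have "\<dots> \<le> (\<Sum>j=1..J. 1)" using u01 by (intro sum_mono) (simp add: norm_mult)
        finally show ?thesis by simp
      qed
      have "(norm (P x))\<^sup>2 \<le> (real J)\<^sup>2" using nP by (intro power_mono) auto
      then have 1: "kap * (norm (P x))\<^sup>2 \<le> 2 * real J * c"
        using kap_pos mult_left_mono[of "(norm (P x))\<^sup>2" "(real J)\<^sup>2" kap]
        by (simp add: c_def power2_eq_square algebra_simps)
      have "(\<Sum>j=1..J. u j * (cos (2 * pi * (real j * x)) + cos (2 * pi * (real (J - j) * x)))) \<le> (\<Sum>j=1..J. 2)"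
      proof (rule sum_mono)
        fix j
        have "\<bar>u j * (cos (2 * pi * (real j * x)) + cos (2 * pi * (real (J - j) * x)))\<bar> \<le> 1 * 2"
          unfolding abs_mult using abs_cos_le_one[of "2 * pi * (real j * x)"] abs_cos_le_one[of "2 * pi * (real (J - j) * x)"]
          by (intro mult_mono u01) linarith+
        then show "u j * (cos (2 * pi * (real j * x)) + cos (2 * pi * (real (J - j) * x))) \<le> 2" by linarith
      qed
      then have "(\<Sum>j=1..J. u j * (cos (2 * pi * (real j * x)) + cos (2 * pi * (real (J - j) * x)))) \<le> 2 * real J" by simp
      then have "sin y / 2 * (\<Sum>j=1..J. u j * (cos (2 * pi * (real j * x)) + cos (2 * pi * (real (J - j) * x)))) \<le> sin y / 2 * (2 * real J)"
        using siny by (intro mult_left_mono) auto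
      also have "\<dots> \<le> (2 * kap * real J) / 2 * (2 * real J)"
        using siny_le by (intro mult_right_mono divide_right_mono) auto
      also have "\<dots> = 4 * real J * c" by (simp add: c_def)
      finally show ?thesis using 1 unfolding T_eq[of x] by linarith
    qed
    define C where "C d = (\<Sum>n=1..N. lam n * cos (2 * pi * (d * (real n * \<theta> + \<gamma>))))" for d :: real
    have C_even: "C (- d) = C d" for d unfolding C_def by simp
    have C_le: "\<bar>C (real h)\<bar> \<le> s h" for h
    proof -
      have "C (real h) = Re (expi (real h * \<gamma>) * (\<Sum>n=1..N. of_real (lam n) * expi (real (h * n) * \<theta>)))"
        unfolding C_def sum_distrib_left Re_sum
      proof (rule sum.cong[OF refl])
        fix n
        have "expi (real h * \<gamma>) * (of_real (lam n) * expi (real (h * n) * \<theta>)) = 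
           of_real (lam n) * expi (real h * (real n * \<theta> + \<gamma>))"
          by (simp add: distrib_left expi_add mult_ac)
        then show "lam n * cos (2 * pi * (real h * (real n * \<theta> + \<gamma>))) = 
          Re (expi (real h * \<gamma>) * (of_real (lam n) * expi (real (h * n) * \<theta>)))"
          by (simp only: Re_expi[symmetric]) simp
      qed
      also have "\<bar>\<dots>\<bar> \<le> norm (expi (real h * \<gamma>) * (\<Sum>n=1..N. of_real (lam n) * expi (real (h * n) * \<theta>)))"
        by (rule abs_Re_le_cmod)
      finally show ?thesis by (simp add: s_def norm_mult)
    qed
    have C0: "C 0 = \<Psi>" by (simp add: C_def \<Psi>_def)
    have s0: "s h \<ge> 0" for h by (simp add: s_def)
    have Es: "(\<Sum>h=1..J. s h) \<le> E" using E by (simp add: s_def)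
    \<comment> \<open>The diagonal gives the main term; among the other differences i - j each
      absolute value occurs at most twice, hence 2 E.\<close>
    have row: "(\<Sum>j=1..J. u i * u j * C (real i - real j)) \<ge> (u i)\<^sup>2 * \<Psi> - 2 * E" if i: "i \<in> {1..J}" for i
    proof -
      have "(\<Sum>j=1..J. u i * u j * C (real i - real j)) = 
         (u i)\<^sup>2 * \<Psi> + (\<Sum>j\<in>{1..J} - {i}. u i * u j * C (real i - real j))"
        using i by (subst sum.remove[of _ i]) (auto simp: C0 power2_eq_square)
      moreover have "\<bar>\<Sum>j\<in>{1..J} - {i}. u i * u j * C (real i - real j)\<bar> \<le> 2 * E"
      proof -
        have bnd: "\<bar>u i * u j * C d\<bar> \<le> \<bar>C d\<bar>" for j d
          using mult_mono[OF u01[of i] u01[of j]] by (simp add: abs_mult mult_left_le_one_le)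
        have "\<bar>\<Sum>j\<in>{1..J} - {i}. u i * u j * C (real i - real j)\<bar> \<le> (\<Sum>j\<in>{1..J} - {i}. \<bar>C (real i - real j)\<bar>)"
          by (rule order_trans[OF sum_abs]) (intro sum_mono bnd)
        also have "\<dots> = (\<Sum>j\<in>{1..<i} \<union> {i<..J}. \<bar>C (real i - real j)\<bar>)"
          using i by (intro sum.cong) auto
        also have "\<dots> = (\<Sum>j\<in>{1..<i}. \<bar>C (real i - real j)\<bar>) + (\<Sum>j\<in>{i<..J}. \<bar>C (real i - real j)\<bar>)"
          by (intro sum.union_disjoint) auto
        also have "(\<Sum>j\<in>{1..<i}. \<bar>C (real i - real j)\<bar>) \<le> (\<Sum>j\<in>{1..<i}. s (i - j))"
          using C_le by (intro sum_mono) (metis atLeastLessThan_iff less_imp_le of_nat_diff)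
        also have "(\<Sum>j\<in>{1..<i}. s (i - j)) = (\<Sum>h\<in>{1..<i}. s h)"
          by (rule sum.reindex_bij_witness[of _ "\<lambda>h. i - h" "\<lambda>j. i - j"]) auto
        also have "\<dots> \<le> (\<Sum>h=1..J. s h)" using i s0 by (intro sum_mono2) auto
        also have "(\<Sum>j\<in>{i<..J}. \<bar>C (real i - real j)\<bar>) \<le> (\<Sum>j\<in>{i<..J}. s (j - i))"
        proof (rule sum_mono)
          fix j assume "j \<in> {i<..J}"
          then have "real i - real j = - real (j - i)" by (simp add: of_nat_diff)
          then show "\<bar>C (real i - real j)\<bar> \<le> s (j - i)" using C_le[of "j - i"] by (simp only: C_even)
        qed
        also have "(\<Sum>j\<in>{i<..J}. s (j - i)) = (\<Sum>h\<in>{1..J - i}. s h)"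
          by (rule sum.reindex_bij_witness[of _ "\<lambda>h. h + i" "\<lambda>j. j - i"]) auto
        also have "\<dots> \<le> (\<Sum>h=1..J. s h)" using i s0 by (intro sum_mono2) auto
        finally show ?thesis using Es by simp
      qed
      ultimately show ?thesis by linarith
    qed
    have part1: "(\<Sum>n=1..N. lam n * (norm (P (real n * \<theta> + \<gamma>)))\<^sup>2) \<ge> real J / 2 * \<Psi> - 2 * real J * E"
    proof -
      have "(\<Sum>n=1..N. lam n * (norm (P (real n * \<theta> + \<gamma>)))\<^sup>2) = 
        (\<Sum>n=1..N. \<Sum>i=1..J. \<Sum>j=1..J. u i * u j * (lam n * cos (2 * pi * ((real i - real j) * (real n * \<theta> + \<gamma>)))))"
        unfolding normP by (simp add: sum_distrib_left mult_ac)
      also have "\<dots> = (\<Sum>i=1..J. \<Sum>n=1..N. \<Sum>j=1..J. u i * u j * (lam n * cos (2 * pi * ((real i - real j) * (real n * \<theta> + \<gamma>)))))"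
        by (rule sum.swap)
      also have "\<dots> = (\<Sum>i=1..J. \<Sum>j=1..J. \<Sum>n=1..N. u i * u j * (lam n * cos (2 * pi * ((real i - real j) * (real n * \<theta> + \<gamma>)))))"
        by (intro sum.cong refl sum.swap)
      also have "\<dots> = (\<Sum>i=1..J. \<Sum>j=1..J. u i * u j * C (real i - real j))"
        by (simp add: C_def sum_distrib_left)
      also have "\<dots> \<ge> (\<Sum>i=1..J. (u i)\<^sup>2 * \<Psi> - 2 * E)" by (intro sum_mono row)
      also have "(\<Sum>i=1..J. (u i)\<^sup>2 * \<Psi> - 2 * E) = (\<Sum>i=1..J. (u i)\<^sup>2) * \<Psi> - 2 * real J * E"
        by (simp add: sum_subtractf sum_distrib_right)
      also have "(\<Sum>i=1..J. (u i)\<^sup>2) = real J / 2"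
        unfolding u_def y_def by (rule sum_sin_squared[OF J])
      finally show ?thesis .
    qed
    have part2: "\<bar>\<Sum>n=1..N. lam n * (\<Sum>j=1..J. u j * (cos (2 * pi * (real j * (real n * \<theta> + \<gamma>))) + 
        cos (2 * pi * (real (J - j) * (real n * \<theta> + \<gamma>)))))\<bar> \<le> 2 * E"
    proof -
      have "(\<Sum>n=1..N. lam n * (\<Sum>j=1..J. u j * (cos (2 * pi * (real j * (real n * \<theta> + \<gamma>))) + 
        cos (2 * pi * (real (J - j) * (real n * \<theta> + \<gamma>)))))) = 
        (\<Sum>n=1..N. \<Sum>j=1..J. u j * (lam n * cos (2 * pi * (real j * (real n * \<theta> + \<gamma>))) + 
        lam n * cos (2 * pi * (real (J - j) * (real n * \<theta> + \<gamma>)))))"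
        by (simp add: sum_distrib_left algebra_simps)
      also have "\<dots> = (\<Sum>j=1..J. \<Sum>n=1..N. u j * (lam n * cos (2 * pi * (real j * (real n * \<theta> + \<gamma>))) + 
        lam n * cos (2 * pi * (real (J - j) * (real n * \<theta> + \<gamma>)))))" by (rule sum.swap)
      also have "\<dots> = (\<Sum>j=1..J. u j * (C (real j) + C (real (J - j))))"
        by (simp only: C_def flip: sum.distrib sum_distrib_left)
      \<comment> \<open>The term j = J must go before absolute values are taken: it contains C(0),
        the full sum of \<open>lam\<close>, and is saved by u(J) = 0.\<close>
      also have "\<dots> = (\<Sum>j\<in>{1..<J}. u j * (C (real j) + C (real (J - j))))"
      proof -
        have "{1..J} = insert J {1..<J}" using J by auto
        then show ?thesis using uJ by simp
      qed
      also have "\<bar>\<dots>\<bar> \<le> (\<Sum>j\<in>{1..<J}. \<bar>u j * (C (real j) + C (real (J - j)))\<bar>)" by (rule sum_abs)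
      also have "\<dots> \<le> (\<Sum>j\<in>{1..<J}. s j + s (J - j))"
      proof (rule sum_mono)
        fix j
        have "\<bar>u j * (C (real j) + C (real (J - j)))\<bar> \<le> 1 * \<bar>C (real j) + C (real (J - j))\<bar>"
          unfolding abs_mult by (intro mult_right_mono u01) auto
        also have "\<dots> \<le> \<bar>C (real j)\<bar> + \<bar>C (real (J - j))\<bar>" using abs_triangle_ineq by simp
        also have "\<dots> \<le> s j + s (J - j)" by (intro add_mono C_le)
        finally show "\<bar>u j * (C (real j) + C (real (J - j)))\<bar> \<le> s j + s (J - j)" .
      qed
      also have "\<dots> = (\<Sum>j\<in>{1..<J}. s j) + (\<Sum>j\<in>{1..<J}. s (J - j))" by (rule sum.distrib)
      also have "(\<Sum>j\<in>{1..<J}. s (J - j)) = (\<Sum>j\<in>{1..<J}. s j)"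
        by (rule sum.reindex_bij_witness[of _ "\<lambda>h. J - h" "\<lambda>j. J - j"]) auto
      also have "(\<Sum>j\<in>{1..<J}. s j) \<le> (\<Sum>h=1..J. s h)" using s0 by (intro sum_mono2) auto
      finally show ?thesis using Es by linarith
    qed
    have "(\<Sum>n=1..N. lam n * T (real n * \<theta> + \<gamma>)) = 
       kap * (\<Sum>n=1..N. lam n * (norm (P (real n * \<theta> + \<gamma>)))\<^sup>2) + 
       sin y / 2 * (\<Sum>n=1..N. lam n * (\<Sum>j=1..J. u j * (cos (2 * pi * (real j * (real n * \<theta> + \<gamma>))) + 
        cos (2 * pi * (real (J - j) * (real n * \<theta> + \<gamma>))))))"
      unfolding T_eq by (simp add: distrib_left sum.distrib sum_distrib_left mult_ac)
    moreover have "kap * (\<Sum>n=1..N. lam n * (norm (P (real n * \<theta> + \<gamma>)))\<^sup>2) \<ge> kap * (real J / 2 * \<Psi> - 2 * real J * E)"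
      using part1 kap_pos by (intro mult_left_mono) auto
    moreover have "sin y / 2 * (\<Sum>n=1..N. lam n * (\<Sum>j=1..J. u j * (cos (2 * pi * (real j * (real n * \<theta> + \<gamma>))) + 
        cos (2 * pi * (real (J - j) * (real n * \<theta> + \<gamma>)))))) \<ge> sin y / 2 * (- 2 * E)"
      using part2 siny by (intro mult_left_mono) auto
    \<comment> \<open>Origin of the 8: kap times 2 J E equals 4 c E, and sin y times E is at most
      another 4 c E.\<close>
    moreover have "sin y / 2 * (- 2 * E) \<ge> - 4 * c * E"
    proof -
      have "E \<ge> 0" using Es s0 by (meson order_trans sum_nonneg)
      then have "sin y * E \<le> (2 * kap * real J) * E" using siny_le by (intro mult_right_mono) auto
      then show ?thesis by (simp add: c_def)
    qed
    ultimately show "(\<Sum>n=1..N. lam n * T (real n * \<theta> + \<gamma>)) \<ge> c * ((\<Sum>n=1..N. lam n) - 8 * E)"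
      by (simp add: c_def \<Psi>_def algebra_simps)
  qed
qed

text \<open>X collects the n that must not be detected; each of them may reach the upper bound of T,
  hence the weight 6 J on their sum.\<close>

lemma detect_small_dist_int:
  fixes lam :: "nat \<Rightarrow> real"
  assumes J: "J \<ge> 2" and lam: "\<And>n. lam n \<ge> 0" and X: "X \<subseteq> {1..N}"
    and E: "(\<Sum>h=1..J. norm (\<Sum>n=1..N. of_real (lam n) * expi (real (h * n) * \<theta>))) \<le> E"
    and gt: "(\<Sum>n=1..N. lam n) > 8 * E + 6 * real J * (\<Sum>n\<in>X. lam n)"
  obtains n where "n \<in> {1..N}" "n \<notin> X" "lam n > 0" "dist_int (real n * \<theta> + \<gamma>) < 1 / real J"
proof -
  obtain c T where T: "c > 0" "\<And>x. dist_int x \<ge> 1 / real J \<Longrightarrow> T x \<le> 0" "\<And>x. T x \<le> 6 * real J * c"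
    "(\<Sum>n=1..N. lam n * T (real n * \<theta> + \<gamma>)) \<ge> c * ((\<Sum>n=1..N. lam n) - 8 * E)"
    using fejer_type_minorant[OF J lam E, of \<gamma>] by blast
  have "\<exists>n\<in>{1..N}. n \<notin> X \<and> lam n > 0 \<and> dist_int (real n * \<theta> + \<gamma>) < 1 / real J"
  proof (rule ccontr)
    assume contra: "\<not> ?thesis"
    have none: "T (real n * \<theta> + \<gamma>) \<le> 0" if "n \<in> {1..N}" "n \<notin> X" "lam n > 0" for n
    proof -
      have "\<not> dist_int (real n * \<theta> + \<gamma>) < 1 / real J" using contra that by blast
      then show ?thesis by (intro T(2)) simp
    qed
    have "(\<Sum>n=1..N. lam n * T (real n * \<theta> + \<gamma>)) \<le> (\<Sum>n=1..N. if n \<in> X then lam n * (6 * real J * c) else 0)"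
    proof (rule sum_mono)
      fix n assume n: "n \<in> {1..N}"
      show "lam n * T (real n * \<theta> + \<gamma>) \<le> (if n \<in> X then lam n * (6 * real J * c) else 0)"
      proof (cases "n \<in> X")
        case True
        then show ?thesis using lam T(3) by (auto intro: mult_left_mono)
      next
        case False
        then show ?thesis using none[of n] n lam[of n] by (cases "lam n = 0") (auto intro: mult_nonneg_nonpos)
      qed
    qed
    also have "\<dots> = (\<Sum>n\<in>X. lam n * (6 * real J * c))"
      using X by (subst sum.inter_restrict[symmetric]) (auto simp: Int_absorb1)
    also have "\<dots> = (\<Sum>n\<in>X. lam n) * (6 * real J * c)" by (rule sum_distrib_right[symmetric])
    also have "\<dots> = c * (6 * real J * (\<Sum>n\<in>X. lam n))" by simp
    also have "\<dots> < c * ((\<Sum>n=1..N. lam n) - 8 * E)" using gt T(1) by (intro mult_strict_left_mono) auto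
    finally show False using T(4) by simp
  qed
  then show ?thesis using that by blast
qed

subsection \<open>Primes in Beatty sequences\<close>

text \<open>The middle term of Vaughan's identity is cut at r = U into a sum of type I and one of
  type II. By U V V \<le> N its support r \<le> U V stays below N div V, so both sums of type II
  share this upper end. In 3 L, partial summation accounts for 2 L and the size of
  \<open>vaughan_coeff\<close> for L.\<close>

lemma exponential_sum_mangoldt_le:
  assumes ws: "well_spaced \<theta> q" and N: "N \<ge> 1" and H: "H \<ge> 1" and UV: "1 \<le> V" "V \<le> U" "U * V * V \<le> N"
    and L: "1 + ln (real (H * N)) \<le> L" "harm (2 * q) \<le> L"
  shows "(\<Sum>h=1..H. norm (\<Sum>n=1..N. of_real (mangoldt n) * expi (real (h * n) * \<theta>))) \<le>
     real H * (real U * L + 3 * L * (L * (4 * (real N * real H) / real q + 8 * (real H * real U) + 8 * real q)))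
     + 2 * (2 * L * sqrt (8 * L ^ 12 * (real H * real N) *
         (real H * real N / real q + real H * real N / real U + real (N div V) + real q)))"
    (is "_ \<le> real H * (real U * L + 3 * L * ?I) + 2 * ?II")
proof -
  have U: "U \<ge> 1" using UV by simp
  have lnN: "ln (real n) \<le> L" if "1 \<le> n" "n \<le> H * N" for n
  proof -
    have "ln (real n) \<le> ln (real (H * N))" using that N H by (subst ln_le_cancel_iff) (auto simp del: of_nat_mult)
    then show ?thesis using L by linarith
  qed
  have NHN: "N \<le> H * N" using H by simp
  have lnN': "ln (real n) \<le> L" if "1 \<le> n" "n \<le> N" for n
    using lnN[OF that(1) le_trans[OF that(2) NHN]] .
  have L1: "1 \<le> L"
  proof -
    have "1 \<le> H * N" using N NHN by simp
    then have "1 \<le> real (H * N)" by (metis of_nat_1 of_nat_mono)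
    then show ?thesis using L(1) ln_ge_zero[of "real (H * N)"] by linarith
  qed
  have UVN: "U * V \<le> N div V" using UV by (simp add: less_eq_div_iff_mult_less_eq)
  have UVN': "U * V \<le> N" using UVN div_le_dividend[of N V] by linarith
  have "U * 1 \<le> U * V" using UV(1) by (rule mult_le_mono2)
  then have UN: "U \<le> N" using UVN' by linarith
  have harmHU: "harm (H * U) \<le> L"
  proof -
    have "harm (H * U) \<le> 1 + ln (real (H * U))" using H U by (intro harm_le_ln) simp
    also have "ln (real (H * U)) \<le> ln (real (H * N))" 
      using H U UN by (subst ln_le_cancel_iff) (auto simp del: of_nat_mult)
    finally show ?thesis using L by linarith
  qed
  define f where "f h n = expi (real (h * n) * \<theta>)" for h n
  define c1 where "c1 d = (if d \<le> V then moebius_mu d else 0)" for d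
  define c2 where "c2 r = (if r \<le> U then vaughan_coeff U V r else 0)" for r
  define a1 where "a1 r = (if U < r then vaughan_coeff U V r else 0)" for r
  \<comment> \<open>The cofactors k exceed V here, so for m > N div V the inner sum is zero.\<close>
  define a2 where "a2 m = (if U < m \<and> m \<le> N div V then mangoldt m else 0 :: real)" for m
  \<comment> \<open>The bound by \<open>num_divisors\<close> forces the value 0 at k = 0: the
    divisors of 0 form an infinite set, whose cardinality is 0. The sums start at k = 1.\<close>
  define b1 where "b1 k = (if k = 0 then 0 else 1 :: real)" for k :: nat
  define b2 where "b2 k = (if V < k then moebius_trunc V k else 0)" for k
  define S0 where "S0 h = (\<Sum>n=1..N. of_real (if n \<le> U then mangoldt n else 0) * f h n)" for h
  define S1 where "S1 h = (\<Sum>d=1..N. of_real (c1 d) * (\<Sum>k=1..N div d. of_real (ln (real k)) * f h (d * k)))" for h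
  define S2 where "S2 h = (\<Sum>d=1..N. of_real (c2 d) * (\<Sum>k=1..N div d. of_real 1 * f h (d * k)))" for h
  define S3 where "S3 h = (\<Sum>m=1..N. of_real (a1 m) * (\<Sum>k=1..N div m. of_real (b1 k) * f h (m * k)))" for h
  define S4 where "S4 h = (\<Sum>m=1..N. of_real (a2 m) * (\<Sum>k=1..N div m. of_real (b2 k) * f h (m * k)))" for h
  have split: "(\<Sum>n=1..N. of_real (mangoldt n) * f h n) = S0 h + S1 h - (S2 h + S3 h) - S4 h" for h
  proof -
    have "(\<Sum>n=1..N. of_real (mangoldt n) * f h n) = (\<Sum>n=1..N. of_real (if n \<le> U then mangoldt n else 0) * f h n +
       of_real (if U < n then mangoldt n else 0) * f h n)"
      by (intro sum.cong refl) (auto simp: not_less)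
    also have "\<dots> = S0 h + (\<Sum>n=1..N. of_real (if U < n then mangoldt n else 0) * f h n)"
      by (simp only: sum.distrib S0_def)
    also have "(\<Sum>n=1..N. of_real (if U < n then mangoldt n else 0) * f h n) = S1 h
      - (\<Sum>r=1..N. of_real (vaughan_coeff U V r) * (\<Sum>k=1..N div r. f h (r * k)))
      - (\<Sum>m=1..N. of_real (if U < m then mangoldt m else 0) * (\<Sum>k=1..N div m. of_real (b2 k) * f h (m * k)))"
      unfolding S1_def c1_def b2_def by (rule vaughan_identity[OF UV(1)])
    also have "(\<Sum>r=1..N. of_real (vaughan_coeff U V r) * (\<Sum>k=1..N div r. f h (r * k))) = 
        (\<Sum>r=1..N. of_real (c2 r) * (\<Sum>k=1..N div r. of_real 1 * f h (r * k)) + 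
           of_real (a1 r) * (\<Sum>k=1..N div r. of_real (b1 k) * f h (r * k)))"
    proof (rule sum.cong[OF refl])
      fix r
      have "(\<Sum>k=1..N div r. of_real (b1 k) * f h (r * k)) = (\<Sum>k=1..N div r. f h (r * k))"
        by (intro sum.cong) (auto simp: b1_def)
      then show "of_real (vaughan_coeff U V r) * (\<Sum>k=1..N div r. f h (r * k)) =
         of_real (c2 r) * (\<Sum>k=1..N div r. of_real 1 * f h (r * k)) + 
           of_real (a1 r) * (\<Sum>k=1..N div r. of_real (b1 k) * f h (r * k))"
        by (simp add: c2_def a1_def)
    qed
    also have "\<dots> = S2 h + S3 h" by (simp only: sum.distrib S2_def S3_def)
    also have "(\<Sum>m=1..N. of_real (if U < m then mangoldt m else 0) * (\<Sum>k=1..N div m. of_real (b2 k) * f h (m * k))) = S4 h"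
      unfolding S4_def
    proof (rule sum.cong[OF refl])
      fix m assume m: "m \<in> {1..N}"
      show "of_real (if U < m then mangoldt m else 0) * (\<Sum>k=1..N div m. of_real (b2 k) * f h (m * k)) =
        of_real (a2 m) * (\<Sum>k=1..N div m. of_real (b2 k) * f h (m * k))"
      proof (cases "m \<le> N div V")
        case True
        then show ?thesis by (simp add: a2_def)
      next
        case False
        then have "N div V < m" by simp
        then have "N < m * V" using UV(1) by (subst (asm) div_less_iff_less_mult) auto
        then have "N div m < V" using m by (simp add: div_less_iff_less_mult mult.commute)
        then have "(\<Sum>k=1..N div m. of_real (b2 k) * f h (m * k)) = 0"
          by (intro sum.neutral) (auto simp: b2_def)
        then show ?thesis by simp
      qed
    qed
    finally show ?thesis by simp
  qed
  have n0: "norm (S0 h) \<le> real U * L" for h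
  proof -
    have "norm (S0 h) \<le> (\<Sum>n=1..N. if n \<le> U then L else 0)"
      unfolding S0_def
    proof (rule sum_norm_le)
      fix n assume n: "n \<in> {1..N}"
      have "mangoldt n \<le> L" using mangoldt_le[of n] lnN'[of n] n by simp
      then show "norm (of_real (if n \<le> U then mangoldt n else 0) * f h n) \<le> (if n \<le> U then L else 0)"
        by (simp add: f_def norm_mult mangoldt_nonneg)
    qed
    also have "\<dots> = (\<Sum>n\<in>{1..N} \<inter> {..U}. L)" by (subst sum.inter_restrict) auto
    also have "\<dots> \<le> (\<Sum>n=1..U. L)" using L1 by (intro sum_mono2) auto
    finally show ?thesis by simp
  qed
  have n1: "norm (S1 h) \<le> 2 * L * ?I" if h: "h \<in> {1..H}" for h
    unfolding S1_def f_def
  proof (rule type_I_sum[OF ws h L(2) harmHU L1, where D = "2 * L"])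
    fix d assume d: "d \<in> {1..N}"
    show "\<bar>c1 d\<bar> * (2 * L) \<le> 2 * L" using L1 abs_moebius_le[of d] by (simp add: c1_def)
    have dN: "N div d \<ge> 1" using d by (simp add: Suc_le_eq div_greater_zero_iff)
    have "norm (\<Sum>k=1..N div d. of_real (ln (real k)) * expi (real (h * (d * k)) * \<theta>)) \<le>
        2 * ln (real (N div d)) * geo_bound (real N / real d) (real (h * d) * \<theta>)"
      using d by (intro norm_sum_ln_le norm_expi_sum_le_geo_bound) auto
    also have "\<dots> \<le> 2 * L * geo_bound (real N / real d) (real (h * d) * \<theta>)"
    proof (intro mult_right_mono geo_bound_nonneg)
      show "2 * ln (real (N div d)) \<le> 2 * L" using lnN'[OF dN] by simp
    qed auto
    finally show "norm (\<Sum>k=1..N div d. of_real (ln (real k)) * expi (real (h * (d * k)) * \<theta>)) \<le>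
        2 * L * geo_bound (real N / real d) (real (h * d) * \<theta>)" .
  qed (use L1 UV in \<open>auto simp: c1_def\<close>)
  have n2: "norm (S2 h) \<le> L * ?I" if h: "h \<in> {1..H}" for h
    unfolding S2_def f_def
  proof (rule type_I_sum[OF ws h L(2) harmHU L1, where D = 1])
    fix d assume d: "d \<in> {1..N}"
    show "\<bar>c2 d\<bar> * 1 \<le> L"
      using abs_vaughan_coeff_le[of d U V] lnN'[of d] d L1 by (simp add: c2_def)
    show "norm (\<Sum>k=1..N div d. of_real 1 * expi (real (h * (d * k)) * \<theta>)) \<le>
        1 * geo_bound (real N / real d) (real (h * d) * \<theta>)"
      using norm_expi_sum_le_geo_bound[of d "N div d" N h \<theta>] d by (simp del: of_nat_mult)
  qed (use L1 in \<open>auto simp: c2_def\<close>)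
  have n3: "(\<Sum>h=1..H. norm (S3 h)) \<le> ?II"
    unfolding S3_def f_def
  proof (rule type_II_sum[OF ws U N H _ _ _ _ L])
    show "\<bar>a1 m\<bar> \<le> L" for m
    proof (cases "U < m \<and> m \<le> U * V")
      case True
      then show ?thesis using abs_vaughan_coeff_le[of m U V] lnN'[of m] UVN' by (simp add: a1_def)
    next
      case False
      then show ?thesis using vaughan_coeff_eq_0[of U V m] L1 by (auto simp: a1_def)
    qed
    show "a1 m = 0" if "m > N div V" for m
      using that UVN vaughan_coeff_eq_0[of U V m] by (simp add: a1_def)
    show "\<bar>b1 k\<bar> \<le> real (num_divisors k)" for k
    proof (cases "k = 0")
      case False
      then have "card {d. d dvd k} > 0" by (subst card_gt_0_iff) auto
      then show ?thesis by (simp add: b1_def num_divisors_def)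
    qed (simp add: b1_def)
  qed (simp add: a1_def)
  have n4: "(\<Sum>h=1..H. norm (S4 h)) \<le> ?II"
    unfolding S4_def f_def
  proof (rule type_II_sum[OF ws U N H _ _ _ _ L])
    show "\<bar>a2 m\<bar> \<le> L" for m
    proof (cases "U < m \<and> m \<le> N div V")
      case True
      then have "m \<le> N" using div_le_dividend[of N V] by linarith
      then show ?thesis using True mangoldt_le[of m] lnN'[of m] by (simp add: a2_def)
    qed (use L1 in \<open>auto simp: a2_def\<close>)
    show "\<bar>b2 k\<bar> \<le> real (num_divisors k)" for k
      using abs_moebius_trunc_le[of V k] by (simp add: b2_def)
  qed (simp_all add: a2_def)
  have "(\<Sum>h=1..H. norm (\<Sum>n=1..N. of_real (mangoldt n) * f h n)) \<le> 
     (\<Sum>h=1..H. (real U * L + 3 * L * ?I) + (norm (S3 h) + norm (S4 h)))"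
  proof (rule sum_mono)
    fix h assume h: "h \<in> {1..H}"
    have "norm (S0 h + S1 h - (S2 h + S3 h) - S4 h) \<le> norm (S0 h) + norm (S1 h) + (norm (S2 h) + norm (S3 h)) + norm (S4 h)"
      by (intro order_trans[OF norm_triangle_ineq4] add_mono norm_triangle_ineq order_refl)
    also have "\<dots> \<le> (real U * L + 3 * L * ?I) + (norm (S3 h) + norm (S4 h))"
    proof -
      have "a + b + (c + d) + e \<le> (u + 3 * L * x) + (d + e)"
        if "a \<le> u" "b \<le> 2 * L * x" "c \<le> L * x" for a b c d e u x :: real
        using that by (simp add: algebra_simps)
      from this[OF n0 n1[OF h] n2[OF h]] show ?thesis .
    qed
    finally show "norm (\<Sum>n=1..N. of_real (mangoldt n) * f h n) \<le> (real U * L + 3 * L * ?I) + (norm (S3 h) + norm (S4 h))"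
      unfolding split .
  qed
  also have "\<dots> = real H * (real U * L + 3 * L * ?I) + ((\<Sum>h=1..H. norm (S3 h)) + (\<Sum>h=1..H. norm (S4 h)))"
    by (simp only: sum.distrib sum_constant card_atLeastAtMost) (simp add: distrib_left)
  also have "\<dots> \<le> real H * (real U * L + 3 * L * ?I) + 2 * ?II" using n3 n4 by linarith
  finally show ?thesis by (simp only: f_def)
qed

text \<open>U is about \<Theta> H^2 and V about \<Theta> H, so that each of the terms H^2 N / q, H^2
  N / U, H (N div V) and H q from type II is at most N / \<Theta>. The exponent 14 is 12 from type
  II plus 2 from the factor L in front of the root. N1 ensures U V V \<le> N.\<close>

lemma exponential_sum_mangoldt_small:
  fixes \<Theta> L :: real
  assumes ws: "well_spaced \<theta> q" and N: "N \<ge> 1" and H: "H \<ge> 1"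
    and L: "1 + ln (real (H * N)) \<le> L" "harm (2 * q) \<le> L"
    and \<Theta>: "\<Theta> = 10 ^ 8 * L ^ 14"
    and q: "\<Theta> * (real H)\<^sup>2 \<le> real q" and N1: "8 * \<Theta> ^ 3 * (real H) ^ 4 \<le> real N" and N2: "\<Theta> * real H * real q \<le> real N"
  shows "(\<Sum>h=1..H. norm (\<Sum>n=1..N. of_real (mangoldt n) * expi (real (h * n) * \<theta>))) \<le> real N / 400"
proof -
  define n h where "n = real N" and "h = real H"
  have h1: "h \<ge> 1" and n0: "n > 0" using H N by (auto simp: h_def n_def)
  have q0: "real q > 0" using ws by (simp add: well_spaced_def)
  have L1: "1 \<le> L"
  proof -
    have "1 \<le> real (H * N)" using H N by (metis mult_le_mono nat_mult_1 of_nat_1 of_nat_mono)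
    then show ?thesis using L(1) ln_ge_zero[of "real (H * N)"] by linarith
  qed
  have L14: "L ^ 14 \<ge> L ^ k" if "k \<le> 14" for k using that L1 by (rule power_increasing)
  have \<Theta>L: "10 ^ 8 * L ^ k \<le> \<Theta>" if "k \<le> 14" for k using L14[OF that] by (simp add: \<Theta>)
  have \<Theta>1: "10 ^ 8 \<le> \<Theta>" using \<Theta>L[of 0] by simp
  define U where "U = nat \<lceil>\<Theta> * h\<^sup>2\<rceil>"
  define V where "V = nat \<lceil>\<Theta> * h\<rceil>"
  have hh: "h \<le> h\<^sup>2" "1 \<le> h\<^sup>2" using h1 by (auto simp: power2_eq_square mult_ge1_I)
  have \<Theta>h: "1 \<le> \<Theta> * h" using \<Theta>1 h1 mult_mono[of 1 \<Theta> 1 h] by simp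
  have \<Theta>h2: "\<Theta> * h \<le> \<Theta> * h\<^sup>2" using \<Theta>1 hh by (intro mult_left_mono) auto
  have U: "\<Theta> * h\<^sup>2 \<le> real U" "real U \<le> 2 * (\<Theta> * h\<^sup>2)" using \<Theta>h \<Theta>h2 unfolding U_def by linarith+
  have V: "\<Theta> * h \<le> real V" "real V \<le> 2 * (\<Theta> * h)" using \<Theta>h unfolding V_def by linarith+
  have V1: "1 \<le> V" using V \<Theta>h by linarith
  have VU: "V \<le> U" unfolding U_def V_def using \<Theta>h2 by (intro nat_mono ceiling_mono)
  have "real U * real V * real V \<le> (2 * (\<Theta> * h\<^sup>2)) * (2 * (\<Theta> * h)) * (2 * (\<Theta> * h))"
    using U V \<Theta>1 h1 by (intro mult_mono) auto
  also have "\<dots> = 8 * \<Theta> ^ 3 * h ^ 4" by (simp add: eval_nat_numeral)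
  also have "\<dots> \<le> real N" using N1 by (simp add: h_def)
  finally have UVN: "U * V * V \<le> N" by (metis of_nat_le_iff of_nat_mult)
  have n\<Theta>: "8 * \<Theta>\<^sup>2 * h ^ 4 \<le> n / \<Theta>" using N1 \<Theta>1 by (simp add: n_def h_def field_simps eval_nat_numeral)
  have qn: "h * real q \<le> n / \<Theta>" using N2 \<Theta>1 by (simp add: n_def h_def field_simps)
  have t1: "h\<^sup>2 * n / real q \<le> n / \<Theta>"
  proof -
    have "\<Theta> * h\<^sup>2 * n \<le> real q * n" using q n0 by (intro mult_right_mono) (auto simp: h_def)
    then show ?thesis using q0 \<Theta>1 by (simp add: field_simps)
  qed
  have t2: "h\<^sup>2 * n / real U \<le> n / \<Theta>"
  proof -
    have "\<Theta> * h\<^sup>2 * n \<le> real U * n" using U n0 by (intro mult_right_mono) auto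
    moreover have "real U > 0" using V1 VU by simp
    ultimately show ?thesis using \<Theta>1 by (simp add: field_simps)
  qed
  have t3: "h * real (N div V) \<le> n / \<Theta>"
  proof -
    have "real (N div V) \<le> n / real V" unfolding n_def by (rule of_nat_div_le_of_nat)
    then have "h * real (N div V) \<le> h * (n / real V)" using h1 by (intro mult_left_mono) auto
    also have "\<dots> \<le> n / \<Theta>"
    proof -
      have "\<Theta> * h * n \<le> real V * n" using V n0 by (intro mult_right_mono) auto
      then show ?thesis using V1 \<Theta>1 by (simp add: field_simps)
    qed
    finally show ?thesis .
  qed
  have h34: "h ^ 3 \<le> h ^ 4" using h1 by (intro power_increasing) auto
  have hU: "h * real U \<le> n / (4 * \<Theta> * 10 ^ 8)"
  proof -
    have "h * real U \<le> h * (2 * (\<Theta> * h\<^sup>2))" using U h1 by (intro mult_left_mono) auto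
    also have "\<dots> = 2 * \<Theta> * h ^ 3" by (simp add: eval_nat_numeral)
    also have "\<dots> \<le> 2 * \<Theta> * h ^ 4" using h34 \<Theta>1 by (intro mult_left_mono) auto
    finally have "h * real U \<le> 2 * \<Theta> * h ^ 4" .
    then have "h * real U * 10 ^ 8 \<le> 2 * \<Theta> * h ^ 4 * \<Theta>" using \<Theta>1 by (rule mult_mono) (use h1 \<Theta>1 in auto)
    then have "h * real U \<le> 2 * \<Theta> * h ^ 4 * \<Theta> / 10 ^ 8" by (simp add: le_divide_eq)
    also have "\<dots> = (8 * \<Theta>\<^sup>2 * h ^ 4) / (4 * 10 ^ 8)" by (simp add: power2_eq_square)
    also have "\<dots> \<le> (n / \<Theta>) / (4 * 10 ^ 8)" using n\<Theta> by (intro divide_right_mono) auto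
    finally show ?thesis using \<Theta>1 by (simp add: field_simps)
  qed
  have hhU: "h * (h * real U) \<le> n / \<Theta>"
  proof -
    have "h * (h * real U) \<le> h * (h * (2 * (\<Theta> * h\<^sup>2)))" using U h1 by (intro mult_left_mono) auto
    also have "\<dots> = 2 * \<Theta> * 1 * h ^ 4" by (simp add: eval_nat_numeral)
    also have "\<dots> \<le> 2 * \<Theta> * \<Theta> * h ^ 4" using \<Theta>1 by (intro mult_right_mono mult_left_mono) auto
    also have "\<dots> \<le> 8 * \<Theta>\<^sup>2 * h ^ 4" using \<Theta>1 h1 by (simp add: power2_eq_square mult_nonneg_nonneg)
    finally show ?thesis using n\<Theta> by linarith
  qed
  let ?I = "L * (4 * (n * h) / real q + 8 * (h * real U) + 8 * real q)"
  let ?R = "8 * L ^ 12 * (h * n) * (h * n / real q + h * n / real U + real (N div V) + real q)"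
  have L2\<Theta>: "L\<^sup>2 * (n / \<Theta>) \<le> n / 10 ^ 8"
  proof -
    have "10 ^ 8 * L\<^sup>2 * n \<le> \<Theta> * n" using \<Theta>L[of 2] n0 by (intro mult_right_mono) auto
    then show ?thesis using \<Theta>1 by (simp add: field_simps)
  qed
  have "h * (3 * L * ?I) = 3 * L\<^sup>2 * (4 * (h\<^sup>2 * n / real q) + 8 * (h * (h * real U)) + 8 * (h * real q))"
    by (simp add: power2_eq_square algebra_simps)
  also have "\<dots> \<le> 3 * L\<^sup>2 * (4 * (n / \<Theta>) + 8 * (n / \<Theta>) + 8 * (n / \<Theta>))"
    using t1 hhU qn by (intro mult_left_mono) auto
  also have "\<dots> = 60 * (L\<^sup>2 * (n / \<Theta>))" by (simp add: algebra_simps)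
  also have "\<dots> \<le> 60 * (n / 10 ^ 8)" using L2\<Theta> by simp
  finally have A: "h * (3 * L * ?I) \<le> 60 * (n / 10 ^ 8)" .
  have B: "h * (real U * L) \<le> n / 10 ^ 8"
  proof -
    have "h * (real U * L) = L * (h * real U)" by simp
    also have "\<dots> \<le> L\<^sup>2 * (n / \<Theta>)"
    proof (rule mult_mono)
      show "L \<le> L\<^sup>2" using L1 by (simp add: power2_eq_square)
      have "h * real U \<le> n / \<Theta> / (4 * 10 ^ 8)" using hU by simp
      also have "\<dots> \<le> n / \<Theta>" using n0 \<Theta>1 by (simp add: field_simps)
      finally show "h * real U \<le> n / \<Theta>" .
    qed (use L1 h1 in auto)
    finally show ?thesis using L2\<Theta> by linarith
  qed
  \<comment> \<open>As 32 / 10^8 \<le> (6 / 10^4)^2, the two sums of type II together give 24 /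
    10^4, just below 1 / 400.\<close>
  have C: "2 * (2 * L * sqrt ?R) \<le> 24 / 10 ^ 4 * n"
  proof -
    have "?R = 8 * L ^ 12 * n * (h\<^sup>2 * n / real q + h\<^sup>2 * n / real U + h * real (N div V) + h * real q)"
      by (simp add: power2_eq_square algebra_simps)
    also have "\<dots> \<le> 8 * L ^ 12 * n * (n / \<Theta> + n / \<Theta> + n / \<Theta> + n / \<Theta>)"
      using t1 t2 t3 qn L1 n0 by (intro mult_left_mono add_mono) auto
    also have "\<dots> = 32 * (L ^ 12 / \<Theta>) * n\<^sup>2" by (simp add: power2_eq_square)
    finally have "L\<^sup>2 * ?R \<le> L\<^sup>2 * (32 * (L ^ 12 / \<Theta>) * n\<^sup>2)" by (intro mult_left_mono) auto
    also have "\<dots> = 32 / 10 ^ 8 * n\<^sup>2"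
    proof -
      have "L\<^sup>2 * (L ^ 12 / \<Theta>) = 1 / 10 ^ 8" using L1 by (simp add: \<Theta> flip: power_add)
      moreover have "L\<^sup>2 * (32 * (L ^ 12 / \<Theta>) * n\<^sup>2) = 32 * (L\<^sup>2 * (L ^ 12 / \<Theta>)) * n\<^sup>2" by (simp only: mult_ac)
      ultimately show ?thesis by (simp only:)
    qed
    also have "\<dots> \<le> (6 / 10 ^ 4 * n)\<^sup>2" using n0 by (simp add: power2_eq_square)
    finally have "sqrt (L\<^sup>2 * ?R) \<le> 6 / 10 ^ 4 * n" using n0 by (intro real_le_lsqrt) auto
    then have "L * sqrt ?R \<le> 6 / 10 ^ 4 * n" using L1 by (simp add: real_sqrt_mult)
    then show ?thesis by simp
  qed
  have "(\<Sum>h=1..H. norm (\<Sum>n=1..N. of_real (mangoldt n) * expi (real (h * n) * \<theta>))) \<le> 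
      h * (real U * L + 3 * L * ?I) + 2 * (2 * L * sqrt ?R)"
    unfolding n_def h_def by (rule exponential_sum_mangoldt_le[OF ws N H V1 VU UVN L])
  also have "\<dots> \<le> n / 10 ^ 8 + 60 * (n / 10 ^ 8) + 24 / 10 ^ 4 * n"
    using A B C by (simp only: distrib_left)
  also have "\<dots> \<le> n / 400" using n0 by simp
  finally show ?thesis by (simp add: n_def)
qed

section \<open>From exponential sums to primes in a Beatty sequence\<close>

lemma beatty_memI:
  fixes p :: nat
  assumes \<alpha>: "\<alpha> > 1" and p: "real p > \<beta>" and H: "real H \<ge> 2 * \<alpha>"
    and d: "dist_int (real p * (1 / \<alpha>) + (1 / 2 - \<beta>) * (1 / \<alpha>)) < 1 / real H"
  shows "int p \<in> beatty \<alpha> \<beta>"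
proof -
  \<comment> \<open>The index of p: k \<alpha> + \<beta> has to lie in [p, p + 1), whose midpoint
    explains the shift by 1/2 - \<beta>. That the index is positive follows from p >
    \<beta>.\<close>
  define k where "k = round (real p * (1 / \<alpha>) + (1 / 2 - \<beta>) * (1 / \<alpha>))"
  have "\<bar>real p * (1 / \<alpha>) + (1 / 2 - \<beta>) * (1 / \<alpha>) - of_int k\<bar> < 1 / (2 * \<alpha>)"
  proof -
    have "1 / real H \<le> 1 / (2 * \<alpha>)" using H \<alpha> by (intro divide_left_mono) auto
    then show ?thesis using d by (simp add: dist_int_def k_def)
  qed
  then have "\<bar>real p * (1 / \<alpha>) + (1 / 2 - \<beta>) * (1 / \<alpha>) - of_int k\<bar> * \<alpha> < 1 / (2 * \<alpha>) * \<alpha>"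
    using \<alpha> by (intro mult_strict_right_mono) auto
  also have "\<bar>real p * (1 / \<alpha>) + (1 / 2 - \<beta>) * (1 / \<alpha>) - of_int k\<bar> * \<alpha> = 
     \<bar>(real p * (1 / \<alpha>) + (1 / 2 - \<beta>) * (1 / \<alpha>) - of_int k) * \<alpha>\<bar>" using \<alpha> by (simp add: abs_mult)
  also have "(real p * (1 / \<alpha>) + (1 / 2 - \<beta>) * (1 / \<alpha>) - of_int k) * \<alpha> = real p + 1 / 2 - \<beta> - of_int k * \<alpha>"
    using \<alpha> by (simp add: field_simps)
  finally have *: "\<bar>real p + 1 / 2 - \<beta> - of_int k * \<alpha>\<bar> < 1 / 2" using \<alpha> by simp
  then have "of_int k * \<alpha> > 0" using p by linarith
  then have "k > 0" using \<alpha> by (simp add: zero_less_mult_iff)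
  then have k: "real (nat k) = of_int k" "nat k \<ge> 1" by auto
  have "of_int (int p) \<le> real (nat k) * \<alpha> + \<beta>" "real (nat k) * \<alpha> + \<beta> < of_int (int p) + 1"
    using * unfolding k by (simp_all only: of_int_of_nat_eq)
  then have "\<lfloor>real (nat k) * \<alpha> + \<beta>\<rfloor> = int p" by (rule floor_unique)
  then show ?thesis using k unfolding beatty_def by force
qed

text \<open>Excluded from detection are the n \<le> \<beta>, whose index might not be positive, and
  the nonprimes. N3 and the sparsity of proper prime powers make their total \<Lambda> negligible
  even with the weight 6 H.\<close>

theorem prime_in_beatty:
  fixes \<alpha> \<beta> \<Theta> L :: real
  assumes \<alpha>: "\<alpha> > 1" and \<beta>: "\<beta> \<ge> 0" and ws: "well_spaced (1 / \<alpha>) q" and H: "H = nat \<lceil>2 * \<alpha>\<rceil>"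
    and L: "1 + ln (real (H * N)) \<le> L" "harm (2 * q) \<le> L"
    and \<Theta>: "\<Theta> = 10 ^ 8 * L ^ 14"
    and q: "\<Theta> * (real H)\<^sup>2 \<le> real q" and N1: "8 * \<Theta> ^ 3 * (real H) ^ 4 \<le> real N" and N2: "\<Theta> * real H * real q \<le> real N"
    and N3: "\<Theta> * real H * \<beta> \<le> real N"
  shows "\<exists>p::nat. prime p \<and> p \<le> N \<and> int p \<in> beatty \<alpha> \<beta>"
proof -
  have H2: "real H \<ge> 2 * \<alpha>" "H \<ge> 2" using \<alpha> unfolding H by linarith+
  have q0: "q \<ge> 1" using ws by (simp add: well_spaced_def)
  have L1: "1 \<le> L"
  proof -
    have "harm 1 \<le> (harm (2 * q) :: real)" using q0 by (intro harm_mono) simp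
    then show ?thesis using L by (simp add: harm_def)
  qed
  have \<Theta>1: "10 ^ 8 * L\<^sup>2 \<le> \<Theta>" using power_increasing[of 2 14 L] L1 by (simp add: \<Theta>)
  have "L \<le> L\<^sup>2" "1 \<le> L\<^sup>2" using L1 by (auto simp: power2_eq_square mult_ge1_I)
  then have \<Theta>0: "10 ^ 8 * L \<le> \<Theta>" "10 ^ 8 \<le> \<Theta>" using \<Theta>1 by auto
  have "10 ^ 8 * 1 * 1 \<le> \<Theta> * real H * real q" using \<Theta>0 H2 q0 by (intro mult_mono) auto
  then have Nbig: "10 ^ 8 \<le> real N" using N2 by linarith
  moreover have "(2::real) \<le> 10 ^ 8" by simp
  ultimately have "2 \<le> real N" by linarith
  then have N: "N \<ge> 2" by simp
  have lnN: "0 \<le> ln (real N)" "ln (real N) \<le> L"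
  proof -
    show "0 \<le> ln (real N)" using N by simp
    have "N \<le> H * N" using H2 by simp
    then have "ln (real N) \<le> ln (real (H * N))" using N H2 by (subst ln_le_cancel_iff) (auto simp del: of_nat_mult)
    then show "ln (real N) \<le> L" using L by linarith
  qed
  define X where "X = {n \<in> {1..N}. real n \<le> \<beta> \<or> \<not> prime n}"
  have X: "(\<Sum>n\<in>X. mangoldt n) \<le> \<beta> * L + 2 * sqrt (real N) * L\<^sup>2"
  proof -
    have "(\<Sum>n\<in>X. mangoldt n :: real) \<le> (\<Sum>n | n \<in> {1..N} \<and> real n \<le> \<beta>. mangoldt n) + (\<Sum>n | n \<in> {1..N} \<and> \<not> prime n. mangoldt n)"
    proof -
      have "X = {n. n \<in> {1..N} \<and> real n \<le> \<beta>} \<union> {n. n \<in> {1..N} \<and> \<not> prime n}" by (auto simp: X_def)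
      then show ?thesis using sum.union_inter[of "{n. n \<in> {1..N} \<and> real n \<le> \<beta>}" "{n. n \<in> {1..N} \<and> \<not> prime n}" "mangoldt :: nat \<Rightarrow> real"]
        sum_nonneg[of "{n. n \<in> {1..N} \<and> real n \<le> \<beta>} \<inter> {n. n \<in> {1..N} \<and> \<not> prime n}" "mangoldt :: nat \<Rightarrow> real"]
        by (simp add: mangoldt_nonneg)
    qed
    also have "(\<Sum>n | n \<in> {1..N} \<and> real n \<le> \<beta>. mangoldt n :: real) \<le> \<beta> * L"
    proof -
      have "(\<Sum>n | n \<in> {1..N} \<and> real n \<le> \<beta>. mangoldt n) \<le> (\<Sum>n | n \<in> {1..N} \<and> real n \<le> \<beta>. L)"
      proof (rule sum_mono)
        fix n assume n: "n \<in> {n. n \<in> {1..N} \<and> real n \<le> \<beta>}"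
        have "mangoldt n \<le> ln (real n)" using n by (intro mangoldt_le) auto
        also have "\<dots> \<le> ln (real N)" using n by simp
        finally show "mangoldt n \<le> L" using lnN by linarith
      qed
      also have "\<dots> = real (card {n. n \<in> {1..N} \<and> real n \<le> \<beta>}) * L" by simp
      also have "card {n. n \<in> {1..N} \<and> real n \<le> \<beta>} \<le> card {1..nat \<lfloor>\<beta>\<rfloor>}"
        by (intro card_mono) (auto simp: le_nat_floor)
      then have "real (card {n. n \<in> {1..N} \<and> real n \<le> \<beta>}) \<le> real (nat \<lfloor>\<beta>\<rfloor>)" by simp
      then have "real (card {n. n \<in> {1..N} \<and> real n \<le> \<beta>}) \<le> \<beta>" using \<beta> by linarith
      then have "real (card {n. n \<in> {1..N} \<and> real n \<le> \<beta>}) * L \<le> \<beta> * L"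
        using L1 by (intro mult_right_mono) auto
      finally show ?thesis .
    qed
    also have "(\<Sum>n | n \<in> {1..N} \<and> \<not> prime n. mangoldt n) \<le> 2 * sqrt (real N) * (ln (real N))\<^sup>2"
      using N by (intro sum_mangoldt_nonprime_le) auto
    also have "\<dots> \<le> 2 * sqrt (real N) * L\<^sup>2" using lnN by (intro mult_left_mono power_mono) auto
    finally show ?thesis by simp
  qed
  have HN: "real H * sqrt (real N) \<le> real N / \<Theta>"
  proof -
    have "(\<Theta> * real H)\<^sup>2 \<le> real N"
    proof -
      have "\<Theta> ^ 2 * real H ^ 2 \<le> (8 * \<Theta> ^ 3) * real H ^ 4"
      proof (intro mult_mono power_increasing)
        have "\<Theta> ^ 2 * 1 \<le> \<Theta> ^ 2 * (8 * \<Theta>)" using \<Theta>0 by (intro mult_left_mono) auto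
        then show "\<Theta> ^ 2 \<le> 8 * \<Theta> ^ 3" by (simp add: eval_nat_numeral)
      qed (use H2 \<Theta>0 in auto)
      then show ?thesis using N1 by (simp add: power_mult_distrib)
    qed
    then have "\<Theta> * real H \<le> sqrt (real N)" by (rule real_le_rsqrt)
    then have "\<Theta> * real H * sqrt (real N) \<le> sqrt (real N) * sqrt (real N)" by (intro mult_right_mono) auto
    then show ?thesis using \<Theta>0 by (simp add: field_simps)
  qed
  have H\<beta>: "real H * \<beta> \<le> real N / \<Theta>" using N3 \<Theta>0 by (simp add: field_simps)
  have "6 * real H * (\<Sum>n\<in>X. mangoldt n) \<le> 6 * real H * (\<beta> * L + 2 * sqrt (real N) * L\<^sup>2)"
    using X by (intro mult_left_mono) auto
  also have "\<dots> = 6 * L * (real H * \<beta>) + 12 * L\<^sup>2 * (real H * sqrt (real N))" by (simp add: algebra_simps)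
  also have "\<dots> \<le> 6 * L * (real N / \<Theta>) + 12 * L\<^sup>2 * (real N / \<Theta>)"
    using HN H\<beta> L1 by (intro add_mono mult_left_mono) auto
  also have "\<dots> \<le> 6 * (real N / 10 ^ 8) + 12 * (real N / 10 ^ 8)"
  proof -
    have "10 ^ 8 * L * real N \<le> \<Theta> * real N" "10 ^ 8 * L\<^sup>2 * real N \<le> \<Theta> * real N"
      by (intro mult_right_mono \<Theta>0 \<Theta>1; simp)+
    then have "L * (real N / \<Theta>) \<le> real N / 10 ^ 8" "L\<^sup>2 * (real N / \<Theta>) \<le> real N / 10 ^ 8"
      using \<Theta>0 by (simp_all add: field_simps)
    then show ?thesis by linarith
  qed
  also have "\<dots> \<le> real N / 1000" by simp
  finally have small: "6 * real H * (\<Sum>n\<in>X. mangoldt n) \<le> real N / 1000" .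
  have E: "(\<Sum>h=1..H. norm (\<Sum>n=1..N. of_real (mangoldt n) * expi (real (h * n) * (1 / \<alpha>)))) \<le> real N / 400"
    using N H2 by (intro exponential_sum_mangoldt_small[OF ws _ _ L \<Theta> q N1 N2]) auto
  \<comment> \<open>Chebyshev's 1 / 9 outweighs 8 / 400 + 1 / 1000.\<close>
  have "(\<Sum>n=1..N. mangoldt n) \<ge> real N / 9" using N by (rule sum_mangoldt_ge)
  then have gt: "(\<Sum>n=1..N. mangoldt n) > 8 * (real N / 400) + 6 * real H * (\<Sum>n\<in>X. mangoldt n)"
    using small \<open>2 \<le> real N\<close> by linarith
  have "X \<subseteq> {1..N}" by (auto simp: X_def)
  then obtain p where p: "p \<in> {1..N}" "p \<notin> X" 
    "dist_int (real p * (1 / \<alpha>) + (1 / 2 - \<beta>) * (1 / \<alpha>)) < 1 / real H"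
    using E gt detect_small_dist_int[OF H2(2), of mangoldt X N "1 / \<alpha>" "real N / 400" "(1 / 2 - \<beta>) * (1 / \<alpha>)"]
    by (auto simp: mangoldt_nonneg)
  then have "prime p" "real p > \<beta>" by (auto simp: X_def)
  then show ?thesis using p beatty_memI[OF \<alpha> _ H2(1)] by auto
qed

subsection \<open>Convergents\<close>

lemma complete_quotient_irrational:
  assumes "\<alpha> \<notin> \<rat>"
  shows "complete_quotient \<alpha> n \<notin> \<rat>"
proof (induction n)
  case (Suc n)
  show ?case
  proof
    assume "complete_quotient \<alpha> (Suc n) \<in> \<rat>"
    then have "1 / complete_quotient \<alpha> (Suc n) \<in> \<rat>" by (rule Rats_divide[OF Rats_1])
    then have "frac (complete_quotient \<alpha> n) \<in> \<rat>" by simp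
    then have "frac (complete_quotient \<alpha> n) + of_int \<lfloor>complete_quotient \<alpha> n\<rfloor> \<in> \<rat>" by (intro Rats_add) auto
    then show False using Suc by (simp add: frac_def)
  qed
qed (simp add: assms)

lemma complete_quotient_gt_1:
  assumes "\<alpha> \<notin> \<rat>"
  shows "complete_quotient \<alpha> (Suc n) > 1"
proof -
  have "frac (complete_quotient \<alpha> n) \<noteq> 0"
    using complete_quotient_irrational[OF assms, of n] by (metis Ints_subset_Rats frac_eq_0_iff subsetD)
  then have "0 < frac (complete_quotient \<alpha> n)" using frac_ge_0[of "complete_quotient \<alpha> n"] by linarith
  then show ?thesis using frac_lt_1[of "complete_quotient \<alpha> n"] by simp
qed

lemma partial_quotient_ge_1:
  assumes "\<alpha> \<notin> \<rat>" "\<alpha> > 1"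
  shows "partial_quotient \<alpha> n \<ge> 1"
  unfolding partial_quotient_def using complete_quotient_gt_1[OF assms(1)] assms(2)
  by (cases n) (auto simp: le_floor_iff less_imp_le simp del: complete_quotient.simps(2))

text \<open>The denominators of the convergents, with the index shift of the numerators. For the
  reciprocal 1 / \<alpha> the roles change, and these become the numerators.\<close>

fun conv_den_shift :: "real \<Rightarrow> nat \<Rightarrow> int" where
  "conv_den_shift \<alpha> 0 = 0"
| "conv_den_shift \<alpha> (Suc 0) = 1"
| "conv_den_shift \<alpha> (Suc (Suc n)) =
     partial_quotient \<alpha> (Suc n) * conv_den_shift \<alpha> (Suc n) + conv_den_shift \<alpha> n"

text \<open>The expression of \<alpha> by a complete quotient and two consecutive convergents, with
  denominators cleared. The induction substitutes x = a + 1 / y for consecutive complete quotients x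
  and y.\<close>

lemma convergent_complete_quotient:
  assumes "\<alpha> \<notin> \<rat>"
  shows "\<alpha> * (complete_quotient \<alpha> (Suc n) * of_int (conv_den_shift \<alpha> (Suc n)) + of_int (conv_den_shift \<alpha> n)) =
    complete_quotient \<alpha> (Suc n) * of_int (conv_num_shift \<alpha> (Suc n)) + of_int (conv_num_shift \<alpha> n)"
proof (induction n)
  case 0
  have "frac \<alpha> \<noteq> 0" using assms by (metis Ints_subset_Rats frac_eq_0_iff subsetD)
  then show ?case by (simp add: partial_quotient_def field_simps) (simp add: frac_def)
next
  case (Suc n)
  define x y where "x = complete_quotient \<alpha> (Suc n)" and "y = complete_quotient \<alpha> (Suc (Suc n))"
  have y: "y > 1" unfolding y_def by (rule complete_quotient_gt_1[OF assms])
  have "frac x = 1 / y" by (simp add: x_def y_def)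
  then have x: "x = of_int (partial_quotient \<alpha> (Suc n)) + 1 / y"
    by (simp add: frac_def partial_quotient_def x_def)
  have yx: "y * x = of_int (partial_quotient \<alpha> (Suc n)) * y + 1" using x y by (simp add: field_simps)
  have "(y * x) * (\<alpha> * of_int (conv_den_shift \<alpha> (Suc n))) + y * (\<alpha> * of_int (conv_den_shift \<alpha> n)) =
     (y * x) * of_int (conv_num_shift \<alpha> (Suc n)) + y * of_int (conv_num_shift \<alpha> n)"
    using arg_cong[OF Suc.IH, of "\<lambda>t. y * t"] by (simp only: x_def[symmetric]) (simp add: algebra_simps)
  then show ?case unfolding yx y_def[symmetric] by (simp add: algebra_simps)
qed

lemma convergent_determinant:
  "conv_num_shift \<alpha> (Suc n) * conv_den_shift \<alpha> n - conv_num_shift \<alpha> n * conv_den_shift \<alpha> (Suc n) = (-1) ^ Suc n"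
proof (induction n)
  case (Suc n)
  have "conv_num_shift \<alpha> (Suc (Suc n)) * conv_den_shift \<alpha> (Suc n) - conv_num_shift \<alpha> (Suc n) * conv_den_shift \<alpha> (Suc (Suc n)) = 
    - (conv_num_shift \<alpha> (Suc n) * conv_den_shift \<alpha> n - conv_num_shift \<alpha> n * conv_den_shift \<alpha> (Suc n))"
    by (simp add: algebra_simps)
  then show ?case unfolding Suc.IH by simp
qed simp

lemma conv_num_shift_growth:
  assumes "\<alpha> \<notin> \<rat>" "\<alpha> > 1"
  shows "1 \<le> conv_num_shift \<alpha> n \<and> conv_num_shift \<alpha> n \<le> conv_num_shift \<alpha> (Suc n)"
proof (induction n)
  case 0
  then show ?case using partial_quotient_ge_1[OF assms, of 0] by simp
next
  case (Suc n)
  have "1 * conv_num_shift \<alpha> (Suc n) \<le> partial_quotient \<alpha> (Suc n) * conv_num_shift \<alpha> (Suc n)"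
    using partial_quotient_ge_1[OF assms, of "Suc n"] Suc by (intro mult_right_mono) auto
  then show ?case using Suc by (simp only: conv_num_shift.simps(3)) linarith
qed

lemma conv_num_shift_mono:
  assumes "\<alpha> \<notin> \<rat>" "\<alpha> > 1" "i \<le> j"
  shows "conv_num_shift \<alpha> i \<le> conv_num_shift \<alpha> j"
  using assms(3) by (rule lift_Suc_mono_le[rotated]) (use conv_num_shift_growth[OF assms(1,2)] in blast)

text \<open>Partial quotients are at least 1, so each numerator is at least the sum of the two
  before it, and hence at least twice the one two places earlier.\<close>

lemma conv_num_shift_double:
  assumes "\<alpha> \<notin> \<rat>" "\<alpha> > 1"
  shows "2 ^ r * conv_num_shift \<alpha> n \<le> conv_num_shift \<alpha> (n + 2 * r)"
proof (induction r)
  case (Suc r)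
  let ?k = "n + 2 * r"
  have "1 * conv_num_shift \<alpha> (Suc ?k) \<le> partial_quotient \<alpha> (Suc ?k) * conv_num_shift \<alpha> (Suc ?k)"
    using partial_quotient_ge_1[OF assms, of "Suc ?k"] conv_num_shift_growth[OF assms, of "Suc ?k"] 
    by (intro mult_right_mono) auto
  then have "2 * conv_num_shift \<alpha> ?k \<le> conv_num_shift \<alpha> (Suc (Suc ?k))"
    using conv_num_shift_growth[OF assms, of ?k] by (simp only: conv_num_shift.simps(3)) linarith
  then show ?case using Suc by simp
qed simp

text \<open>The reciprocals of the convergents of \<alpha> approximate 1 / \<alpha>, and their
  denominators are the numerators p. The determinant gives coprimality and the error 1 / (p (x p +
  p')) \<le> 1 / p^2.\<close>

lemma well_spaced_convergent:
  assumes "\<alpha> \<notin> \<rat>" "\<alpha> > 1"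
  shows "well_spaced (1 / \<alpha>) (nat (conv_num_shift \<alpha> (Suc n)))"
proof (rule well_spaced_rational_approx)
  define x where "x = complete_quotient \<alpha> (Suc n)"
  define p q p' q' where "p = conv_num_shift \<alpha> (Suc n)" and "q = conv_den_shift \<alpha> (Suc n)"
    and "p' = conv_num_shift \<alpha> n" and "q' = conv_den_shift \<alpha> n"
  have x: "x > 1" unfolding x_def by (rule complete_quotient_gt_1[OF assms(1)])
  have p: "p \<ge> 1" "p' \<ge> 1"
    using conv_num_shift_growth[OF assms, of "Suc n"] conv_num_shift_growth[OF assms, of n] by (auto simp: p_def p'_def)
  have det: "p * q' - p' * q = (-1) ^ Suc n"
    unfolding p_def q_def p'_def q'_def by (rule convergent_determinant)
  have natp: "int (nat p) = p" "real (nat p) = of_int p" using p by auto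
  show "nat (conv_num_shift \<alpha> (Suc n)) > 0" using p by (simp add: p_def)
  have "is_unit d" if "d dvd q" "d dvd p" for d
  proof -
    have "d dvd p * q' - p' * q" using that by (intro dvd_diff dvd_mult dvd_mult2)
    then have "d dvd (-1) ^ Suc n" by (simp only: det)
    then have "\<bar>d\<bar> dvd 1" by (metis abs_dvd_iff dvd_trans is_unit_power_iff dvd_minus_iff dvd_refl unit_imp_dvd one_dvd minus_dvd_iff dvd_power_same power_one)
    then show ?thesis by simp
  qed
  then have "coprime q p" by (rule coprimeI)
  then show "coprime (conv_den_shift \<alpha> (Suc n)) (int (nat (conv_num_shift \<alpha> (Suc n))))"
    using natp by (simp add: p_def q_def)
  have eq: "\<alpha> * (x * of_int q + of_int q') = x * of_int p + of_int p'"
    unfolding x_def p_def q_def p'_def q'_def by (rule convergent_complete_quotient[OF assms(1)])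
  have den: "x * of_int p + of_int p' \<ge> of_int p" "x * of_int p + of_int p' > 0"
  proof -
    have "1 * of_int p \<le> x * of_int p" using x p by (intro mult_right_mono) auto
    then show "x * of_int p + of_int p' \<ge> of_int p" "x * of_int p + of_int p' > 0" using p by linarith+
  qed
  have "1 / \<alpha> = (x * of_int q + of_int q') / (x * of_int p + of_int p')"
    using eq den assms(2) by (simp add: field_simps)
  then have "1 / \<alpha> - of_int q / of_int p = 
      ((x * of_int q + of_int q') * of_int p - of_int q * (x * of_int p + of_int p')) / ((x * of_int p + of_int p') * of_int p)"
    using den p by (simp only:) (subst diff_frac_eq; simp)
  also have "\<dots> = of_int (p * q' - p' * q) / (of_int p * (x * of_int p + of_int p'))"
    by (simp add: algebra_simps)
  finally have "1 / \<alpha> - of_int q / of_int p = of_int (p * q' - p' * q) / (of_int p * (x * of_int p + of_int p'))" .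
  then have "\<bar>1 / \<alpha> - of_int q / of_int p\<bar> = 1 / (of_int p * (x * of_int p + of_int p'))"
    unfolding det using den p by (simp add: abs_mult power_abs)
  also have "\<dots> \<le> 1 / (of_int p)\<^sup>2"
    unfolding power2_eq_square using den p by (intro divide_left_mono mult_left_mono mult_pos_pos) auto
  finally show "\<bar>1 / \<alpha> - of_int (conv_den_shift \<alpha> (Suc n)) / real (nat (conv_num_shift \<alpha> (Suc n)))\<bar>
      \<le> 1 / (real (nat (conv_num_shift \<alpha> (Suc n))))\<^sup>2"
    using natp by (simp add: p_def q_def)
qed

section \<open>Powers against exponentials\<close>

lemma power_le_exp:
  fixes x :: real
  assumes "x \<ge> 0" "n > 0"
  shows "x ^ n \<le> real n ^ n * exp x"
proof -
  have "x / real n \<le> exp (x / real n)" using exp_ge_add_one_self[of "x / real n"] by linarith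
  then have "(x / real n) ^ n \<le> exp (x / real n) ^ n" using assms by (intro power_mono) auto
  also have "\<dots> = exp x" using assms by (simp flip: exp_of_nat_mult)
  finally show ?thesis using assms by (simp add: power_divide field_simps)
qed

lemma two_power_le_exp:
  assumes "real n \<le> x" shows "2 ^ n \<le> exp x"
proof -
  have "(2::real) ^ n \<le> exp 1 ^ n" using exp_ge_add_one_self[of 1] by (intro power_mono) auto
  also have "\<dots> = exp (real n)" by (simp flip: exp_of_nat_mult)
  also have "\<dots> \<le> exp x" using assms by simp
  finally show ?thesis .
qed

text \<open>Half of the exponent pays for d^14, the other half, at least 500, for the constants. In
  \<open>prime_in_beatty_parameters\<close>, 200 comes from Lc \<le> 200 L d, 9 * 10^8 from \<Theta>
  and H^2 \<le> 9 \<alpha>^2, and 9/4 from L^2 \<ge> 4/9.\<close>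

lemma exp_beats_power_14:
  assumes "1000 \<le> d"
  shows "9 / 4 * (9 * 10 ^ 8 * (200 * d) ^ 14) \<le> exp (d::real)"
proof -
  have e: "exp d = exp (d / 2) * exp (d / 2)" by (simp flip: exp_add)
  have "(d / 2) ^ 14 \<le> 14 ^ 14 * exp (d / 2)" using power_le_exp[of "d / 2" 14] assms by simp
  then have "9 / 4 * (9 * 10 ^ 8 * 400 ^ 14) * (d / 2) ^ 14 \<le> 9 / 4 * (9 * 10 ^ 8 * 400 ^ 14) * (14 ^ 14 * exp (d / 2))"
    by (intro mult_left_mono) auto
  also have "\<dots> \<le> 2 ^ 500 * exp (d / 2)" by simp
  also have "\<dots> \<le> exp (d / 2) * exp (d / 2)"
    using assms by (intro mult_right_mono two_power_le_exp) auto
  finally show ?thesis unfolding e by (simp add: power_mult_distrib power_divide)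
qed

text \<open>exp (\<epsilon> d) alone beats d^28 only up to a multiple of \<epsilon>^(-28), which is
  unbounded. As 1 / \<epsilon> \<le> r / 60, that factor is paid by 2^r: d is at most (\<epsilon> d)
  (r / 60), and each factor is given its own exponential.\<close>

lemma exp_beats_power_28:
  assumes "0 < \<epsilon>" "\<epsilon> < 1 / 46" "60 / \<epsilon> \<le> real r" "0 \<le> d"
  shows "144 * 10 ^ 16 * (200 * d) ^ 28 \<le> (2 / 3) ^ 7 * 2 ^ r * exp (\<epsilon> * d)"
proof -
  have "60 * 46 \<le> 60 / \<epsilon>" using assms by (simp add: field_simps)
  then have r: "2760 \<le> real r" using assms by linarith
  \<comment> \<open>exp (r / 2) is spent on the power of r and exp (r / 6) on the constants; r \<ge>
    2760 makes r / 6 at least 460.\<close>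
  have "(2::real) ^ r = exp (real r * ln 2)" by (simp add: exp_of_nat_mult)
  also have "\<dots> \<ge> exp (2 * real r / 3)"
    using mult_left_mono[OF ln2_ge_two_thirds, of "real r"] by (subst exp_le_cancel_iff) simp
  finally have F: "exp (real r / 6) * exp (real r / 2) \<le> 2 ^ r" by (simp flip: exp_add) 
  have 1: "(\<epsilon> * d) ^ 28 \<le> 28 ^ 28 * exp (\<epsilon> * d)" using power_le_exp[of "\<epsilon> * d" 28] assms by simp
  have 2: "(real r / 2) ^ 28 \<le> 28 ^ 28 * exp (real r / 2)" using power_le_exp[of "real r / 2" 28] by simp
  have "d \<le> (\<epsilon> * d) * (real r / 60)"
  proof -
    have "60 \<le> \<epsilon> * real r" using assms by (simp add: field_simps)
    then have "d * 60 \<le> d * (\<epsilon> * real r)" using assms by (intro mult_left_mono) auto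
    then show ?thesis by (simp add: mult_ac)
  qed
  then have "d ^ 28 \<le> ((\<epsilon> * d) * (real r / 60)) ^ 28" using assms by (intro power_mono) auto
  also have "\<dots> = (\<epsilon> * d) ^ 28 * ((real r / 2) ^ 28 * (1 / 30) ^ 28)"
    by (simp only: power_mult_distrib[symmetric]) simp
  also have "\<dots> \<le> (28 ^ 28 * exp (\<epsilon> * d)) * ((28 ^ 28 * exp (real r / 2)) * (1 / 30) ^ 28)"
    using 1 2 assms by (intro mult_mono) auto
  finally have "144 * 10 ^ 16 * 200 ^ 28 * d ^ 28 \<le> 
      144 * 10 ^ 16 * 200 ^ 28 * ((28 ^ 28 * exp (\<epsilon> * d)) * ((28 ^ 28 * exp (real r / 2)) * (1 / 30) ^ 28))"
    by (intro mult_left_mono) auto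
  also have "\<dots> = (144 * 10 ^ 16 * 200 ^ 28 * 28 ^ 28 * 28 ^ 28 * (1 / 30) ^ 28) * (exp (\<epsilon> * d) * exp (real r / 2))"
    by (simp only: mult_ac)
  also have "\<dots> \<le> ((2 / 3) ^ 7 * 2 ^ 460) * (exp (\<epsilon> * d) * exp (real r / 2))"
    by (intro mult_right_mono) (simp_all add: power_divide)
  also have "\<dots> \<le> ((2 / 3) ^ 7 * exp (real r / 6)) * (exp (\<epsilon> * d) * exp (real r / 2))"
    using r by (intro mult_right_mono mult_left_mono two_power_le_exp) auto
  also have "\<dots> = (2 / 3) ^ 7 * exp (\<epsilon> * d) * (exp (real r / 6) * exp (real r / 2))" by (simp only: mult_ac)
  also have "\<dots> \<le> (2 / 3) ^ 7 * exp (\<epsilon> * d) * 2 ^ r" using F by (intro mult_left_mono) auto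
  finally show ?thesis by (simp add: power_mult_distrib mult_ac)
qed

subsection \<open>Choice of parameters\<close>

text \<open>The two gaps serve different ends. That between P and q makes q / W at least 2^r, whence
  \<Theta> H^2 \<le> q; that between q and p pays for the constants and powers of 1 / \<epsilon> in
  the final bound.\<close>

lemma prime_in_beatty_parameters:
  fixes \<alpha> \<beta> B L \<epsilon> p :: real and P q r :: nat
  assumes \<alpha>: "\<alpha> > 1" and \<beta>: "\<beta> \<ge> 0" and B: "B = max 1 \<beta>" and L: "L = ln (2 * \<alpha> * B)"
    and \<epsilon>: "0 < \<epsilon>" "\<epsilon> < 1 / 46" and r: "60 / \<epsilon> \<le> real r"
    and ws: "well_spaced (1 / \<alpha>) q" and P: "1 \<le> P" "L ^ 16 * \<alpha>\<^sup>2 < real P"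
    and q: "2 ^ r * real P \<le> real q" and p: "2 ^ r * real q \<le> p"
  shows "\<exists>k::nat. prime k \<and> int k \<in> beatty \<alpha> \<beta> \<and>
     real k \<le> L powr (35 - 16 * \<epsilon>) * \<alpha> powr (2 * (1 - \<epsilon>)) * B * p powr (1 + \<epsilon>)"
proof -
  have B1: "B \<ge> 1" "B \<ge> \<beta>" by (auto simp: B)
  have \<alpha>B: "\<alpha> * 1 \<le> \<alpha> * B" using B1 \<alpha> by (intro mult_left_mono) auto
  have \<alpha>B1: "1 \<le> \<alpha> * B" "\<alpha> \<le> 2 * \<alpha> * B" using \<alpha>B \<alpha> by linarith+
  \<comment> \<open>L may be smaller than 1, so raising L^14 to L^16 and L^28 to L^35 costs the
    constants (2/3)^2 and (2/3)^7.\<close>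
  have L23: "2 / 3 \<le> L"
  proof -
    have "ln 2 \<le> L" unfolding L using \<alpha>B1 \<alpha> by (subst ln_le_cancel_iff) auto
    then show ?thesis using ln2_ge_two_thirds by linarith
  qed
  have L\<alpha>: "ln \<alpha> \<le> L" unfolding L using \<alpha>B1 \<alpha> by (subst ln_le_cancel_iff) auto
  have "60 * 46 \<le> 60 / \<epsilon>" using \<epsilon> by (simp add: field_simps)
  then have r1: "2760 \<le> real r" using r by linarith
  define W where "W = L ^ 16 * \<alpha>\<^sup>2"
  define D where "D = real q / W"
  define d where "d = ln D"
  have W: "W > 0" unfolding W_def using L23 \<alpha> by (intro mult_pos_pos zero_less_power) auto
  have qr: "2 ^ r \<le> real q"
  proof -
    have "2 ^ r * 1 \<le> 2 ^ r * real P" using P by (intro mult_left_mono) auto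
    then show ?thesis using q by linarith
  qed
  have q1: "real q \<ge> 1" using qr one_le_power[of "2::real" r] by linarith
  have Dr: "2 ^ r \<le> D"
  proof -
    have "2 ^ r * W \<le> 2 ^ r * real P" using P by (intro mult_left_mono) (auto simp: W_def)
    then have "2 ^ r * W \<le> real q" using q by linarith
    then show ?thesis using W by (simp add: D_def field_simps)
  qed
  have ln_ge: "1000 \<le> ln x" if "2 ^ r \<le> x" for x :: real
  proof -
    have "real r * (2 / 3) \<le> real r * ln 2" using ln2_ge_two_thirds by (intro mult_left_mono) auto
    also have "\<dots> = ln (2 ^ r)" by (simp add: ln_realpow)
    also have "\<dots> \<le> ln x" using that by (intro ln_mono) auto
    finally show ?thesis using r1 by linarith
  qed
  have D0: "D > 0" using Dr by (meson less_le_trans zero_less_numeral zero_less_power)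
  have d: "1000 \<le> d" unfolding d_def by (rule ln_ge[OF Dr])
  have exp_d: "exp d = D" using D0 by (simp add: d_def)
  have qD: "real q = D * W" using W by (simp add: D_def)
  define y where "y = ln (2 * \<alpha> * B * real q)"
  have y1: "1000 \<le> y"
    unfolding y_def
  proof (rule ln_ge)
    have "1 \<le> 2 * \<alpha> * B" using \<alpha>B1 by linarith
    then have "1 * real q \<le> (2 * \<alpha> * B) * real q" by (intro mult_right_mono) auto
    then show "2 ^ r \<le> 2 * \<alpha> * B * real q" using qr by linarith
  qed
  \<comment> \<open>A sum of logarithms becomes a product, as L and d are bounded below. This
    separates the powers of L, which appear in the result, from those of d, which D powr \<epsilon>
    pays.\<close>
  have y2: "y \<le> 2 * (L * d)"
  proof -
    have "y = L + ln (real q)" unfolding y_def L using \<alpha> B1 q1 by (subst ln_mult) auto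
    also have "ln (real q) = d + (16 * ln L + 2 * ln \<alpha>)"
      unfolding qD d_def W_def using D0 L23 \<alpha> by (simp add: ln_mult ln_realpow)
    also have "ln L \<le> L" using L23 ln_le_minus_one[of L] by linarith
    finally have "y \<le> 19 * L + d" using L\<alpha> by linarith
    also have "\<dots> \<le> L * d / 4 + 3 / 2 * (L * d)"
    proof (rule add_mono)
      have "L * 76 \<le> L * d" using d L23 by (intro mult_left_mono) auto
      then show "19 * L \<le> L * d / 4" by simp
      have "2 / 3 * d \<le> L * d" using d L23 by (intro mult_right_mono) auto
      then show "d \<le> 3 / 2 * (L * d)" by simp
    qed
    also have "\<dots> \<le> 2 * (L * d)" using L23 d by simp
    finally show ?thesis .
  qed
  \<comment> \<open>\<open>Lc\<close> has to exceed 1 + ln (H N), but N depends on \<Theta> and so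
    on \<open>Lc\<close>. The circle is harmless: \<Theta> enters only through ln y, the crude y
    \<le> exp y suffices, and 301 + 31 y \<le> 100 y.\<close>
  define Lc where "Lc = 100 * y"
  have Lc0: "Lc > 0" using y1 by (simp add: Lc_def)
  have Lc_le: "Lc \<le> L * (200 * d)" using y2 by (simp add: Lc_def)
  define \<Theta> where "\<Theta> = 10 ^ 8 * Lc ^ 14"
  have \<Theta>1: "1 \<le> \<Theta>"
  proof -
    have "1 \<le> Lc ^ 14" using y1 by (intro one_le_power) (simp add: Lc_def)
    then show ?thesis by (simp add: \<Theta>_def)
  qed
  define H where "H = nat \<lceil>2 * \<alpha>\<rceil>"
  have H: "1 \<le> real H" "real H \<le> 3 * \<alpha>" using \<alpha> unfolding H_def by linarith+
  have H2: "(real H)\<^sup>2 \<le> 9 * \<alpha>\<^sup>2"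
  proof -
    have "(real H)\<^sup>2 \<le> (3 * \<alpha>)\<^sup>2" using H by (intro power_mono) auto
    then show ?thesis by (simp add: power_mult_distrib)
  qed
  \<comment> \<open>This dominates 8 \<Theta>^3 H^4, by \<Theta> H^2 \<le> q, and also \<Theta> H q
    and \<Theta> H \<beta>. The factor \<Theta>^2 H^2 becomes L^28 \<alpha>^2 in the result.\<close>
  define x where "x = 8 * \<Theta>\<^sup>2 * (real H)\<^sup>2 * real q * B"
  define N where "N = nat \<lceil>x\<rceil>"
  have sq1: "\<Theta> \<le> \<Theta>\<^sup>2" "real H \<le> (real H)\<^sup>2" "1 \<le> \<Theta>\<^sup>2" "1 \<le> (real H)\<^sup>2"
    using \<Theta>1 H by (auto simp: power2_eq_square mult_ge1_I)
  have x1: "1 \<le> x"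
  proof -
    have "1 * 1 * 1 * 1 * 1 \<le> 8 * \<Theta>\<^sup>2 * (real H)\<^sup>2 * real q * B"
      using sq1 q1 B1 by (intro mult_mono) auto
    then show ?thesis by (simp add: x_def)
  qed
  have N: "x \<le> real N" "real N \<le> 2 * x" "1 \<le> N" using x1 unfolding N_def by linarith+
  have c1: "\<Theta> * (real H)\<^sup>2 \<le> real q"
  proof -
    have "\<Theta> * (real H)\<^sup>2 \<le> (10 ^ 8 * (L * (200 * d)) ^ 14) * (9 * \<alpha>\<^sup>2)"
      unfolding \<Theta>_def using Lc_le Lc0 H2 L23 d by (intro mult_mono power_mono mult_nonneg_nonneg zero_le_power) auto
    also have "\<dots> = (9 * 10 ^ 8 * (200 * d) ^ 14) * (L ^ 14 * \<alpha>\<^sup>2)" by (simp add: power_mult_distrib)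
    also have "\<dots> \<le> (4 / 9 * exp d) * (L ^ 14 * \<alpha>\<^sup>2)"
      using exp_beats_power_14[OF d] L23 by (intro mult_right_mono) auto
    also have "\<dots> \<le> (L\<^sup>2 * exp d) * (L ^ 14 * \<alpha>\<^sup>2)"
    proof (intro mult_right_mono)
      have "(2 / 3)\<^sup>2 \<le> L\<^sup>2" using L23 by (intro power_mono) auto
      then show "4 / 9 \<le> L\<^sup>2" by (simp add: power2_eq_square)
    qed (use L23 in auto)
    also have "\<dots> = D * W" unfolding exp_d W_def by (simp add: eval_nat_numeral)
    finally show ?thesis by (simp add: qD)
  qed
  have c2: "8 * \<Theta> ^ 3 * (real H) ^ 4 \<le> real N"
  proof -
    have "8 * \<Theta> ^ 3 * (real H) ^ 4 = (8 * \<Theta>\<^sup>2 * (real H)\<^sup>2) * (\<Theta> * (real H)\<^sup>2) * 1"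
      by (simp add: eval_nat_numeral)
    also have "\<dots> \<le> (8 * \<Theta>\<^sup>2 * (real H)\<^sup>2) * real q * B"
      using c1 B1 \<Theta>1 by (intro mult_mono mult_left_mono) auto
    finally show ?thesis using N by (simp add: x_def)
  qed
  have \<Theta>H: "\<Theta> * real H \<le> 8 * \<Theta>\<^sup>2 * (real H)\<^sup>2"
  proof -
    have "\<Theta> * real H \<le> \<Theta>\<^sup>2 * (real H)\<^sup>2" using sq1 \<Theta>1 by (intro mult_mono) auto
    moreover have "0 \<le> \<Theta>\<^sup>2 * (real H)\<^sup>2" by simp
    ultimately show ?thesis by linarith
  qed
  have c3: "\<Theta> * real H * real q \<le> real N"
  proof -
    have "\<Theta> * real H * real q \<le> 8 * \<Theta>\<^sup>2 * (real H)\<^sup>2 * real q * 1"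
      using mult_right_mono[OF \<Theta>H, of "real q"] by simp
    also have "\<dots> \<le> x" unfolding x_def using B1 by (intro mult_left_mono) auto
    finally show ?thesis using N by linarith
  qed
  have c4: "\<Theta> * real H * \<beta> \<le> real N"
  proof -
    have "\<Theta> * real H * \<beta> \<le> 8 * \<Theta>\<^sup>2 * (real H)\<^sup>2 * \<beta>" using \<Theta>H \<beta> by (rule mult_right_mono)
    also have "\<dots> \<le> 8 * \<Theta>\<^sup>2 * (real H)\<^sup>2 * (real q * B)"
    proof (rule mult_left_mono)
      have "1 * B \<le> real q * B" using q1 B1 by (intro mult_right_mono) auto
      then show "\<beta> \<le> real q * B" using B1 by linarith
    qed simp
    finally show ?thesis using N by (simp add: x_def mult.assoc)
  qed
  have l1: "1 + ln (real (H * N)) \<le> Lc"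
  proof -
    have \<alpha>3: "\<alpha> ^ 3 * real q * B \<le> (2 * \<alpha> * B * real q) ^ 3"
    proof -
      have B3: "B * 1 \<le> B * B\<^sup>2" "real q * 1 \<le> real q * (real q)\<^sup>2"
        using B1 q1 by (auto intro!: mult_left_mono simp: power2_eq_square mult_ge1_I)
      have "\<alpha> ^ 3 * real q * B \<le> (8 * \<alpha> ^ 3) * (real q * (real q)\<^sup>2) * (B * B\<^sup>2)"
        using \<alpha> B1 B3 by (intro mult_mono) auto
      also have "\<dots> = (2 * \<alpha> * B * real q) ^ 3" by (simp add: eval_nat_numeral)
      finally show ?thesis .
    qed
    have "real (H * N) \<le> (3 * \<alpha>) * (2 * (8 * \<Theta>\<^sup>2 * (9 * \<alpha>\<^sup>2) * real q * B))"
    proof -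
      have "x \<le> 8 * \<Theta>\<^sup>2 * (9 * \<alpha>\<^sup>2) * real q * B"
        unfolding x_def using H2 B1 by (intro mult_right_mono mult_left_mono) auto
      then have "real N \<le> 2 * (8 * \<Theta>\<^sup>2 * (9 * \<alpha>\<^sup>2) * real q * B)" using N by linarith
      then show ?thesis unfolding of_nat_mult using H \<alpha> by (intro mult_mono) auto
    qed
    also have "\<dots> = (432 * \<Theta>\<^sup>2) * (\<alpha> ^ 3 * real q * B)" by (simp add: eval_nat_numeral)
    also have "\<dots> \<le> (432 * \<Theta>\<^sup>2) * (2 * \<alpha> * B * real q) ^ 3" using \<alpha>3 by (intro mult_left_mono) auto
    also have "\<dots> \<le> (2 ^ 300 * y ^ 28) * (2 * \<alpha> * B * real q) ^ 3"
    proof (rule mult_right_mono)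
      have "432 * \<Theta>\<^sup>2 = 432 * 10 ^ 16 * 100 ^ 28 * y ^ 28"
        by (simp add: \<Theta>_def Lc_def power_mult_distrib flip: power_mult)
      also have "\<dots> \<le> 2 ^ 300 * y ^ 28" using y1 by (intro mult_right_mono) auto
      finally show "432 * \<Theta>\<^sup>2 \<le> 2 ^ 300 * y ^ 28" .
    qed (use \<alpha> B1 in simp)
    also have "2 * \<alpha> * B * real q = exp y" unfolding y_def using \<alpha> B1 q1 by simp
    finally have HN: "real (H * N) \<le> 2 ^ 300 * y ^ 28 * exp y ^ 3" .
    have "2 ^ 300 * y ^ 28 * exp y ^ 3 \<le> exp 300 * exp y ^ 28 * exp y ^ 3"
    proof (intro mult_mono power_mono)
      show "y \<le> exp y" using exp_ge_add_one_self[of y] by linarith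
    qed (use y1 two_power_le_exp[of 300 300] in auto)
    also have "\<dots> = exp (300 + 28 * y + 3 * y)"
      using exp_of_nat_mult[of 28 y] exp_of_nat_mult[of 3 y] by (simp only: exp_add of_nat_numeral)
    finally have "real (H * N) \<le> exp (300 + 28 * y + 3 * y)" using HN by linarith
    moreover have "real (H * N) > 0" using H N by simp
    ultimately have "ln (real (H * N)) \<le> ln (exp (300 + 28 * y + 3 * y))"
      by (intro ln_mono)
    then have "ln (real (H * N)) \<le> 300 + 28 * y + 3 * y" by (simp only: ln_exp)
    then show ?thesis using y1 by (simp add: Lc_def)
  qed
  have l2: "harm (2 * q) \<le> Lc"
  proof -
    have "harm (2 * q) \<le> 1 + ln (real (2 * q))" using q1 by (intro harm_le_ln) auto
    also have "ln (real (2 * q)) \<le> y"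
    proof -
      have "1 * real q \<le> (\<alpha> * B) * real q" using \<alpha>B1 by (intro mult_right_mono) auto
      then show ?thesis unfolding y_def using q1 by (intro ln_mono) auto
    qed
    finally show ?thesis using y1 by (simp add: Lc_def)
  qed
  obtain k :: nat where k: "prime k" "k \<le> N" "int k \<in> beatty \<alpha> \<beta>"
    using prime_in_beatty[OF \<alpha> \<beta> ws H_def l1 l2 \<Theta>_def c1 c2 c3 c4] by blast
  have "real N \<le> L powr (35 - 16 * \<epsilon>) * \<alpha> powr (2 * (1 - \<epsilon>)) * B * p powr (1 + \<epsilon>)"
  proof -
    define F :: real where "F = 2 ^ r"
    have F1: "1 \<le> F" unfolding F_def by simp
    have "real N \<le> 2 * x" by (rule N)
    also have "\<dots> \<le> 16 * ((10 ^ 8 * (L * (200 * d)) ^ 14)\<^sup>2) * (9 * \<alpha>\<^sup>2) * real q * B"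
    proof -
      have "\<Theta> \<le> 10 ^ 8 * (L * (200 * d)) ^ 14"
        unfolding \<Theta>_def using Lc_le Lc0 by (intro mult_left_mono power_mono) auto
      then have "\<Theta>\<^sup>2 \<le> (10 ^ 8 * (L * (200 * d)) ^ 14)\<^sup>2" using \<Theta>1 by (intro power_mono) auto
      then have "16 * \<Theta>\<^sup>2 * (real H)\<^sup>2 * real q * B \<le> 16 * ((10 ^ 8 * (L * (200 * d)) ^ 14)\<^sup>2) * (9 * \<alpha>\<^sup>2) * real q * B"
        using H2 B1 by (intro mult_right_mono mult_mono) auto
      then show ?thesis by (simp add: x_def)
    qed
    also have "\<dots> = (144 * 10 ^ 16 * (200 * d) ^ 28) * (L ^ 28 * (\<alpha>\<^sup>2 * real q * B))"
      by (simp add: power_mult_distrib flip: power_mult)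
    also have "\<dots> \<le> ((2 / 3) ^ 7 * F * exp (\<epsilon> * d)) * (L ^ 28 * (\<alpha>\<^sup>2 * real q * B))"
      unfolding F_def using exp_beats_power_28[OF \<epsilon> r, of d] d B1 L23 by (intro mult_right_mono) auto
    also have "\<dots> \<le> (L ^ 7 * F * exp (\<epsilon> * d)) * (L ^ 28 * (\<alpha>\<^sup>2 * real q * B))"
      using L23 F1 B1 by (intro mult_right_mono power_mono mult_nonneg_nonneg) auto
    also have "\<dots> = L ^ 35 * \<alpha>\<^sup>2 * B * (F * real q * exp (\<epsilon> * d))"
    proof -
      have "L ^ 35 = L ^ 7 * L ^ 28" by (simp flip: power_add)
      then show ?thesis by (simp only: mult_ac)
    qed
    also have "exp (\<epsilon> * d) = D powr \<epsilon>" using D0 by (simp add: powr_def d_def)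
    \<comment> \<open>q powr \<epsilon> is D powr \<epsilon> times W powr \<epsilon>; taking the
      latter out of L^35 and \<alpha>^2 leaves the exponents 35 - 16 \<epsilon> and 2 (1 -
      \<epsilon>).\<close>
    also have "L ^ 35 * \<alpha>\<^sup>2 * B * (F * real q * D powr \<epsilon>) = 
       L powr (35 - 16 * \<epsilon>) * \<alpha> powr (2 * (1 - \<epsilon>)) * B * ((F * real q) * real q powr \<epsilon>)"
    proof -
      have L0: "L > 0" using L23 by linarith
      have 1: "real q powr \<epsilon> = D powr \<epsilon> * W powr \<epsilon>" unfolding qD using D0 W by (simp add: powr_mult)
      have 2: "W powr \<epsilon> = L powr (16 * \<epsilon>) * \<alpha> powr (2 * \<epsilon>)"
        unfolding W_def using L0 \<alpha>
        by (simp add: powr_mult powr_powr flip: powr_numeral)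
      have 3: "L ^ 35 = L powr (35 - 16 * \<epsilon>) * L powr (16 * \<epsilon>)"
        using L0 by (simp flip: powr_add powr_numeral)
      have 4: "\<alpha>\<^sup>2 = \<alpha> powr (2 * (1 - \<epsilon>)) * \<alpha> powr (2 * \<epsilon>)"
        using \<alpha> by (simp add: algebra_simps flip: powr_add powr_numeral)
      show ?thesis unfolding 1 2 3 4 by (simp only: mult_ac)
    qed
    also have "\<dots> \<le> L powr (35 - 16 * \<epsilon>) * \<alpha> powr (2 * (1 - \<epsilon>)) * B * (p * p powr \<epsilon>)"
    proof -
      have Fq: "F * real q \<le> p" using p by (simp add: F_def)
      have "1 * real q \<le> F * real q" using F1 by (intro mult_right_mono) auto
      then have "real q powr \<epsilon> \<le> p powr \<epsilon>" using Fq \<epsilon> by (intro powr_mono2) auto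
      then have "(F * real q) * real q powr \<epsilon> \<le> p * p powr \<epsilon>" 
        using Fq q1 order_trans[OF _ Fq, of 0] F1 by (intro mult_mono) auto
      then show ?thesis using B1 by (intro mult_left_mono mult_nonneg_nonneg) auto
    qed
    also have "p * p powr \<epsilon> = p powr (1 + \<epsilon>)"
    proof -
      have "0 < F * real q" using F1 q1 by (intro mult_pos_pos) auto
      then have "p > 0" using p by (simp add: F_def)
      then show ?thesis by (simp add: powr_add)
    qed
    finally show ?thesis .
  qed
  then show ?thesis using k by (intro exI[of _ k]) auto
qed

lemma ex_least_prime_in:
  assumes "prime k" "int k \<in> S"
  obtains p where "is_least_prime_in p S" "p \<le> int k"
proof -
  define n where "n = (LEAST n::nat. prime n \<and> int n \<in> S)"
  have n: "prime n \<and> int n \<in> S" unfolding n_def by (rule LeastI[of _ k]) (use assms in simp)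
  have le: "n \<le> j" if "prime j" "int j \<in> S" for j unfolding n_def by (rule Least_le) (use that in simp)
  have "is_least_prime_in (int n) S"
    unfolding is_least_prime_in_def
  proof (intro conjI ballI impI)
    fix j assume j: "j \<in> S" "prime j"
    then have "0 \<le> j" by (simp add: prime_ge_0_int)
    then have "int (nat j) = j" by simp
    then show "int n \<le> j" using le[of "nat j"] j by (metis of_nat_le_iff prime_int_nat_transfer)
  qed (use n in simp_all)
  then show ?thesis using le[OF assms] that by simp
qed

theorem theorem2:
  fixes \<epsilon> \<alpha> \<beta> M B L :: real and l :: nat and m :: int
  assumes "0 < \<epsilon>" and "\<epsilon> < 44 / 2025"
    and "\<alpha> > 1" and "\<alpha> \<notin> \<rat>" and "\<beta> \<ge> 0"
    and "M > 0"
    and "\<And>x::nat. x \<ge> 1 \<Longrightarrow> real (num_divisors x) \<le> M * real x powr (5 / 4 * \<epsilon>)"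
    and "l = (LEAST k::nat. k \<ge> 1 \<and>
           real k \<ge> 3 + 9 * inverse \<epsilon> *
             (41 + ln (1 + inverse \<epsilon>) + ln (3711 + 2 * inverse (17 ^ 3) * M)))"
    and "B = max 1 \<beta>"
    and "L = ln (2 * \<alpha> * B)"
    and "m \<ge> -1"
    and "real_of_int (conv_num \<alpha> m) \<le> L ^ 16 * \<alpha>\<^sup>2"
    and "L ^ 16 * \<alpha>\<^sup>2 < real_of_int (conv_num \<alpha> (m + 1))"
  shows "\<exists>p. is_least_prime_in p (beatty \<alpha> \<beta>) \<and>
           real_of_int p \<le> L powr (35 - 16 * \<epsilon>) * \<alpha> powr (2 * (1 - \<epsilon>)) * B *
             real_of_int (conv_num \<alpha> (m + int l)) powr (1 + \<epsilon>)"
proof -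
  let ?R = "3 + 9 * inverse \<epsilon> * (41 + ln (1 + inverse \<epsilon>) + ln (3711 + 2 * inverse (17 ^ 3) * M))"
  \<comment> \<open>44 * 46 = 2024 falls just short of 2025.\<close>
  have \<epsilon>: "0 < \<epsilon>" "\<epsilon> < 1 / 46" using assms(1,2) by auto
  obtain k0 where "?R \<le> real k0" using real_arch_simple by blast
  then have "1 \<le> max 1 k0 \<and> ?R \<le> real (max 1 k0)" by (auto simp: max_def)
  then have "1 \<le> l \<and> ?R \<le> real l" unfolding assms(8) by (rule LeastI)
  then have l: "1 \<le> l" "?R \<le> real l" by auto
  \<comment> \<open>The indices m + 1 and m + l differ by l - 1, and a factor 2^r takes 2 r steps;
    each of the two gaps gets one such factor.\<close>
  define r where "r = (l - 1) div 4"
  have r: "60 / \<epsilon> \<le> real r"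
  proof -
    \<comment> \<open>Both logarithms are nonnegative, so l \<ge> 9 * 41 / \<epsilon>. A quarter of
      369 / \<epsilon> exceeds 60 / \<epsilon> by more than the rounding loss of 1.\<close>
    have "2 * inverse (17 ^ 3) * M \<ge> 0" using assms(6) by simp
    then have "ln (3711 + 2 * inverse (17 ^ 3) * M) \<ge> 0" by (intro ln_ge_zero) linarith
    moreover have "ln (1 + inverse \<epsilon>) \<ge> 0" using \<epsilon> by (intro ln_ge_zero) simp
    ultimately have "9 * inverse \<epsilon> * 41 \<le> 9 * inverse \<epsilon> * (41 + ln (1 + inverse \<epsilon>) + ln (3711 + 2 * inverse (17 ^ 3) * M))"
      using \<epsilon> by (intro mult_left_mono) auto
    then have "369 * inverse \<epsilon> \<le> real l" using l(2) by linarith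
    moreover have "real l \<le> 4 * real r + 4" unfolding r_def using l(1) by linarith
    moreover have "inverse \<epsilon> \<ge> 46" using \<epsilon> by (simp add: field_simps)
    ultimately have "60 * inverse \<epsilon> \<le> real r" by linarith
    then show ?thesis by (simp add: divide_inverse)
  qed
  \<comment> \<open>The place of the numerator with index m + 1 in the shifted list. It is at least
    1, so q is a numerator of nonnegative index, as \<open>well_spaced_convergent\<close>
    requires.\<close>
  define s where "s = nat (m + 2)"
  have s: "s \<ge> 1" using assms(11) by (simp add: s_def)
  note irr = assms(4,3)
  define P q where "P = nat (conv_num_shift \<alpha> s)" and "q = nat (conv_num_shift \<alpha> (s + 2 * r))"
  have pos: "conv_num_shift \<alpha> n \<ge> 1" for n using conv_num_shift_growth[OF irr] by blast
  have P: "real P = of_int (conv_num_shift \<alpha> s)" using pos[of s] by (simp add: P_def)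
  have q: "real q = of_int (conv_num_shift \<alpha> (s + 2 * r))" using pos[of "s + 2 * r"] by (simp add: q_def)
  have "well_spaced (1 / \<alpha>) (nat (conv_num_shift \<alpha> (Suc (s - 1 + 2 * r))))" by (rule well_spaced_convergent[OF irr])
  then have ws: "well_spaced (1 / \<alpha>) q" using s by (simp add: q_def)
  have sm: "conv_num \<alpha> (m + 1) = conv_num_shift \<alpha> s"
    by (simp add: conv_num_def s_def add.assoc)
  have sl: "conv_num \<alpha> (m + int l) = conv_num_shift \<alpha> (s + (l - 1))"
  proof -
    have "nat (m + int l + 1) = s + (l - 1)" using l(1) assms(11) by (simp add: s_def nat_eq_iff of_nat_diff)
    then show ?thesis by (simp add: conv_num_def)
  qed
  have Pq: "2 ^ r * real P \<le> real q"
  proof -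
    have "real_of_int (2 ^ r * conv_num_shift \<alpha> s) \<le> of_int (conv_num_shift \<alpha> (s + 2 * r))"
      by (rule of_int_le_iff[THEN iffD2, OF conv_num_shift_double[OF irr]])
    then show ?thesis by (simp add: P q)
  qed
  have qp: "2 ^ r * real q \<le> of_int (conv_num \<alpha> (m + int l))"
  proof -
    have "2 ^ r * conv_num_shift \<alpha> (s + 2 * r) \<le> conv_num_shift \<alpha> (s + 2 * r + 2 * r)"
      by (rule conv_num_shift_double[OF irr])
    also have "\<dots> \<le> conv_num_shift \<alpha> (s + (l - 1))"
      by (rule conv_num_shift_mono[OF irr]) (simp add: r_def)
    finally have "real_of_int (2 ^ r * conv_num_shift \<alpha> (s + 2 * r)) \<le> of_int (conv_num_shift \<alpha> (s + (l - 1)))"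
      by (rule of_int_le_iff[THEN iffD2])
    then show ?thesis by (simp add: q sl)
  qed
  have "1 \<le> P" using pos[of s] by (simp add: P_def)
  moreover have "L ^ 16 * \<alpha>\<^sup>2 < real P" using assms(13) by (simp add: P sm)
  ultimately obtain k where k: "prime k" "int k \<in> beatty \<alpha> \<beta>"
    "real k \<le> L powr (35 - 16 * \<epsilon>) * \<alpha> powr (2 * (1 - \<epsilon>)) * B * of_int (conv_num \<alpha> (m + int l)) powr (1 + \<epsilon>)"
    using prime_in_beatty_parameters[OF assms(3,5,9,10) \<epsilon> r ws _ _ Pq qp] by blast
  then obtain p where p: "is_least_prime_in p (beatty \<alpha> \<beta>)" "p \<le> int k" using ex_least_prime_in by blast
  then have "real_of_int p \<le> real k" by linarith
  then show ?thesis using p k by (intro exI[of _ p]) auto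
qed

end
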